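(* Let $K$ be a field of characteristic $0$, $d\ge2$, and let $\alpha=(\alpha_1,\alpha_2)\in K^2$, $\alpha\neq(0,0)$, with $\alpha_1+\alpha_2=0$. In $G_d(\mathfrak U_\alpha)$ the consequences of degree $n+1$ of the following polynomials of degree $n$ are equivalent to the polynomials listed: (i) The identity $w_{(n)}^{(1)}$, $n\ge1$ (where $w_{(1)}^{(1)}$ means $w_{(1)}=x_1$), implies all polynomials of degree $n+1$. (ii) The identities $w_{(1^2)}^{(0)}$ and $\beta_1w_{(2,1)}^{(1)}+\beta_2w_{(2,1)}^{(0)}$, $(\beta_1,\beta_2)\neq(0,0)$, imply, respectively, $w_{(2,1)}^{(1)},w_{(2,1)}^{(0)}$ and $w_{(2^2)}^{(0)}$ (and their consequences of degree $3$, respectively $4$, are equivalent to these). (iii) $w_{(2^2)}^{(0)}$ has no (nonzero) consequences of higher degree.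
   Context: A bicommutative algebra is a nonassociative $K$-algebra satisfying $(x_1x_2)x_3=(x_1x_3)x_2$ and $x_1(x_2x_3)=x_2(x_1x_3)$; $\mathfrak B$ is the variety of all of them. The free bicommutative algebra $F_d(\mathfrak B)$ on $x_1,\dots,x_d$ is identified (via $x_i\mapsto x_i$) with the algebra $G_d$ having as basis $x_1,\dots,x_d$ together with all monomials $Y^aZ^b=y_1^{a_1}\cdots y_d^{a_d}z_1^{b_1}\cdots z_d^{b_d}$ in the polynomial algebra $K[y_1,\dots,y_d,z_1,\dots,z_d]$ with $|a|\ge1$ and $|b|\ge1$, and multiplication $x_ix_j=y_iz_j$, $x_i(Y^aZ^b)=y_iY^aZ^b$, $(Y^aZ^b)x_i=Y^aZ^bz_i$, $(Y^aZ^b)(Y^cZ^e)=Y^{a+c}Z^{b+e}$. The group $GL_d(K)$ acts on $G_d$ by automorphisms extending its linear action on the span of $x_1,\dots,x_d$. Put $w_{(1)}=x_1$, $w_{(n)}^{(j)}=y_1^jz_1^{n-j}$ ($1\le j\le n-1$), and $w_{(\lambda_1,\lambda_2)}^{(j)}=y_1^j(y_1z_2-y_2z_1)^{\lambda_2}z_1^{\lambda_1-\lambda_2-j}$ for $\lambda_2>0$, $0\le j\le\lambda_1-\lambda_2$; $(1^2)=(1,1)$, $(2^2)=(2,2)$. $\mathfrak U_\alpha$ is the variety of bicommutative algebras defined by the identity $\alpha_1x(xx)+\alpha_2(xx)x=0$, and $G_d(\mathfrak U_\alpha)\cong F_d(\mathfrak U_\alpha)$ is the factor algebra of $G_d$ modulo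 the T-ideal (ideal closed under all endomorphisms) generated by $\alpha_1y_1^2z_1+\alpha_2y_1z_1^2$; elements of $G_d$ denote also their images. For a homogeneous $f$ of degree $n$ in $G_d(\mathfrak U_\alpha)$, its consequences of degree $m>n$ are the elements of the degree $m$ homogeneous component of the T-ideal of $G_d(\mathfrak U_\alpha)$ generated by $f$ (one says $f$ implies these elements). The consequences of degree $n+1$ are "equivalent to" a list of polynomials if the degree $n+1$ component equals the $GL_d(K)$-submodule generated by the list. *)

theory Defs
  imports
    "HOL-Library.Poly_Mapping"
    "HOL-Library.Product_Plus"
    "Jordan_Normal_Form.Matrix"
begin

section \<open>Nonassociative algebras over a field\<close>

record ('k, 'a) nalg =
  ncarrier :: "'a set"
  nadd :: "'a \<Rightarrow> 'a \<Rightarrow> 'a"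
  nzero :: 'a
  nsmult :: "'k \<Rightarrow> 'a \<Rightarrow> 'a"
  nmult :: "'a \<Rightarrow> 'a \<Rightarrow> 'a"

definition nsubspace :: "('k, 'a) nalg \<Rightarrow> 'a set \<Rightarrow> bool" where
  "nsubspace A N \<longleftrightarrow>
     N \<subseteq> ncarrier A \<and> nzero A \<in> N \<and>
     (\<forall>x\<in>N. \<forall>y\<in>N. nadd A x y \<in> N) \<and>
     (\<forall>c. \<forall>x\<in>N. nsmult A c x \<in> N)"

definition nideal :: "('k, 'a) nalg \<Rightarrow> 'a set \<Rightarrow> bool" where
  "nideal A N \<longleftrightarrow>
     nsubspace A N \<and>
     (\<forall>a\<in>ncarrier A. \<forall>x\<in>N. nmult A a x \<in> N \<and> nmult A x a \<in> N)"

definition nendo :: "('k, 'a) nalg \<Rightarrow> ('a \<Rightarrow> 'a) \<Rightarrow> bool" where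
  "nendo A \<phi> \<longleftrightarrow>
     (\<forall>x\<in>ncarrier A. \<phi> x \<in> ncarrier A) \<and>
     (\<forall>x\<in>ncarrier A. \<forall>y\<in>ncarrier A. \<phi> (nadd A x y) = nadd A (\<phi> x) (\<phi> y)) \<and>
     (\<forall>c. \<forall>x\<in>ncarrier A. \<phi> (nsmult A c x) = nsmult A c (\<phi> x)) \<and>
     (\<forall>x\<in>ncarrier A. \<forall>y\<in>ncarrier A. \<phi> (nmult A x y) = nmult A (\<phi> x) (\<phi> y))"

definition nauto :: "('k, 'a) nalg \<Rightarrow> ('a \<Rightarrow> 'a) \<Rightarrow> bool" where
  "nauto A \<phi> \<longleftrightarrow> nendo A \<phi> \<and> bij_betw \<phi> (ncarrier A) (ncarrier A)"

definition T_ideal :: "('k, 'a) nalg \<Rightarrow> 'a set \<Rightarrow> bool" where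
  "T_ideal A N \<longleftrightarrow> nideal A N \<and> (\<forall>\<phi>. nendo A \<phi> \<longrightarrow> \<phi> ` N \<subseteq> N)"

definition T_ideal_gen :: "('k, 'a) nalg \<Rightarrow> 'a set \<Rightarrow> 'a set" where
  "T_ideal_gen A S = \<Inter>{N. T_ideal A N \<and> S \<subseteq> N}"

definition ncoset :: "('k, 'a) nalg \<Rightarrow> 'a set \<Rightarrow> 'a \<Rightarrow> 'a set" where
  "ncoset A I a = nadd A a ` I"

text \<open>The factor algebra on cosets, with each operation given by all representatives at once.\<close>

definition nquot :: "('k, 'a) nalg \<Rightarrow> 'a set \<Rightarrow> ('k, 'a set) nalg" where
  "nquot A I =
     \<lparr> ncarrier = ncoset A I ` ncarrier A,
       nadd = (\<lambda>X Y. \<Union>x\<in>X. \<Union>y\<in>Y. ncoset A I (nadd A x y)),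
       nzero = I,
       nsmult = (\<lambda>c X. \<Union>x\<in>X. ncoset A I (nsmult A c x)),
       nmult = (\<lambda>X Y. \<Union>x\<in>X. \<Union>y\<in>Y. ncoset A I (nmult A x y)) \<rparr>"


section \<open>The algebra \<open>G\<^sub>d\<close>\<close>

text \<open>
  The key \<open>(a, b)\<close> stands for the monomial \<open>Y\<^sup>a Z\<^sup>b\<close>. An element of \<open>G\<^sub>d\<close> is a pair of a linear
  combination of the \<open>x\<^sub>i\<close> (key \<open>i\<close>) and a polynomial in the \<open>y\<^sub>i\<close>, \<open>z\<^sub>i\<close>. Indices run over
  \<open>1, \<dots>, d\<close>.
\<close>

type_synonym yz_monom = "(nat \<Rightarrow>\<^sub>0 nat) \<times> (nat \<Rightarrow>\<^sub>0 nat)"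
type_synonym 'k yz_poly = "yz_monom \<Rightarrow>\<^sub>0 'k"
type_synonym 'k gelem = "(nat \<Rightarrow>\<^sub>0 'k) \<times> 'k yz_poly"

definition exp_size :: "(nat \<Rightarrow>\<^sub>0 nat) \<Rightarrow> nat" where
  "exp_size a = (\<Sum>i\<in>Poly_Mapping.keys a. Poly_Mapping.lookup a i)"

definition yvar :: "nat \<Rightarrow> 'k::comm_ring_1 yz_poly" where
  "yvar i = Poly_Mapping.single (Poly_Mapping.single i 1, 0) 1"

definition zvar :: "nat \<Rightarrow> 'k::comm_ring_1 yz_poly" where
  "zvar i = Poly_Mapping.single (0, Poly_Mapping.single i 1) 1"

definition xgen :: "nat \<Rightarrow> 'k::comm_ring_1 gelem" where
  "xgen i = (Poly_Mapping.single i 1, 0)"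

definition gcarrier :: "nat \<Rightarrow> 'k::comm_ring_1 gelem set" where
  "gcarrier d = {(u, f).
     Poly_Mapping.keys u \<subseteq> {1..d} \<and>
     (\<forall>(a, b)\<in>Poly_Mapping.keys f.
        Poly_Mapping.keys a \<subseteq> {1..d} \<and> Poly_Mapping.keys b \<subseteq> {1..d} \<and>
        exp_size a \<ge> 1 \<and> exp_size b \<ge> 1)}"

definition gsmult :: "'k::comm_ring_1 \<Rightarrow> 'k gelem \<Rightarrow> 'k gelem" where
  "gsmult c p = (Poly_Mapping.map ((*) c) (fst p), Poly_Mapping.map ((*) c) (snd p))"

text \<open>
  In a product, a left factor \<open>x\<^sub>i\<close> acts as \<open>y\<^sub>i\<close> and a right factor \<open>x\<^sub>i\<close> as \<open>z\<^sub>i\<close>; the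
  multiplication table on the basis is recovered in the lemmas below.
\<close>

definition left_poly :: "'k::comm_ring_1 gelem \<Rightarrow> 'k yz_poly" where
  "left_poly p =
     (\<Sum>i\<in>Poly_Mapping.keys (fst p).
        Poly_Mapping.single (Poly_Mapping.single i 1, 0) (Poly_Mapping.lookup (fst p) i)) + snd p"

definition right_poly :: "'k::comm_ring_1 gelem \<Rightarrow> 'k yz_poly" where
  "right_poly p =
     (\<Sum>i\<in>Poly_Mapping.keys (fst p).
        Poly_Mapping.single (0, Poly_Mapping.single i 1) (Poly_Mapping.lookup (fst p) i)) + snd p"

definition gmult :: "'k::comm_ring_1 gelem \<Rightarrow> 'k gelem \<Rightarrow> 'k gelem" where
  "gmult p q = (0, left_poly p * right_poly q)"

definition G_alg :: "nat \<Rightarrow> ('k::comm_ring_1, 'k gelem) nalg" where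
  "G_alg d =
     \<lparr> ncarrier = gcarrier d, nadd = (+), nzero = 0, nsmult = gsmult, nmult = gmult \<rparr>"

lemma left_poly_xgen: "left_poly (xgen i) = yvar i"
  by (simp add: left_poly_def xgen_def yvar_def)

lemma right_poly_xgen: "right_poly (xgen i) = zvar i"
  by (simp add: right_poly_def xgen_def zvar_def)

lemma left_poly_poly: "left_poly (0, f) = f"
  by (simp add: left_poly_def)

lemma right_poly_poly: "right_poly (0, f) = f"
  by (simp add: right_poly_def)

lemma gmult_basis:
  "gmult (xgen i) (xgen j) = (0, yvar i * zvar j)"
  "gmult (xgen i) (0, f) = (0, yvar i * f)"
  "gmult (0, f) (xgen i) = (0, f * zvar i)"
  "gmult (0, f) (0, g) = (0, f * g)"
  by (simp_all add: gmult_def left_poly_xgen right_poly_xgen left_poly_poly right_poly_poly)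

lemma gmult_bicommutative:
  "gmult (gmult p q) r = gmult (gmult p r) q"
  "gmult p (gmult q r) = gmult q (gmult p r)"
  by (simp_all add: gmult_def left_poly_poly right_poly_poly ac_simps)

definition gcomponent :: "nat \<Rightarrow> nat \<Rightarrow> 'k::comm_ring_1 gelem set" where
  "gcomponent d m = {(u, f). (u, f) \<in> gcarrier d \<and>
     (u \<noteq> 0 \<longrightarrow> m = 1) \<and> (\<forall>(a, b)\<in>Poly_Mapping.keys f. exp_size a + exp_size b = m)}"

text \<open>
  \<open>GL_action d M \<phi>\<close>: \<open>\<phi>\<close> is the automorphism of \<open>G\<^sub>d\<close> extending the linear map with matrix \<open>M\<close>
  on the span of the \<open>x\<^sub>i\<close>. Matrix indices start at 0.
\<close>

definition GL_action :: "nat \<Rightarrow> 'k::comm_ring_1 mat \<Rightarrow> ('k gelem \<Rightarrow> 'k gelem) \<Rightarrow> bool" where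
  "GL_action d M \<phi> \<longleftrightarrow>
     nauto (G_alg d) \<phi> \<and>
     (\<forall>j\<in>{1..d}. \<phi> (xgen j) = (\<Sum>i\<in>{1..d}. gsmult (M $$ (i - 1, j - 1)) (xgen i)))"

definition w_one :: "nat \<Rightarrow> nat \<Rightarrow> 'k::comm_ring_1 gelem" where
  "w_one n j = (if n = 1 then xgen 1 else (0, yvar 1 ^ j * zvar 1 ^ (n - j)))"

definition w_two :: "nat \<Rightarrow> nat \<Rightarrow> nat \<Rightarrow> 'k::comm_ring_1 gelem" where
  "w_two l1 l2 j =
     (0, yvar 1 ^ j * (yvar 1 * zvar 2 - yvar 2 * zvar 1) ^ l2 * zvar 1 ^ (l1 - l2 - j))"


section \<open>The relatively free algebra \<open>G\<^sub>d(\<UU>\<^sub>\<alpha>)\<close>\<close>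

text \<open>In the following, \<open>\<alpha>\<close> is the pair \<open>(\<alpha>\<^sub>1, \<alpha>\<^sub>2)\<close>.\<close>

definition U_ideal :: "nat \<Rightarrow> 'k::field \<times> 'k \<Rightarrow> 'k gelem set" where
  "U_ideal d \<alpha> = T_ideal_gen (G_alg d)
     {gsmult (fst \<alpha>) (0, yvar 1 ^ 2 * zvar 1) + gsmult (snd \<alpha>) (0, yvar 1 * zvar 1 ^ 2)}"

definition GU_alg :: "nat \<Rightarrow> 'k::field \<times> 'k \<Rightarrow> ('k, 'k gelem set) nalg" where
  "GU_alg d \<alpha> = nquot (G_alg d) (U_ideal d \<alpha>)"

definition GU_image :: "nat \<Rightarrow> 'k::field \<times> 'k \<Rightarrow> 'k gelem \<Rightarrow> 'k gelem set" where
  "GU_image d \<alpha> = ncoset (G_alg d) (U_ideal d \<alpha>)"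

definition GU_component :: "nat \<Rightarrow> 'k::field \<times> 'k \<Rightarrow> nat \<Rightarrow> 'k gelem set set" where
  "GU_component d \<alpha> m = GU_image d \<alpha> ` gcomponent d m"

definition consequences ::
  "nat \<Rightarrow> 'k::field \<times> 'k \<Rightarrow> 'k gelem \<Rightarrow> nat \<Rightarrow> 'k gelem set set" where
  "consequences d \<alpha> f m = T_ideal_gen (GU_alg d \<alpha>) {GU_image d \<alpha> f} \<inter> GU_component d \<alpha> m"

definition GL_submodule :: "nat \<Rightarrow> 'k::field \<times> 'k \<Rightarrow> 'k gelem set set \<Rightarrow> bool" where
  "GL_submodule d \<alpha> N \<longleftrightarrow>
     nsubspace (GU_alg d \<alpha>) N \<and>
     (\<forall>M \<phi>. M \<in> carrier_mat d d \<and> invertible_mat M \<and> GL_action d M \<phi> \<longrightarrow>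
        (\<forall>g\<in>gcarrier d. GU_image d \<alpha> g \<in> N \<longrightarrow> GU_image d \<alpha> (\<phi> g) \<in> N))"

definition GL_submodule_gen ::
  "nat \<Rightarrow> 'k::field \<times> 'k \<Rightarrow> 'k gelem set \<Rightarrow> 'k gelem set set" where
  "GL_submodule_gen d \<alpha> S = \<Inter>{N. GL_submodule d \<alpha> N \<and> GU_image d \<alpha> ` S \<subseteq> N}"

end

theory Submission
  imports Defs "Jordan_Normal_Form.Gauss_Jordan_Elimination"
begin

text \<open>
  Let \<open>merge\<close> be the substitution \<open>z\<^sub>i \<mapsto> y\<^sub>i\<close>. Its kernel in \<open>G\<^sub>d\<close> is a T-ideal containing
  \<open>x(xx) - (xx)x\<close>, which bounds from above the consequences of each polynomial in (ii) and (iii).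

  Polarizing \<open>y\<^sub>1z\<^sub>1(y\<^sub>1 - z\<^sub>1)\<close>, with elements of degree 1 and of higher degree substituted for
  \<open>x\<^sub>1\<close>, shows that the T-ideal of the variety contains \<open>f(y\<^sub>ky\<^sub>l - z\<^sub>kz\<^sub>l)\<close> and \<open>fg(y\<^sub>k - z\<^sub>k)\<close> for
  \<open>f\<close>, \<open>g\<close> without linear part. Hence it contains the whole kernel of \<open>merge\<close> in degrees at least 5,
  while in degrees 3 and 4 the kernel modulo the T-ideal is spanned by the elements
  \<open>y\<^sub>k[i,j]\<close>, \<open>z\<^sub>k[i,j]\<close> and \<open>[i,j][k,l]\<close>, where \<open>[i,j] = y\<^sub>iz\<^sub>j - y\<^sub>jz\<^sub>i\<close>. Transvections together with the
  Jacobi and Pluecker relations generate these from \<open>y\<^sub>1[1,2]\<close>, \<open>z\<^sub>1[1,2]\<close> and \<open>[1,2][1,2]\<close>.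
\<close>

section \<open>Monomials and polynomials\<close>

text \<open>The obstacle is degree 4. The relation f(y_k y_l - z_k z_l) preserves the parity of the
  number of y's, and the relation fg(y_k - z_k), which changes it, needs two factors of degree at
  least 2 and so starts in degree 5. In degree 4 the monomials with two y's are tied to the others
  only by consequences of the polarized cubic with several terms, so degrees 3 and 4 are computed
  separately.

  Part (i) asks for everything of degree n + 1, so every monomial must be produced. For n at least
  4, monomials of equal content are congruent; linear forms are substituted in y_1 z_1^(n-1) and
  coefficients extracted. For n = 1, 2, 3 the monomials are obtained by explicit combinations.

  Consequences are defined in the factor algebra but computed in G_d: freeness lifts endomorphisms
  of the factor algebra, so its T-ideals correspond to T-ideals of G_d above the ideal of the
  variety. Membership thereby becomes a statement about an arbitrary such T-ideal J. Characteristic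
  0 enters through division by 2, by 3 and by binomial coefficients.\<close>

definition delta :: "nat \<Rightarrow> (nat \<Rightarrow>\<^sub>0 nat)" where
  "delta i = Poly_Mapping.single i 1"

abbreviation cst :: "'k::comm_ring_1 \<Rightarrow> 'k yz_poly" where
  "cst c \<equiv> Poly_Mapping.single 0 c"

abbreviation yzmon :: "(nat \<Rightarrow>\<^sub>0 nat) \<Rightarrow> (nat \<Rightarrow>\<^sub>0 nat) \<Rightarrow> 'k::comm_ring_1 yz_poly" where
  "yzmon a b \<equiv> Poly_Mapping.single (a, b) 1"

lemma keys_nat_add:
  fixes a b :: "nat \<Rightarrow>\<^sub>0 nat"
  shows "Poly_Mapping.keys (a + b) = Poly_Mapping.keys a \<union> Poly_Mapping.keys b"
  by (auto simp: in_keys_iff lookup_add)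

lemma exp_size_superset:
  assumes "finite A" "Poly_Mapping.keys a \<subseteq> A"
  shows "exp_size a = (\<Sum>i\<in>A. Poly_Mapping.lookup a i)"
  unfolding exp_size_def
  by (rule sum.mono_neutral_left) (use assms in \<open>auto simp: in_keys_iff\<close>)

lemma exp_size_add [simp]: "exp_size (a + b) = exp_size a + exp_size b"
proof -
  let ?A = "Poly_Mapping.keys a \<union> Poly_Mapping.keys b"
  have "exp_size (a + b) = (\<Sum>i\<in>?A. Poly_Mapping.lookup (a + b) i)"
    by (rule exp_size_superset) (auto simp: keys_nat_add)
  also have "\<dots> = exp_size a + exp_size b"
    by (simp add: lookup_add sum.distrib exp_size_superset[of ?A a] exp_size_superset[of ?A b])
  finally show ?thesis .
qed

lemma exp_size_zero [simp]: "exp_size 0 = 0"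
  by (simp add: exp_size_def)

lemma exp_size_single [simp]: "exp_size (Poly_Mapping.single i n) = n"
  by (cases "n = 0") (simp_all add: exp_size_def)

lemma exp_size_delta [simp]: "exp_size (delta i) = 1"
  by (simp add: delta_def)

lemma keys_delta [simp]: "Poly_Mapping.keys (delta i) = {i}"
  by (simp add: delta_def)

lemma exp_size_eq_0_iff [simp]: "exp_size a = 0 \<longleftrightarrow> a = 0"
proof
  assume "exp_size a = 0"
  then have "Poly_Mapping.lookup a i = 0" for i
    by (cases "i \<in> Poly_Mapping.keys a") (auto simp: exp_size_def in_keys_iff)
  then show "a = 0" by (intro poly_mapping_eqI) simp
qed simp

lemma split_delta:
  assumes "i \<in> Poly_Mapping.keys a"
  obtains a' where "a = delta i + a'"
proof
  show "a = delta i + (a - delta i)"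
    by (rule poly_mapping_eqI)
      (use assms in \<open>auto simp: lookup_add lookup_minus lookup_single when_def in_keys_iff delta_def\<close>)
qed

lemma exp_size_SucE:
  assumes "exp_size a = Suc n"
  obtains i a' where "a = delta i + a'" "exp_size a' = n"
proof -
  have "a \<noteq> 0" using assms by auto
  then obtain i where "i \<in> Poly_Mapping.keys a"
    by (metis in_keys_iff lookup_zero poly_mapping_eqI)
  then obtain a' where "a = delta i + a'" by (rule split_delta)
  with assms that show thesis by auto
qed

lemma delta_add_eqE:
  assumes "delta i + a = delta j + b" "i \<noteq> j"
  obtains c where "a = delta j + c" "b = delta i + c"
proof -
  have "j \<in> Poly_Mapping.keys (delta i + a)" unfolding assms(1) keys_nat_add by simp
  then have "j \<in> Poly_Mapping.keys a" using assms(2) by (auto simp: keys_nat_add)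
  then obtain c where c: "a = delta j + c" by (rule split_delta)
  have "delta j + b = delta j + (delta i + c)"
    using assms(1) unfolding c by (simp add: ac_simps)
  then have "b = delta i + c" by (rule add_left_imp_eq)
  with c that show thesis by blast
qed

lemma cst_mult: "cst (c * c') = cst c * cst c'"
  by (simp add: mult_single)

lemma cst_mult_yzmon: "cst c * yzmon a b = Poly_Mapping.single (a, b) c"
  by (simp add: mult_single)

lemma yzmon_delta_left: "yzmon (delta i + a) b = yvar i * yzmon a b"
  by (simp add: yvar_def delta_def mult_single)

lemma yzmon_delta_right: "yzmon a (delta i + b) = zvar i * yzmon a b"
  by (simp add: zvar_def delta_def mult_single)

lemma yzmon_delta: "yzmon (delta i) (delta j) = yvar i * zvar j"
  by (simp add: yvar_def zvar_def delta_def mult_single)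

lemma poly_sum_mon:
  assumes "finite A" "Poly_Mapping.keys f \<subseteq> A"
  shows "f = (\<Sum>k\<in>A. cst (Poly_Mapping.lookup f k) * yzmon (fst k) (snd k))"
proof (rule poly_mapping_eqI)
  fix k
  have "(\<Sum>x\<in>A. Poly_Mapping.lookup f x when x = k) = Poly_Mapping.lookup f k"
  proof (cases "k \<in> A")
    case True
    then show ?thesis using assms by (simp add: when_def if_distrib cong: if_cong)
  next
    case False
    then have "Poly_Mapping.lookup f k = 0" using assms by (auto simp: in_keys_iff)
    with False show ?thesis by (auto simp: when_def intro!: sum.neutral)
  qed
  then show "Poly_Mapping.lookup f k =
      Poly_Mapping.lookup (\<Sum>k\<in>A. cst (Poly_Mapping.lookup f k) * yzmon (fst k) (snd k)) k"
    by (simp add: lookup_sum mult_single lookup_single)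
qed

text \<open>The terms are added along the fixed support of f, so \<open>R\<close> is known for every
  monomial that is added, whatever shape the partial sums have.\<close>

lemma poly_mon_induct [case_names keys zero add]:
  assumes "\<And>a b. (a, b) \<in> Poly_Mapping.keys f \<Longrightarrow> R a b"
    and "P 0"
    and "\<And>g c a b. P g \<Longrightarrow> R a b \<Longrightarrow> P (cst c * yzmon a b + g)"
  shows "P f"
proof -
  have "P (\<Sum>k\<in>B. cst (Poly_Mapping.lookup f k) * yzmon (fst k) (snd k))"
    if "finite B" "B \<subseteq> Poly_Mapping.keys f" for B
    using that by (induction B) (use assms in auto)
  from this[of "Poly_Mapping.keys f"] show ?thesis
    using poly_sum_mon[of "Poly_Mapping.keys f" f] by simp
qed

section \<open>Substitution homomorphisms\<close>

definition msubst ::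
  "(nat \<Rightarrow> 'k::comm_ring_1 yz_poly) \<Rightarrow> (nat \<Rightarrow> 'k yz_poly) \<Rightarrow> yz_monom \<Rightarrow> 'k yz_poly" where
  "msubst r s k =
     (\<Prod>i\<in>Poly_Mapping.keys (fst k). r i ^ Poly_Mapping.lookup (fst k) i) *
     (\<Prod>i\<in>Poly_Mapping.keys (snd k). s i ^ Poly_Mapping.lookup (snd k) i)"

text \<open>The evaluation homomorphism of K[Y, Z] at y_i -> \<open>r i\<close>, z_i ->
  \<open>s i\<close>. It is set up on the whole polynomial ring, constants included, so that
  multiplicativity holds without side conditions.\<close>

definition psubst ::
  "(nat \<Rightarrow> 'k::comm_ring_1 yz_poly) \<Rightarrow> (nat \<Rightarrow> 'k yz_poly) \<Rightarrow> 'k yz_poly \<Rightarrow> 'k yz_poly" where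
  "psubst r s f = (\<Sum>k\<in>Poly_Mapping.keys f. cst (Poly_Mapping.lookup f k) * msubst r s k)"

lemma prod_power_superset:
  fixes r :: "nat \<Rightarrow> 'a::comm_monoid_mult"
  assumes "finite A" "Poly_Mapping.keys a \<subseteq> A"
  shows "(\<Prod>i\<in>Poly_Mapping.keys a. r i ^ Poly_Mapping.lookup a i)
    = (\<Prod>i\<in>A. r i ^ Poly_Mapping.lookup a i)"
  by (rule prod.mono_neutral_left) (use assms in \<open>auto simp: in_keys_iff\<close>)

lemma prod_power_add:
  fixes r :: "nat \<Rightarrow> 'a::comm_monoid_mult"
  shows "(\<Prod>i\<in>Poly_Mapping.keys (a + b). r i ^ Poly_Mapping.lookup (a + b) i)
    = (\<Prod>i\<in>Poly_Mapping.keys a. r i ^ Poly_Mapping.lookup a i) *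
      (\<Prod>i\<in>Poly_Mapping.keys b. r i ^ Poly_Mapping.lookup b i)"
proof -
  let ?A = "Poly_Mapping.keys a \<union> Poly_Mapping.keys b"
  have *: "finite ?A" "Poly_Mapping.keys a \<subseteq> ?A" "Poly_Mapping.keys b \<subseteq> ?A" by auto
  show ?thesis
    unfolding prod_power_superset[OF *(1,2)] prod_power_superset[OF *(1,3)] keys_nat_add
    by (simp add: lookup_add power_add prod.distrib)
qed

lemma msubst_add: "msubst r s (k + l) = msubst r s k * msubst r s l"
  by (simp add: msubst_def prod_power_add ac_simps)

lemma psubst_superset:
  assumes "finite A" "Poly_Mapping.keys f \<subseteq> A"
  shows "psubst r s f = (\<Sum>k\<in>A. cst (Poly_Mapping.lookup f k) * msubst r s k)"
  unfolding psubst_def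
  by (rule sum.mono_neutral_left) (use assms in \<open>auto simp: in_keys_iff\<close>)

lemma psubst_add [simp]: "psubst r s (f + g) = psubst r s f + psubst r s g"
proof -
  let ?A = "Poly_Mapping.keys f \<union> Poly_Mapping.keys g"
  have *: "finite ?A" "Poly_Mapping.keys f \<subseteq> ?A" "Poly_Mapping.keys g \<subseteq> ?A"
    "Poly_Mapping.keys (f + g) \<subseteq> ?A" using keys_add[of f g] by auto
  show ?thesis
    unfolding psubst_superset[OF *(1,2)] psubst_superset[OF *(1,3)] psubst_superset[OF *(1,4)]
    by (simp add: lookup_add single_add ring_distribs sum.distrib)
qed

lemma psubst_zero [simp]: "psubst r s 0 = 0"
  by (simp add: psubst_def)

lemma psubst_single: "psubst r s (Poly_Mapping.single k c) = cst c * msubst r s k"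
  by (cases "c = 0") (simp_all add: psubst_def)

lemma psubst_cst [simp]: "psubst r s (cst c) = cst c"
  by (simp add: psubst_single msubst_def)

lemma psubst_one [simp]: "psubst r s 1 = 1"
  using psubst_cst[of r s 1] by simp

lemma psubst_yvar [simp]: "psubst r s (yvar i) = r i"
  by (simp add: yvar_def psubst_single msubst_def)

lemma psubst_zvar [simp]: "psubst r s (zvar i) = s i"
  by (simp add: zvar_def psubst_single msubst_def)

lemma psubst_mult [simp]: "psubst r s (f * g) = psubst r s f * psubst r s g"
proof -
  have *: "psubst r s (cst c * yzmon a b * g) = psubst r s (cst c * yzmon a b) * psubst r s g"
    for c a b and g :: "'a yz_poly"
  proof (induction g rule: poly_mon_induct[where R = "\<lambda>_ _. True"])
    case (add g c' a' b')
    have "psubst r s (cst c * yzmon a b * (cst c' * yzmon a' b'))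
        = psubst r s (cst c * yzmon a b) * psubst r s (cst c' * yzmon a' b')"
      unfolding cst_mult_yzmon
      unfolding mult_single psubst_single msubst_add
      unfolding cst_mult by (simp only: ac_simps)
    with add show ?case by (simp add: distrib_left)
  qed simp_all
  show ?thesis
  proof (induction f rule: poly_mon_induct[where R = "\<lambda>_ _. True"])
    case (add f c a b)
    then show ?case by (simp only: distrib_right psubst_add *)
  qed simp_all
qed

lemma psubst_minus [simp]: "psubst r s (- f) = - psubst r s f"
  using psubst_add[of r s f "- f"] by (simp add: eq_neg_iff_add_eq_0 add.commute)

lemma psubst_diff [simp]: "psubst r s (f - g) = psubst r s f - psubst r s g"
  using psubst_add[of r s f "- g"] by simp

lemma psubst_power [simp]: "psubst r s (f ^ n) = psubst r s f ^ n"
  by (induction n) simp_all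

lemma psubst_sum [simp]: "psubst r s (sum f A) = (\<Sum>i\<in>A. psubst r s (f i))"
  by (induction A rule: infinite_finite_induct) simp_all

lemma psubst_prod [simp]: "psubst r s (prod f A) = (\<Prod>i\<in>A. psubst r s (f i))"
  by (induction A rule: infinite_finite_induct) simp_all

lemma psubst_psubst:
  "psubst r s (psubst r' s' f) = psubst (\<lambda>i. psubst r s (r' i)) (\<lambda>i. psubst r s (s' i)) f"
  by (simp add: psubst_def[of r' s'] psubst_def[of "\<lambda>i. psubst r s (r' i)"] msubst_def)

section \<open>Endomorphisms of \<open>G\<^sub>d\<close>\<close>

lemma lookup_map_mult [simp]:
  "Poly_Mapping.lookup (Poly_Mapping.map ((*) c) u) i
    = (c::'k::comm_ring_1) * Poly_Mapping.lookup u i"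
  by (simp add: map.rep_eq when_def)

lemma fst_gsmult: "fst (gsmult c p) = Poly_Mapping.map ((*) c) (fst p)"
  by (simp add: gsmult_def)

lemma snd_gsmult: "snd (gsmult c p) = cst c * snd p"
  by (simp add: gsmult_def mult_map_scale_conv_mult)

lemma gsmult_pair: "gsmult c (0, f) = (0, cst c * f)"
  by (simp add: prod_eq_iff fst_gsmult snd_gsmult) (rule poly_mapping_eqI, simp)

lemma gsmult_one [simp]: "gsmult 1 p = p"
  by (simp add: prod_eq_iff fst_gsmult snd_gsmult) (rule poly_mapping_eqI, simp)

lemma gsmult_zero_left [simp]: "gsmult 0 p = 0"
  by (simp add: prod_eq_iff fst_gsmult snd_gsmult) (rule poly_mapping_eqI, simp)

lemma gsmult_zero [simp]: "gsmult c 0 = 0"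
  by (simp add: prod_eq_iff fst_gsmult snd_gsmult) (rule poly_mapping_eqI, simp)

lemma gsmult_minus_one: "gsmult (- 1) p = - p"
  by (simp add: prod_eq_iff fst_gsmult snd_gsmult single_uminus)
    (rule poly_mapping_eqI, simp)

lemma gsmult_add: "gsmult c (p + q) = gsmult c p + gsmult c q"
  by (simp add: prod_eq_iff fst_gsmult snd_gsmult ring_distribs)
    (rule poly_mapping_eqI, simp add: lookup_add ring_distribs)

lemma gsmult_add_left: "gsmult (b + c) p = gsmult b p + gsmult c p"
  by (simp add: prod_eq_iff fst_gsmult snd_gsmult ring_distribs single_add)
    (rule poly_mapping_eqI, simp add: lookup_add ring_distribs)

lemma gsmult_gsmult: "gsmult b (gsmult c p) = gsmult (b * c) p"
  by (simp add: prod_eq_iff fst_gsmult snd_gsmult cst_mult mult.assoc)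
    (rule poly_mapping_eqI, simp add: mult.assoc)

lemma gsmult_sum: "gsmult c (sum f A) = (\<Sum>i\<in>A. gsmult c (f i))"
  by (induction A rule: infinite_finite_induct) (simp_all add: gsmult_add)

lemma left_poly_superset:
  assumes "finite A" "Poly_Mapping.keys (fst p) \<subseteq> A"
  shows "left_poly p = (\<Sum>i\<in>A. cst (Poly_Mapping.lookup (fst p) i) * yvar i) + snd p"
proof -
  have "left_poly p =
      (\<Sum>i\<in>Poly_Mapping.keys (fst p). cst (Poly_Mapping.lookup (fst p) i) * yvar i) + snd p"
    by (simp add: left_poly_def yvar_def mult_single)
  also have "(\<Sum>i\<in>Poly_Mapping.keys (fst p). cst (Poly_Mapping.lookup (fst p) i) * yvar i)
      = (\<Sum>i\<in>A. cst (Poly_Mapping.lookup (fst p) i) * yvar i)"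
    by (rule sum.mono_neutral_left) (use assms in \<open>auto simp: in_keys_iff\<close>)
  finally show ?thesis .
qed

lemma right_poly_superset:
  assumes "finite A" "Poly_Mapping.keys (fst p) \<subseteq> A"
  shows "right_poly p = (\<Sum>i\<in>A. cst (Poly_Mapping.lookup (fst p) i) * zvar i) + snd p"
proof -
  have "right_poly p =
      (\<Sum>i\<in>Poly_Mapping.keys (fst p). cst (Poly_Mapping.lookup (fst p) i) * zvar i) + snd p"
    by (simp add: right_poly_def zvar_def mult_single)
  also have "(\<Sum>i\<in>Poly_Mapping.keys (fst p). cst (Poly_Mapping.lookup (fst p) i) * zvar i)
      = (\<Sum>i\<in>A. cst (Poly_Mapping.lookup (fst p) i) * zvar i)"
    by (rule sum.mono_neutral_left) (use assms in \<open>auto simp: in_keys_iff\<close>)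
  finally show ?thesis .
qed

lemma left_poly_add [simp]: "left_poly (p + q) = left_poly p + left_poly q"
  and right_poly_add [simp]: "right_poly (p + q) = right_poly p + right_poly q"
proof -
  let ?A = "Poly_Mapping.keys (fst p) \<union> Poly_Mapping.keys (fst q)"
  have *: "finite ?A" "Poly_Mapping.keys (fst p) \<subseteq> ?A" "Poly_Mapping.keys (fst q) \<subseteq> ?A"
    "Poly_Mapping.keys (fst (p + q)) \<subseteq> ?A" using keys_add[of "fst p" "fst q"] by auto
  show "left_poly (p + q) = left_poly p + left_poly q"
    unfolding left_poly_superset[OF *(1,2)] left_poly_superset[OF *(1,3)]
      left_poly_superset[OF *(1,4)]
    by (simp add: lookup_add single_add ring_distribs sum.distrib)
  show "right_poly (p + q) = right_poly p + right_poly q"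
    unfolding right_poly_superset[OF *(1,2)] right_poly_superset[OF *(1,3)]
      right_poly_superset[OF *(1,4)]
    by (simp add: lookup_add single_add ring_distribs sum.distrib)
qed

lemma left_poly_gsmult [simp]: "left_poly (gsmult c p) = cst c * left_poly p"
  and right_poly_gsmult [simp]: "right_poly (gsmult c p) = cst c * right_poly p"
proof -
  let ?A = "Poly_Mapping.keys (fst p)"
  have *: "finite ?A" "?A \<subseteq> ?A" "Poly_Mapping.keys (fst (gsmult c p)) \<subseteq> ?A"
    by (auto simp: fst_gsmult in_keys_iff)
  show "left_poly (gsmult c p) = cst c * left_poly p"
    unfolding left_poly_superset[OF *(1,2)] left_poly_superset[OF *(1,3)]
    by (simp add: fst_gsmult snd_gsmult cst_mult ring_distribs sum_distrib_left mult.assoc)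
  show "right_poly (gsmult c p) = cst c * right_poly p"
    unfolding right_poly_superset[OF *(1,2)] right_poly_superset[OF *(1,3)]
    by (simp add: fst_gsmult snd_gsmult cst_mult ring_distribs sum_distrib_left mult.assoc)
qed

lemma left_poly_zero [simp]: "left_poly 0 = 0" and right_poly_zero [simp]: "right_poly 0 = 0"
  by (simp_all add: left_poly_def right_poly_def)

lemma left_poly_sum: "left_poly (sum f A) = (\<Sum>i\<in>A. left_poly (f i))"
  and right_poly_sum: "right_poly (sum f A) = (\<Sum>i\<in>A. right_poly (f i))"
  by (induction A rule: infinite_finite_induct) simp_all

lemmas left_right_basis [simp] =
  left_poly_xgen right_poly_xgen left_poly_poly right_poly_poly

text \<open>Since x_i acts as y_i from the left and as z_i from the right, an endomorphism with x_i
  -> \<open>P i\<close> must substitute \<open>left_poly (P i)\<close> for y_i and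
  \<open>right_poly (P i)\<close> for z_i in the polynomial part.\<close>

definition gendo :: "(nat \<Rightarrow> 'k::comm_ring_1 gelem) \<Rightarrow> 'k gelem \<Rightarrow> 'k gelem" where
  "gendo P q =
     (\<Sum>i\<in>Poly_Mapping.keys (fst q). gsmult (Poly_Mapping.lookup (fst q) i) (P i)) +
     (0, psubst (\<lambda>i. left_poly (P i)) (\<lambda>i. right_poly (P i)) (snd q))"

lemma gendo_superset:
  assumes "finite A" "Poly_Mapping.keys (fst q) \<subseteq> A"
  shows "gendo P q = (\<Sum>i\<in>A. gsmult (Poly_Mapping.lookup (fst q) i) (P i)) +
     (0, psubst (\<lambda>i. left_poly (P i)) (\<lambda>i. right_poly (P i)) (snd q))"
proof -
  have "(\<Sum>i\<in>Poly_Mapping.keys (fst q). gsmult (Poly_Mapping.lookup (fst q) i) (P i))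
      = (\<Sum>i\<in>A. gsmult (Poly_Mapping.lookup (fst q) i) (P i))"
    by (rule sum.mono_neutral_left) (use assms in \<open>auto simp: in_keys_iff\<close>)
  then show ?thesis by (simp add: gendo_def)
qed

lemma gendo_poly: "gendo P (0, f) = (0, psubst (\<lambda>i. left_poly (P i)) (\<lambda>i. right_poly (P i)) f)"
  by (simp add: gendo_def)

lemma gendo_zero [simp]: "gendo P 0 = 0"
  by (simp add: gendo_def flip: zero_prod_def)

lemma gendo_xgen [simp]: "gendo P (xgen i) = P i"
  by (simp add: gendo_def xgen_def prod_eq_iff)

lemma gendo_add: "gendo P (p + q) = gendo P p + gendo P q"
proof -
  let ?A = "Poly_Mapping.keys (fst p) \<union> Poly_Mapping.keys (fst q)"
  have *: "finite ?A" "Poly_Mapping.keys (fst p) \<subseteq> ?A" "Poly_Mapping.keys (fst q) \<subseteq> ?A"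
    "Poly_Mapping.keys (fst (p + q)) \<subseteq> ?A" using keys_add[of "fst p" "fst q"] by auto
  have "(0, f + g) = (0, f) + (0 :: nat \<Rightarrow>\<^sub>0 'a, g)" for f g :: "'a yz_poly"
    by simp
  then show ?thesis
    unfolding gendo_superset[OF *(1,2)] gendo_superset[OF *(1,3)] gendo_superset[OF *(1,4)]
    by (simp add: lookup_add gsmult_add_left sum.distrib)
qed

lemma gendo_gsmult: "gendo P (gsmult c p) = gsmult c (gendo P p)"
proof -
  let ?A = "Poly_Mapping.keys (fst p)"
  have *: "finite ?A" "?A \<subseteq> ?A" "Poly_Mapping.keys (fst (gsmult c p)) \<subseteq> ?A"
    by (auto simp: fst_gsmult in_keys_iff)
  show ?thesis
    unfolding gendo_superset[OF *(1,2)] gendo_superset[OF *(1,3)]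
    by (simp add: fst_gsmult snd_gsmult gsmult_add gsmult_sum gsmult_gsmult gsmult_pair)
qed

text \<open>Together with its right-hand twin this makes \<open>gendo\<close> multiplicative: a
  product in G_d depends on its factors only through \<open>left_poly\<close> and
  \<open>right_poly\<close>.\<close>

lemma left_poly_gendo:
  "left_poly (gendo P q) = psubst (\<lambda>i. left_poly (P i)) (\<lambda>i. right_poly (P i)) (left_poly q)"
  by (simp add: gendo_def left_poly_sum left_poly_superset[OF finite_keys subset_refl, of q])

lemma right_poly_gendo:
  "right_poly (gendo P q) = psubst (\<lambda>i. left_poly (P i)) (\<lambda>i. right_poly (P i)) (right_poly q)"
  by (simp add: gendo_def right_poly_sum right_poly_superset[OF finite_keys subset_refl, of q])

lemma gendo_gmult: "gendo P (gmult p q) = gmult (gendo P p) (gendo P q)"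
  by (simp add: gmult_def gendo_poly left_poly_gendo right_poly_gendo)

section \<open>Supports and degrees of elements of G_d\<close>

definition good_exp :: "nat \<Rightarrow> (nat \<Rightarrow>\<^sub>0 nat) \<Rightarrow> (nat \<Rightarrow>\<^sub>0 nat) \<Rightarrow> bool" where
  "good_exp d a b \<longleftrightarrow> Poly_Mapping.keys a \<subseteq> {1..d} \<and> Poly_Mapping.keys b \<subseteq> {1..d} \<and>
     exp_size a \<ge> 1 \<and> exp_size b \<ge> 1"

lemma gcarrier_iff:
  "p \<in> gcarrier d \<longleftrightarrow> Poly_Mapping.keys (fst p) \<subseteq> {1..d} \<and>
     (\<forall>(a, b)\<in>Poly_Mapping.keys (snd p). good_exp d a b)"
  by (cases p) (auto simp: gcarrier_def good_exp_def)

lemma gcomponent_iff: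
  "p \<in> gcomponent d m \<longleftrightarrow> p \<in> gcarrier d \<and> (fst p \<noteq> 0 \<longrightarrow> m = 1) \<and>
     (\<forall>(a, b)\<in>Poly_Mapping.keys (snd p). exp_size a + exp_size b = m)"
  by (cases p) (auto simp: gcomponent_def)

lemma keys_map_mult_subset:
  "Poly_Mapping.keys (Poly_Mapping.map ((*) (c::'k::comm_ring_1)) u) \<subseteq> Poly_Mapping.keys u"
  by (auto simp: in_keys_iff)

lemma keys_cst_mult_subset:
  "Poly_Mapping.keys (cst c * f) \<subseteq> Poly_Mapping.keys f"
  using keys_map_mult_subset[of c f] by (simp add: mult_map_scale_conv_mult)

lemma gcarrier_zero [simp]: "0 \<in> gcarrier d"
  by (simp add: gcarrier_iff)

lemma gcarrier_add:
  assumes "p \<in> gcarrier d" "q \<in> gcarrier d"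
  shows "p + q \<in> gcarrier d"
proof -
  have "good_exp d a b" if "(a, b) \<in> Poly_Mapping.keys (snd p + snd q)" for a b
    using subsetD[OF keys_add that] assms by (auto simp: gcarrier_iff)
  moreover have "i \<in> {1..d}" if "i \<in> Poly_Mapping.keys (fst p + fst q)" for i
    using subsetD[OF keys_add that] assms unfolding gcarrier_iff by blast
  ultimately show ?thesis unfolding gcarrier_iff fst_add snd_add by blast
qed

lemma gcarrier_gsmult:
  assumes "p \<in> gcarrier d"
  shows "gsmult c p \<in> gcarrier d"
proof -
  have "good_exp d a b" if "(a, b) \<in> Poly_Mapping.keys (cst c * snd p)" for a b
    using subsetD[OF keys_cst_mult_subset that] assms by (auto simp: gcarrier_iff)
  moreover have "Poly_Mapping.keys (fst (gsmult c p)) \<subseteq> {1..d}"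
    using assms keys_map_mult_subset[of c "fst p"] unfolding gcarrier_iff fst_gsmult by blast
  ultimately show ?thesis by (auto simp: gcarrier_iff snd_gsmult)
qed

lemma xgen_in_gcarrier: "i \<in> {1..d} \<Longrightarrow> xgen i \<in> gcarrier d"
  by (simp add: gcarrier_iff xgen_def)

lemma gcarrier_yzmon: "good_exp d a b \<Longrightarrow> (0, yzmon a b) \<in> gcarrier d"
  by (simp add: gcarrier_iff)

lemma keys_left_poly:
  assumes "(a, b) \<in> Poly_Mapping.keys (left_poly p)"
  shows "(\<exists>i\<in>Poly_Mapping.keys (fst p). a = delta i \<and> b = 0) \<or> (a, b) \<in> Poly_Mapping.keys (snd p)"
proof -
  let ?s = "\<lambda>i. Poly_Mapping.single (delta i, 0::nat \<Rightarrow>\<^sub>0 nat) (Poly_Mapping.lookup (fst p) i)"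
  have "(a, b) \<in> Poly_Mapping.keys (\<Sum>i\<in>Poly_Mapping.keys (fst p). ?s i) \<union> Poly_Mapping.keys (snd p)"
    using assms unfolding left_poly_def delta_def by (rule subsetD[OF keys_add])
  then show ?thesis
  proof
    assume "(a, b) \<in> Poly_Mapping.keys (\<Sum>i\<in>Poly_Mapping.keys (fst p). ?s i)"
    then obtain i where "i \<in> Poly_Mapping.keys (fst p)" "(a, b) \<in> Poly_Mapping.keys (?s i)"
      using keys_sum[of ?s] by blast
    then show ?thesis by (auto split: if_splits)
  qed simp
qed

lemma keys_right_poly:
  assumes "(a, b) \<in> Poly_Mapping.keys (right_poly p)"
  shows "(\<exists>i\<in>Poly_Mapping.keys (fst p). a = 0 \<and> b = delta i) \<or> (a, b) \<in> Poly_Mapping.keys (snd p)"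
proof -
  let ?s = "\<lambda>i. Poly_Mapping.single (0::nat \<Rightarrow>\<^sub>0 nat, delta i) (Poly_Mapping.lookup (fst p) i)"
  have "(a, b) \<in> Poly_Mapping.keys (\<Sum>i\<in>Poly_Mapping.keys (fst p). ?s i) \<union> Poly_Mapping.keys (snd p)"
    using assms unfolding right_poly_def delta_def by (rule subsetD[OF keys_add])
  then show ?thesis
  proof
    assume "(a, b) \<in> Poly_Mapping.keys (\<Sum>i\<in>Poly_Mapping.keys (fst p). ?s i)"
    then obtain i where "i \<in> Poly_Mapping.keys (fst p)" "(a, b) \<in> Poly_Mapping.keys (?s i)"
      using keys_sum[of ?s] by blast
    then show ?thesis by (auto split: if_splits)
  qed simp
qed

lemma gcarrier_gmult:
  assumes "p \<in> gcarrier d" "q \<in> gcarrier d"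
  shows "gmult p q \<in> gcarrier d"
proof -
  have "good_exp d a b" if "(a, b) \<in> Poly_Mapping.keys (left_poly p * right_poly q)" for a b
  proof -
    obtain a1 b1 a2 b2 where *: "(a1, b1) \<in> Poly_Mapping.keys (left_poly p)"
      "(a2, b2) \<in> Poly_Mapping.keys (right_poly q)" "a = a1 + a2" "b = b1 + b2"
      using \<open>(a, b) \<in> _\<close> keys_mult[of "left_poly p" "right_poly q"] by auto
    from keys_left_poly[OF *(1)] keys_right_poly[OF *(2)] assms show ?thesis
      unfolding *(3,4) by (fastforce simp: gcarrier_iff good_exp_def keys_nat_add)
  qed
  then show ?thesis by (auto simp: gcarrier_iff gmult_def)
qed

lemma gcomponent_gmult:
  assumes "p \<in> gcomponent d m" "q \<in> gcomponent d n"
  shows "gmult p q \<in> gcomponent d (m + n)"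
proof -
  have "exp_size a + exp_size b = m + n"
    if "(a, b) \<in> Poly_Mapping.keys (left_poly p * right_poly q)" for a b
  proof -
    obtain a1 b1 a2 b2 where *: "(a1, b1) \<in> Poly_Mapping.keys (left_poly p)"
      "(a2, b2) \<in> Poly_Mapping.keys (right_poly q)" "a = a1 + a2" "b = b1 + b2"
      using \<open>(a, b) \<in> _\<close> keys_mult[of "left_poly p" "right_poly q"] by auto
    have "exp_size a1 + exp_size b1 = m" "exp_size a2 + exp_size b2 = n"
      using keys_left_poly[OF *(1)] keys_right_poly[OF *(2)] assms
      by (fastforce simp: gcomponent_iff)+
    then show ?thesis unfolding *(3,4) by simp
  qed
  then show ?thesis using assms gcarrier_gmult[of p d q]
    by (auto simp: gcomponent_iff gmult_def)
qed

lemma gcomponent_zero [simp]: "0 \<in> gcomponent d m"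
  by (simp add: gcomponent_iff)

lemma gcomponent_add:
  assumes "p \<in> gcomponent d m" "q \<in> gcomponent d m"
  shows "p + q \<in> gcomponent d m"
proof -
  have "exp_size a + exp_size b = m" if "(a, b) \<in> Poly_Mapping.keys (snd p + snd q)" for a b
    using subsetD[OF keys_add that] assms by (auto simp: gcomponent_iff)
  moreover have "fst p + fst q \<noteq> 0 \<longrightarrow> m = 1" using assms by (auto simp: gcomponent_iff)
  moreover have "p + q \<in> gcarrier d" using assms by (simp add: gcomponent_iff gcarrier_add)
  ultimately show ?thesis unfolding gcomponent_iff fst_add snd_add by blast
qed

lemma gcomponent_gsmult:
  assumes "p \<in> gcomponent d m"
  shows "gsmult c p \<in> gcomponent d m"
proof -
  have "fst (gsmult c p) = 0" if "fst p = 0"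
    using that gsmult_pair[of c "snd p"] by (metis fst_conv prod.collapse)
  moreover have "exp_size a + exp_size b = m" if "(a, b) \<in> Poly_Mapping.keys (cst c * snd p)" for a b
    using subsetD[OF keys_cst_mult_subset that] assms by (auto simp: gcomponent_iff)
  ultimately show ?thesis
    using assms by (auto simp: gcomponent_iff snd_gsmult gcarrier_gsmult)
qed

lemma gcomponent_sum: "(\<And>i. i \<in> A \<Longrightarrow> f i \<in> gcomponent d m) \<Longrightarrow> sum f A \<in> gcomponent d m"
  by (induction A rule: infinite_finite_induct) (auto intro: gcomponent_add)

lemma xgen_in_gcomponent: "i \<in> {1..d} \<Longrightarrow> xgen i \<in> gcomponent d 1"
  by (simp add: gcomponent_iff xgen_in_gcarrier) (simp add: xgen_def)

text \<open>A basis monomial is built from some y_i z_j = x_i x_j by left multiplications by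
  generators, which add a y, and right multiplications, which add a z. The induction thus follows
  the generation of G_d by the x_i.\<close>

lemma good_exp_induct [consumes 1, case_names base left right]:
  assumes "good_exp d a b"
    and base: "\<And>i j. i \<in> {1..d} \<Longrightarrow> j \<in> {1..d} \<Longrightarrow> P (delta i) (delta j)"
    and left: "\<And>i a b. i \<in> {1..d} \<Longrightarrow> good_exp d a b \<Longrightarrow> P a b \<Longrightarrow> P (delta i + a) b"
    and right: "\<And>i a b. i \<in> {1..d} \<Longrightarrow> good_exp d a b \<Longrightarrow> P a b \<Longrightarrow> P a (delta i + b)"
  shows "P a b"
  using assms(1)
proof (induction "exp_size a + exp_size b" arbitrary: a b rule: less_induct)
  case less
  obtain n m where nm: "exp_size a = Suc n" "exp_size b = Suc m"
    using less.prems by (metis good_exp_def One_nat_def Suc_le_D)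
  from nm(1) obtain i a' where a: "a = delta i + a'" "exp_size a' = n" by (rule exp_size_SucE)
  from nm(2) obtain j b' where b: "b = delta j + b'" "exp_size b' = m" by (rule exp_size_SucE)
  have ij: "i \<in> {1..d}" "j \<in> {1..d}" "Poly_Mapping.keys a' \<subseteq> {1..d}" "Poly_Mapping.keys b' \<subseteq> {1..d}"
    using less.prems by (auto simp: good_exp_def a b keys_nat_add)
  \<comment> \<open>A y may be stripped only if \<open>a'\<close> is still nonzero, and likewise a z
    only if \<open>b'\<close> is; the remaining case is a product of two generators.\<close>
  consider "n = 0" "m = 0" | "n > 0" | "m > 0" by blast
  then show ?case
  proof cases
    case 1
    then show ?thesis using a b ij base by simp
  next
    case 2
    then have g: "good_exp d a' b" using less.prems ij a by (auto simp: good_exp_def)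
    show ?thesis unfolding a(1)
      by (rule left[OF ij(1) g less.hyps[OF _ g]]) (simp add: a)
  next
    case 3
    then have g: "good_exp d a b'" using less.prems ij b by (auto simp: good_exp_def)
    show ?thesis unfolding b(1)
      by (rule right[OF ij(2) g less.hyps[OF _ g]]) (simp add: b)
  qed
qed

lemma gelem_decompose:
  assumes "finite A" "Poly_Mapping.keys (fst p) \<subseteq> A"
  shows "p = (\<Sum>i\<in>A. gsmult (Poly_Mapping.lookup (fst p) i) (xgen i)) + (0, snd p)"
proof -
  have "fst (\<Sum>i\<in>A. gsmult (Poly_Mapping.lookup (fst p) i) (xgen i)) = fst p"
  proof (rule poly_mapping_eqI)
    fix k
    have "(\<Sum>i\<in>A. Poly_Mapping.lookup (fst p) i when i = k) = Poly_Mapping.lookup (fst p) k"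
    proof (cases "k \<in> A")
      case True
      then show ?thesis using assms by (simp add: when_def if_distrib cong: if_cong)
    next
      case False
      then have "Poly_Mapping.lookup (fst p) k = 0" using assms by (auto simp: in_keys_iff)
      with False show ?thesis by (auto simp: when_def intro!: sum.neutral)
    qed
    then show "Poly_Mapping.lookup (fst (\<Sum>i\<in>A. gsmult (Poly_Mapping.lookup (fst p) i) (xgen i))) k
        = Poly_Mapping.lookup (fst p) k"
      by (simp add: fst_sum lookup_sum fst_gsmult xgen_def lookup_single mult_when)
  qed
  moreover have "snd (\<Sum>i\<in>A. gsmult (Poly_Mapping.lookup (fst p) i) (xgen i)) = 0"
    by (simp add: snd_sum snd_gsmult xgen_def)
  ultimately show ?thesis by (simp add: prod_eq_iff)
qed

text \<open>The x_i generate G_d as an algebra, so an endomorphism is determined by its values on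
  them.\<close>

lemma gcarrier_induct [consumes 1, case_names zero xgen add smult mult]:
  assumes "p \<in> gcarrier d"
    and zero: "P 0"
    and xgen: "\<And>i. i \<in> {1..d} \<Longrightarrow> P (xgen i)"
    and add: "\<And>p q. p \<in> gcarrier d \<Longrightarrow> q \<in> gcarrier d \<Longrightarrow> P p \<Longrightarrow> P q \<Longrightarrow> P (p + q)"
    and smult: "\<And>c p. p \<in> gcarrier d \<Longrightarrow> P p \<Longrightarrow> P (gsmult c p)"
    and mult: "\<And>p q. p \<in> gcarrier d \<Longrightarrow> q \<in> gcarrier d \<Longrightarrow> P p \<Longrightarrow> P q \<Longrightarrow> P (gmult p q)"
  shows "P p"
proof -
  let ?S = "\<lambda>A. \<Sum>i\<in>A. gsmult (Poly_Mapping.lookup (fst p) i) (xgen i)"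
  have mon: "P (0, yzmon a b)" if "good_exp d a b" for a b
    using that
  proof (induction rule: good_exp_induct)
    case (base i j)
    then show ?case
      using mult[of "xgen i" "xgen j"] by (simp add: gmult_basis yzmon_delta xgen xgen_in_gcarrier)
  next
    case (left i a b)
    then show ?case
      using mult[of "xgen i" "(0, yzmon a b)"]
      by (simp add: gmult_basis yzmon_delta_left xgen xgen_in_gcarrier gcarrier_yzmon)
  next
    case (right i a b)
    then show ?case
      using mult[of "(0, yzmon a b)" "xgen i"]
      by (simp add: gmult_basis yzmon_delta_right xgen xgen_in_gcarrier gcarrier_yzmon mult.commute)
  qed
  have keys: "Poly_Mapping.keys (fst p) \<subseteq> {1..d}"
    "\<And>a b. (a, b) \<in> Poly_Mapping.keys (snd p) \<Longrightarrow> good_exp d a b"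
    using assms(1) by (auto simp: gcarrier_iff)
  have "P (0, snd p) \<and> (0, snd p) \<in> gcarrier d"
  proof (rule poly_mon_induct[of "snd p" "good_exp d"])
    show "P (0, 0) \<and> (0, 0) \<in> gcarrier d" using zero by (simp flip: zero_prod_def)
  next
    fix g c a b assume *: "P (0, g) \<and> (0, g) \<in> gcarrier d" "good_exp d a b"
    have "(0, cst c * yzmon a b + g) = gsmult c (0, yzmon a b) + (0, g)"
      by (simp add: gsmult_pair)
    then show "P (0, cst c * yzmon a b + g) \<and> (0, cst c * yzmon a b + g) \<in> gcarrier d"
      using * by (auto intro!: add smult mon gcarrier_add gcarrier_gsmult gcarrier_yzmon)
  qed (use keys(2) in auto)
  moreover have "P (?S A) \<and> ?S A \<in> gcarrier d" if "finite A" "A \<subseteq> {1..d}" for A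
    using that
  proof (induction A)
    case (insert i A)
    then show ?case
      by (auto intro!: add smult xgen gcarrier_add gcarrier_gsmult xgen_in_gcarrier)
  qed (simp add: zero)
  ultimately have "P (?S {1..d} + (0, snd p))"
    by (intro add) simp_all
  then show ?thesis
    by (subst gelem_decompose[OF finite_atLeastAtMost keys(1)])
qed

section \<open>Freeness: every endomorphism is a substitution\<close>

lemma nendo_G_iff:
  "nendo (G_alg d) \<phi> \<longleftrightarrow>
     (\<forall>x\<in>gcarrier d. \<phi> x \<in> gcarrier d) \<and>
     (\<forall>x\<in>gcarrier d. \<forall>y\<in>gcarrier d. \<phi> (x + y) = \<phi> x + \<phi> y) \<and>
     (\<forall>c. \<forall>x\<in>gcarrier d. \<phi> (gsmult c x) = gsmult c (\<phi> x)) \<and>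
     (\<forall>x\<in>gcarrier d. \<forall>y\<in>gcarrier d. \<phi> (gmult x y) = gmult (\<phi> x) (\<phi> y))"
  by (simp add: nendo_def G_alg_def)

lemma gendo_in_gcarrier:
  assumes "\<And>i. i \<in> {1..d} \<Longrightarrow> P i \<in> gcarrier d" "q \<in> gcarrier d"
  shows "gendo P q \<in> gcarrier d"
  using assms(2)
  by (induction rule: gcarrier_induct)
    (simp_all add: assms gendo_add gendo_gsmult gendo_gmult gcarrier_add gcarrier_gsmult gcarrier_gmult)

lemma nendo_gendo:
  assumes "\<And>i. i \<in> {1..d} \<Longrightarrow> P i \<in> gcarrier d"
  shows "nendo (G_alg d) (gendo P)"
  using gendo_in_gcarrier[OF assms]
  by (simp add: nendo_G_iff gendo_add gendo_gsmult gendo_gmult)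

lemma nendo_zero: "nendo (G_alg d) \<phi> \<Longrightarrow> \<phi> 0 = 0"
  using nendo_G_iff[of d \<phi>] gcarrier_zero[of d] gsmult_zero_left[of 0]
    gsmult_zero_left[of "\<phi> 0"] by metis

lemma nendo_G_eqI:
  assumes "nendo (G_alg d) \<phi>" "nendo (G_alg d) \<psi>"
    and "\<And>i. i \<in> {1..d} \<Longrightarrow> \<phi> (xgen i) = \<psi> (xgen i)" "q \<in> gcarrier d"
  shows "\<phi> q = \<psi> q"
  using assms(4)
proof (induction rule: gcarrier_induct)
  case zero
  show ?case using assms(1,2) by (simp add: nendo_zero)
qed (use assms(1-3) in \<open>simp_all add: nendo_G_iff\<close>)

text \<open>Any endomorphism agrees with the substitution built from its own values on the
  generators, so questions about arbitrary endomorphisms reduce to \<open>psubst\<close>.\<close>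

lemma nendo_eq_gendo:
  assumes "nendo (G_alg d) \<phi>" "q \<in> gcarrier d"
  shows "\<phi> q = gendo (\<lambda>i. \<phi> (xgen i)) q"
  by (rule nendo_G_eqI[OF assms(1) nendo_gendo _ assms(2)])
    (use assms(1) in \<open>auto simp: nendo_G_iff xgen_in_gcarrier\<close>)

lemma nendo_linear_gcomponent:
  assumes \<phi>: "nendo (G_alg d) \<phi>" and lin: "\<And>i. i \<in> {1..d} \<Longrightarrow> \<phi> (xgen i) \<in> gcomponent d 1"
    and p: "p \<in> gcomponent d m"
  shows "\<phi> p \<in> gcomponent d m"
proof -
  let ?f = "gendo (\<lambda>i. \<phi> (xgen i))"
  have mon: "?f (0, yzmon a b) \<in> gcomponent d (exp_size a + exp_size b)" if "good_exp d a b" for a b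
    using that
  proof (induction rule: good_exp_induct)
    case (base i j)
    then show ?case
      using gcomponent_gmult[OF lin lin, of i j]
      by (simp add: yzmon_delta gmult_basis(1)[symmetric] gendo_gmult)
  next
    case (left i a b)
    then show ?case
      using gcomponent_gmult[OF lin left(3), of i]
      by (simp add: yzmon_delta_left gmult_basis(2)[symmetric] gendo_gmult)
  next
    case (right i a b)
    then show ?case
      using gcomponent_gmult[OF right(3) lin, of i]
      by (simp add: yzmon_delta_right mult.commute[of "zvar i" "yzmon a b"] gmult_basis(3)[symmetric] gendo_gmult)
  qed
  have pc: "p \<in> gcarrier d" and keys: "Poly_Mapping.keys (fst p) \<subseteq> {1..d}"
    "\<And>a b. (a, b) \<in> Poly_Mapping.keys (snd p) \<Longrightarrow> good_exp d a b \<and> exp_size a + exp_size b = m"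
    using p by (auto simp: gcarrier_iff gcomponent_iff)
  have "?f (0, snd p) \<in> gcomponent d m"
  proof (rule poly_mon_induct[of "snd p" "\<lambda>a b. good_exp d a b \<and> exp_size a + exp_size b = m"])
    show "?f (0, 0) \<in> gcomponent d m" by (simp flip: zero_prod_def)
  next
    fix g c a b
    assume *: "?f (0, g) \<in> gcomponent d m" "good_exp d a b \<and> exp_size a + exp_size b = m"
    have "(0, cst c * yzmon a b + g) = gsmult c (0, yzmon a b) + (0, g)"
      by (simp add: gsmult_pair)
    then show "?f (0, cst c * yzmon a b + g) \<in> gcomponent d m"
      using * mon by (auto simp: gendo_add gendo_gsmult intro!: gcomponent_add gcomponent_gsmult)
  qed (use keys(2) in auto)
  moreover have "?f (\<Sum>i\<in>A. gsmult (Poly_Mapping.lookup (fst p) i) (xgen i)) \<in> gcomponent d m"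
    if "finite A" "A \<subseteq> {1..d}" for A
    using that
  proof (induction A)
    case empty
    then show ?case by simp
  next
    case (insert i A)
    \<comment> \<open>A nonzero linear part forces \<open>m = 1\<close>; otherwise all its
      coefficients vanish and the summand is 0.\<close>
    have "gsmult (Poly_Mapping.lookup (fst p) i) (\<phi> (xgen i)) \<in> gcomponent d m"
    proof (cases "fst p = 0")
      case False
      then have "m = 1" using p by (simp add: gcomponent_iff)
      then show ?thesis using lin insert by (simp add: gcomponent_gsmult)
    qed simp
    with insert show ?case by (simp add: gendo_add gendo_gsmult gcomponent_add)
  qed
  ultimately have "?f ((\<Sum>i\<in>{1..d}. gsmult (Poly_Mapping.lookup (fst p) i) (xgen i)) + (0, snd p))
      \<in> gcomponent d m"
    by (simp add: gendo_add gcomponent_add)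
  then have "?f p \<in> gcomponent d m"
    by (subst gelem_decompose[OF finite_atLeastAtMost keys(1)])
  then show ?thesis using nendo_eq_gendo[OF \<phi> pc] by simp
qed

section \<open>T-ideals and factor algebras\<close>

lemma gmult_add_left: "gmult (p + q) r = gmult p r + gmult q r"
  and gmult_add_right: "gmult r (p + q) = gmult r p + gmult r q"
  by (simp_all add: gmult_def ring_distribs)

lemma nsubspace_G_iff:
  "nsubspace (G_alg d) N \<longleftrightarrow> N \<subseteq> gcarrier d \<and> 0 \<in> N \<and>
     (\<forall>x\<in>N. \<forall>y\<in>N. x + y \<in> N) \<and> (\<forall>c. \<forall>x\<in>N. gsmult c x \<in> N)"
  by (simp add: nsubspace_def G_alg_def)

lemma nideal_G_iff:
  "nideal (G_alg d) N \<longleftrightarrow> nsubspace (G_alg d) N \<and>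
     (\<forall>a\<in>gcarrier d. \<forall>x\<in>N. gmult a x \<in> N \<and> gmult x a \<in> N)"
  by (simp add: nideal_def G_alg_def)

lemma nsubspace_G_uminus:
  assumes "nsubspace (G_alg d) N" "x \<in> N"
  shows "- x \<in> N"
  using assms gsmult_minus_one[of x] unfolding nsubspace_G_iff by metis

lemma nsubspace_G_diff:
  assumes "nsubspace (G_alg d) N" "x \<in> N" "y \<in> N"
  shows "x - y \<in> N"
  using assms nsubspace_G_uminus[OF assms(1,3)] unfolding nsubspace_G_iff
  by (metis add_uminus_conv_diff)

lemma T_ideal_gcarrier: "T_ideal (G_alg d) (gcarrier d)"
  by (auto simp: T_ideal_def nideal_G_iff nsubspace_G_iff nendo_G_iff gcarrier_add gcarrier_gsmult
      gcarrier_gmult)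

lemma T_ideal_gen_superset: "S \<subseteq> T_ideal_gen A S"
  by (auto simp: T_ideal_gen_def)

lemma T_ideal_gen_minimal: "T_ideal A N \<Longrightarrow> S \<subseteq> N \<Longrightarrow> T_ideal_gen A S \<subseteq> N"
  by (auto simp: T_ideal_gen_def)

text \<open>That the whole carrier is a T-ideal makes the intersected family nonempty; an empty
  intersection would be the whole type instead of a subset of the algebra.\<close>

lemma T_ideal_T_ideal_gen:
  assumes "T_ideal A (ncarrier A)" "S \<subseteq> ncarrier A"
  shows "T_ideal A (T_ideal_gen A S)"
proof -
  let ?G = "T_ideal_gen A S"
  have sub: "?G \<subseteq> ncarrier A" by (rule T_ideal_gen_minimal[OF assms])
  have mem: "x \<in> ?G \<longleftrightarrow> (\<forall>N. T_ideal A N \<and> S \<subseteq> N \<longrightarrow> x \<in> N)" for x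
    unfolding T_ideal_gen_def by blast
  have closed: "nzero A \<in> N" "x \<in> N \<Longrightarrow> y \<in> N \<Longrightarrow> nadd A x y \<in> N" "x \<in> N \<Longrightarrow> nsmult A c x \<in> N"
    "a \<in> ncarrier A \<Longrightarrow> x \<in> N \<Longrightarrow> nmult A a x \<in> N" "a \<in> ncarrier A \<Longrightarrow> x \<in> N \<Longrightarrow> nmult A x a \<in> N"
    "nendo A \<phi> \<Longrightarrow> x \<in> N \<Longrightarrow> \<phi> x \<in> N"
    if "T_ideal A N" for N x y c a \<phi>
    using that unfolding T_ideal_def nideal_def nsubspace_def by blast+
  show ?thesis
    unfolding T_ideal_def nideal_def nsubspace_def
  proof (intro conjI ballI allI impI image_subsetI)
    show "?G \<subseteq> ncarrier A" by (rule sub)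
  qed (simp_all add: mem closed)
qed

locale G_quotient =
  fixes d :: nat and I :: "'k::comm_ring_1 gelem set"
  assumes T_ideal_I: "T_ideal (G_alg d) I"
begin

abbreviation cs :: "'k gelem \<Rightarrow> 'k gelem set" where
  "cs \<equiv> ncoset (G_alg d) I"

abbreviation Q :: "('k, 'k gelem set) nalg" where
  "Q \<equiv> nquot (G_alg d) I"

lemma subspace_I: "nsubspace (G_alg d) I"
  using T_ideal_I by (simp add: T_ideal_def nideal_def)

lemma I_closed:
  "I \<subseteq> gcarrier d" "0 \<in> I" "x \<in> I \<Longrightarrow> y \<in> I \<Longrightarrow> x + y \<in> I" "x \<in> I \<Longrightarrow> gsmult c x \<in> I"
  "a \<in> gcarrier d \<Longrightarrow> x \<in> I \<Longrightarrow> gmult a x \<in> I" "a \<in> gcarrier d \<Longrightarrow> x \<in> I \<Longrightarrow> gmult x a \<in> I"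
  "nendo (G_alg d) \<phi> \<Longrightarrow> x \<in> I \<Longrightarrow> \<phi> x \<in> I"
  using T_ideal_I unfolding T_ideal_def nideal_G_iff nsubspace_G_iff by blast+

lemma in_cs_iff: "y \<in> cs x \<longleftrightarrow> y - x \<in> I"
proof
  assume "y - x \<in> I"
  then have "nadd (G_alg d) x (y - x) \<in> cs x" unfolding ncoset_def by (rule imageI)
  then show "y \<in> cs x" by (simp add: G_alg_def)
qed (auto simp: ncoset_def G_alg_def)

lemma cs_eq_iff: "cs x = cs y \<longleftrightarrow> x - y \<in> I"
proof
  assume "cs x = cs y"
  moreover have "x \<in> cs x" by (simp add: in_cs_iff I_closed)
  ultimately show "x - y \<in> I" by (simp add: in_cs_iff)
next
  assume *: "x - y \<in> I"
  have "z \<in> cs x \<longleftrightarrow> z \<in> cs y" for z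
  proof -
    have "z - y = (z - x) + (x - y)" "z - x = (z - y) - (x - y)" by simp_all
    then show ?thesis
      unfolding in_cs_iff using * I_closed(3) nsubspace_G_diff[OF subspace_I] by metis
  qed
  then show "cs x = cs y" by blast
qed

lemma cs_in_carrier: "x \<in> gcarrier d \<Longrightarrow> y \<in> cs x \<Longrightarrow> y \<in> gcarrier d"
  using gcarrier_add[of "y - x" d x] I_closed(1) by (auto simp: in_cs_iff)

lemma cs_self: "x \<in> cs x"
  by (simp add: in_cs_iff I_closed)

lemma carrier_Q: "ncarrier Q = cs ` gcarrier d"
  by (simp add: nquot_def) (simp add: G_alg_def)

lemma zero_Q: "nzero Q = cs 0"
  by (simp add: nquot_def ncoset_def) (simp add: G_alg_def)

lemma UN_cs_eq:
  assumes "\<And>x. x \<in> X \<Longrightarrow> f x = c" "X \<noteq> {}"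
  shows "(\<Union>x\<in>X. f x) = c"
  using assms by auto

lemma UN_UN_cs_eq:
  assumes "\<And>x y. x \<in> X \<Longrightarrow> y \<in> Y \<Longrightarrow> f x y = c" "X \<noteq> {}" "Y \<noteq> {}"
  shows "(\<Union>x\<in>X. \<Union>y\<in>Y. f x y) = c"
  by (intro UN_cs_eq assms)

lemma cs_nonempty: "cs x \<noteq> {}"
  using cs_self[of x] by blast

lemma add_Q: "nadd Q (cs x) (cs y) = cs (x + y)"
proof -
  have "cs (x' + y') = cs (x + y)" if "x' \<in> cs x" "y' \<in> cs y" for x' y'
  proof -
    have "(x' + y') - (x + y) = (x' - x) + (y' - y)" by simp
    then show ?thesis using that unfolding in_cs_iff cs_eq_iff by (metis I_closed(3))
  qed
  then have "(\<Union>x'\<in>cs x. \<Union>y'\<in>cs y. cs (x' + y')) = cs (x + y)"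
    by (intro UN_UN_cs_eq cs_nonempty)
  then show ?thesis by (simp add: nquot_def) (simp add: G_alg_def)
qed

lemma smult_Q: "nsmult Q c (cs x) = cs (gsmult c x)"
proof -
  have "cs (gsmult c x') = cs (gsmult c x)" if "x' \<in> cs x" for x'
  proof -
    have "gsmult c x' = gsmult c (x' - x) + gsmult c x" by (simp flip: gsmult_add)
    then have "gsmult c x' - gsmult c x = gsmult c (x' - x)" by simp
    then show ?thesis using that unfolding in_cs_iff cs_eq_iff by (metis I_closed(4))
  qed
  then have "(\<Union>x'\<in>cs x. cs (gsmult c x')) = cs (gsmult c x)"
    by (intro UN_cs_eq cs_nonempty)
  then show ?thesis by (simp add: nquot_def) (simp add: G_alg_def)
qed

lemma mult_Q:
  assumes "x \<in> gcarrier d" "y \<in> gcarrier d"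
  shows "nmult Q (cs x) (cs y) = cs (gmult x y)"
proof -
  have "cs (gmult x' y') = cs (gmult x y)" if "x' \<in> cs x" "y' \<in> cs y" for x' y'
  proof -
    have "gmult x' y' = gmult (x' - x) y' + gmult x y'"
      by (simp flip: gmult_add_left)
    also have "gmult x y' = gmult x (y' - y) + gmult x y"
      by (simp flip: gmult_add_right)
    finally have "gmult x' y' - gmult x y = gmult (x' - x) y' + gmult x (y' - y)" by simp
    \<comment> \<open>\<open>I\<close> absorbs products only with elements of the carrier, so the
      changed representative must be shown to lie there.\<close>
    moreover have "y' \<in> gcarrier d" using that assms cs_in_carrier by blast
    ultimately show ?thesis using that assms unfolding in_cs_iff cs_eq_iff
      by (simp add: I_closed)
  qed
  then have "(\<Union>x'\<in>cs x. \<Union>y'\<in>cs y. cs (gmult x' y')) = cs (gmult x y)"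
    by (intro UN_UN_cs_eq cs_nonempty)
  then show ?thesis by (simp add: nquot_def) (simp add: G_alg_def)
qed

lemma nsubspace_image:
  assumes "nsubspace (G_alg d) N"
  shows "nsubspace Q (cs ` N)"
  using assms unfolding nsubspace_G_iff nsubspace_def[of Q] carrier_Q zero_Q
  by (auto simp: add_Q smult_Q simp del: add_Pair)

lemma nsubspace_preimage:
  assumes "nsubspace Q N"
  shows "nsubspace (G_alg d) {g \<in> gcarrier d. cs g \<in> N}"
  unfolding nsubspace_G_iff
proof (intro conjI ballI allI)
  show "0 \<in> {g \<in> gcarrier d. cs g \<in> N}" using assms by (simp add: nsubspace_def zero_Q)
  show "x + y \<in> {g \<in> gcarrier d. cs g \<in> N}"
    if "x \<in> {g \<in> gcarrier d. cs g \<in> N}" "y \<in> {g \<in> gcarrier d. cs g \<in> N}" for x y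
    using assms that by (simp add: nsubspace_def gcarrier_add flip: add_Q)
  show "gsmult c x \<in> {g \<in> gcarrier d. cs g \<in> N}"
    if "x \<in> {g \<in> gcarrier d. cs g \<in> N}" for c x
    using assms that by (simp add: nsubspace_def gcarrier_gsmult flip: smult_Q)
qed blast

lemma T_ideal_carrier_Q: "T_ideal Q (ncarrier Q)"
proof -
  have "nsubspace Q (ncarrier Q)"
    unfolding carrier_Q
    by (rule nsubspace_image) (simp add: nsubspace_G_iff gcarrier_add gcarrier_gsmult)
  then show ?thesis
    unfolding T_ideal_def nideal_def nendo_def by (auto simp: carrier_Q mult_Q gcarrier_gmult)
qed

text \<open>A T-ideal is stable under \<open>\<phi>\<close>, so congruent elements have congruent
  images and the union over representatives collapses to one coset.\<close>

lemma induced_endo: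
  assumes \<phi>: "nendo (G_alg d) \<phi>"
  obtains \<psi> where "nendo Q \<psi>" "\<And>x. x \<in> gcarrier d \<Longrightarrow> \<psi> (cs x) = cs (\<phi> x)"
proof
  define \<psi> where "\<psi> X = (\<Union>x\<in>X. cs (\<phi> x))" for X
  show *: "\<psi> (cs x) = cs (\<phi> x)" if "x \<in> gcarrier d" for x
    unfolding \<psi>_def
  proof (rule UN_cs_eq)
    fix y assume y: "y \<in> cs x"
    then have yx: "y - x \<in> I" "y - x \<in> gcarrier d" using I_closed(1) by (auto simp: in_cs_iff)
    have "\<phi> (x + (y - x)) = \<phi> x + \<phi> (y - x)" using \<phi> that yx(2) unfolding nendo_G_iff by blast
    then have "\<phi> y - \<phi> x = \<phi> (y - x)" by simp
    then show "cs (\<phi> y) = cs (\<phi> x)" using I_closed(7)[OF \<phi> yx(1)] by (simp add: cs_eq_iff)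
  qed (rule cs_nonempty)
  show "nendo Q \<psi>"
    using \<phi> unfolding nendo_def[of Q] carrier_Q nendo_G_iff
    by (auto simp: * add_Q smult_Q mult_Q gcarrier_add gcarrier_gsmult gcarrier_gmult)
qed

lemma T_ideal_preimage:
  assumes T: "T_ideal Q N"
  shows "T_ideal (G_alg d) {g \<in> gcarrier d. cs g \<in> N}"
  unfolding T_ideal_def nideal_G_iff
proof (intro conjI ballI allI impI)
  let ?N = "{g \<in> gcarrier d. cs g \<in> N}"
  show "nsubspace (G_alg d) ?N"
    using T nsubspace_preimage by (simp add: T_ideal_def nideal_def)
  show "gmult a x \<in> ?N" "gmult x a \<in> ?N" if "a \<in> gcarrier d" "x \<in> ?N" for a x
    using T that by (simp_all add: T_ideal_def nideal_def carrier_Q gcarrier_gmult flip: mult_Q)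
  show "\<phi> ` ?N \<subseteq> ?N" if "nendo (G_alg d) \<phi>" for \<phi>
  proof -
    obtain \<psi> where "nendo Q \<psi>" and \<psi>: "\<And>x. x \<in> gcarrier d \<Longrightarrow> \<psi> (cs x) = cs (\<phi> x)"
      using induced_endo[OF \<open>nendo (G_alg d) \<phi>\<close>] by blast
    then have "\<psi> ` N \<subseteq> N" using T by (simp add: T_ideal_def)
    with \<psi> that show ?thesis unfolding nendo_G_iff by fastforce
  qed
qed

text \<open>The factor algebra is relatively free: representatives of the images of the generators
  may be chosen arbitrarily, and freeness of G_d extends the choice to an endomorphism.\<close>

lemma lift_endo:
  assumes \<psi>: "nendo Q \<psi>"
  obtains \<phi> where "nendo (G_alg d) \<phi>" "\<And>x. x \<in> gcarrier d \<Longrightarrow> \<psi> (cs x) = cs (\<phi> x)"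
proof -
  have "\<exists>p. p \<in> gcarrier d \<and> \<psi> (cs (xgen i)) = cs p" if "i \<in> {1..d}" for i
    using \<psi> xgen_in_gcarrier[OF that] unfolding nendo_def carrier_Q by blast
  then obtain P where P: "\<And>i. i \<in> {1..d} \<Longrightarrow> P i \<in> gcarrier d \<and> \<psi> (cs (xgen i)) = cs (P i)"
    by metis
  have endo: "nendo (G_alg d) (gendo P)" by (rule nendo_gendo) (simp add: P)
  have hom: "\<psi> (nadd Q (cs x) (cs y)) = nadd Q (\<psi> (cs x)) (\<psi> (cs y))"
    "\<psi> (nsmult Q c (cs x)) = nsmult Q c (\<psi> (cs x))"
    "\<psi> (nmult Q (cs x) (cs y)) = nmult Q (\<psi> (cs x)) (\<psi> (cs y))"
    if "x \<in> gcarrier d" "y \<in> gcarrier d" for x y c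
    using \<psi> that unfolding nendo_def carrier_Q by blast+
  have "\<psi> (cs x) = cs (gendo P x)" if "x \<in> gcarrier d" for x
    using that
  proof (induction rule: gcarrier_induct)
    case zero
    obtain p where "\<psi> (cs 0) = cs p"
      using \<psi> gcarrier_zero[of d] unfolding nendo_def carrier_Q by blast
    \<comment> \<open>Compatibility with the scalar 0 alone forces
      \<open>\<psi> (cs 0) = cs 0\<close>.\<close>
    then show ?case using hom(2)[of 0 0 0] by (simp add: smult_Q)
  next
    case (xgen i)
    then show ?case using P by simp
  next
    case (add p q)
    then show ?case using hom(1)[of p q] by (simp add: add_Q gendo_add)
  next
    case (smult c p)
    then show ?case using hom(2)[of p p c] by (simp add: smult_Q gendo_gsmult)
  next
    case (mult p q)
    then show ?case using hom(3)[of p q] endo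
      by (simp add: mult_Q gendo_gmult nendo_G_iff)
  qed
  with endo that show thesis by blast
qed

lemma T_ideal_image:
  assumes J: "T_ideal (G_alg d) J"
  shows "T_ideal Q (cs ` J)"
  unfolding T_ideal_def nideal_def
proof (intro conjI ballI allI impI)
  have sub: "J \<subseteq> gcarrier d" using J by (simp add: T_ideal_def nideal_G_iff nsubspace_G_iff)
  show "nsubspace Q (cs ` J)"
    using J by (auto simp: T_ideal_def nideal_def intro: nsubspace_image)
  show "nmult Q a x \<in> cs ` J" "nmult Q x a \<in> cs ` J"
    if a: "a \<in> ncarrier Q" and x: "x \<in> cs ` J" for a x
  proof -
    obtain a' x' where *: "a = cs a'" "a' \<in> gcarrier d" "x = cs x'" "x' \<in> J"
      using a x by (auto simp: carrier_Q)
    then have "x' \<in> gcarrier d" using sub by blast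
    with * J show "nmult Q a x \<in> cs ` J" "nmult Q x a \<in> cs ` J"
      by (auto simp: mult_Q T_ideal_def nideal_G_iff)
  qed
  show "\<psi> ` (cs ` J) \<subseteq> cs ` J" if "nendo Q \<psi>" for \<psi>
  proof -
    obtain \<phi> where \<phi>: "nendo (G_alg d) \<phi>" "\<And>x. x \<in> gcarrier d \<Longrightarrow> \<psi> (cs x) = cs (\<phi> x)"
      using lift_endo[OF \<open>nendo Q \<psi>\<close>] by blast
    then have "\<phi> ` J \<subseteq> J" using J by (simp add: T_ideal_def)
    with \<phi>(2) sub show ?thesis by fastforce
  qed
qed

text \<open>The preimage of a T-ideal of the factor algebra is a T-ideal of G_d above
  \<open>I\<close>, because endomorphisms descend. It therefore suffices to test all T-ideals of the
  latter kind.\<close>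

lemma T_ideal_gen_Q_memI:
  assumes "f \<in> gcarrier d" "g \<in> gcarrier d"
    and "\<And>J. T_ideal (G_alg d) J \<Longrightarrow> I \<subseteq> J \<Longrightarrow> f \<in> J \<Longrightarrow> g \<in> J"
  shows "cs g \<in> T_ideal_gen Q {cs f}"
  unfolding T_ideal_gen_def
proof safe
  fix N assume N: "T_ideal Q N" "{cs f} \<subseteq> N"
  have "cs 0 \<in> N" using N(1) by (simp add: T_ideal_def nideal_def nsubspace_def zero_Q)
  moreover have "cs x = cs 0" if "x \<in> I" for x using that by (simp add: cs_eq_iff)
  ultimately have "cs x \<in> N" if "x \<in> I" for x using that by metis
  then have "I \<subseteq> {g \<in> gcarrier d. cs g \<in> N}" using I_closed(1) by blast
  with assms(3)[OF T_ideal_preimage[OF N(1)]] assms(1) N(2) show "cs g \<in> N" by blast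
qed

text \<open>The opposite bound, which rests on the lifting of endomorphisms: a single T-ideal above
  \<open>I\<close> that contains \<open>f\<close> already confines everything generated by
  \<open>f\<close>.\<close>

lemma T_ideal_gen_Q_memD:
  assumes "cs g \<in> T_ideal_gen Q {cs f}" "T_ideal (G_alg d) J" "I \<subseteq> J" "f \<in> J"
  shows "g \<in> J"
proof -
  have "cs g \<in> cs ` J"
    using T_ideal_gen_minimal[OF T_ideal_image[OF assms(2)], of "{cs f}"] assms(1,4) by blast
  then obtain h where h: "h \<in> J" "g - h \<in> I" by (auto simp: cs_eq_iff)
  have "h + (g - h) \<in> J"
    using h assms(2,3) unfolding T_ideal_def nideal_G_iff nsubspace_G_iff by blast
  then show ?thesis by simp
qed

end

section \<open>Subspaces of polynomials\<close>

text \<open>Unlike \<open>nsubspace\<close> this makes no reference to a carrier, so relations can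
  be combined freely.\<close>

definition poly_subspace :: "'k::comm_ring_1 yz_poly set \<Rightarrow> bool" where
  "poly_subspace V \<longleftrightarrow> 0 \<in> V \<and> (\<forall>f\<in>V. \<forall>g\<in>V. f + g \<in> V) \<and> (\<forall>c. \<forall>f\<in>V. cst c * f \<in> V)"

lemma poly_subspaceD:
  assumes "poly_subspace V"
  shows "0 \<in> V" "f \<in> V \<Longrightarrow> g \<in> V \<Longrightarrow> f + g \<in> V" "f \<in> V \<Longrightarrow> cst c * f \<in> V"
    "f \<in> V \<Longrightarrow> - f \<in> V" "f \<in> V \<Longrightarrow> g \<in> V \<Longrightarrow> f - g \<in> V"
proof -
  show cl: "0 \<in> V" "f \<in> V \<Longrightarrow> g \<in> V \<Longrightarrow> f + g \<in> V" "f \<in> V \<Longrightarrow> cst c * f \<in> V" for f g c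
    using assms unfolding poly_subspace_def by blast+
  show um: "f \<in> V \<Longrightarrow> - f \<in> V" for f using cl(3)[of f "- 1"] by (simp add: single_uminus)
  show "f \<in> V \<Longrightarrow> g \<in> V \<Longrightarrow> f - g \<in> V" using cl(2)[of f "- g"] um by simp
qed

lemma poly_subspace_sum:
  assumes "poly_subspace V" "\<And>i. i \<in> A \<Longrightarrow> f i \<in> V"
  shows "sum f A \<in> V"
  using assms(2) by (induction A rule: infinite_finite_induct) (auto simp: poly_subspaceD[OF assms(1)])

lemma poly_subspace_cancel:
  fixes V :: "'k::field yz_poly set"
  assumes "poly_subspace V" "cst c * f \<in> V" "c \<noteq> 0"
  shows "f \<in> V"
proof -
  have "cst (1 / c) * (cst c * f) = f"
    using \<open>c \<noteq> 0\<close> by (simp add: mult.assoc[symmetric] mult_single)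
  then show ?thesis using poly_subspaceD(3)[OF assms(1,2)] by metis
qed

lemma poly_subspace_cancel_numeral:
  fixes V :: "'k::field_char_0 yz_poly set"
  assumes "poly_subspace V" "numeral n * f \<in> V"
  shows "f \<in> V"
  by (rule poly_subspace_cancel[OF assms(1), of "numeral n"]) (use assms(2) in auto)

text \<open>Replacing \<open>t\<close> by \<open>2t\<close> and subtracting \<open>2\<^sup>n\<close> times the original kills the leading coefficient.\<close>

lemma poly_subspace_coefficients:
  fixes V :: "'k::field_char_0 yz_poly set"
  assumes V: "poly_subspace V" and "\<And>t. (\<Sum>k\<le>n. cst (t ^ k) * v k) \<in> V" and "k \<le> n"
  shows "v k \<in> V"
  using assms(2,3)
proof (induction n arbitrary: v k)
  case 0
  then show ?case using "0.prems"(1)[of 1] by simp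
next
  case (Suc n)
  have low: "v k \<in> V" if "k \<le> n" for k
  proof -
    have "(\<Sum>k\<le>n. cst (t ^ k) * (cst (2 ^ k - 2 ^ Suc n) * v k)) \<in> V" for t
    proof -
      have "(\<Sum>k\<le>n. cst (t ^ k) * (cst (2 ^ k - 2 ^ Suc n) * v k)) =
          (\<Sum>k\<le>Suc n. cst (t ^ k) * (cst (2 ^ k - 2 ^ Suc n) * v k))"
        by simp
      also have "\<dots> = (\<Sum>k\<le>Suc n. cst ((2 * t) ^ k) * v k) - cst (2 ^ Suc n) * (\<Sum>k\<le>Suc n. cst (t ^ k) * v k)"
        unfolding sum_distrib_left sum_subtractf[symmetric]
      proof (rule sum.cong[OF refl])
        fix k
        show "cst (t ^ k) * (cst (2 ^ k - 2 ^ Suc n) * v k)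
            = cst ((2 * t) ^ k) * v k - cst (2 ^ Suc n) * (cst (t ^ k) * v k)"
          unfolding power_mult_distrib cst_mult single_diff by (simp only: ring_distribs ac_simps)
      qed
      finally show ?thesis
        by (simp only: Suc.prems(1) poly_subspaceD(3,5)[OF V])
    qed
    from Suc.IH[OF this that] have "cst (2 ^ k - 2 ^ Suc n) * v k \<in> V" .
    \<comment> \<open>Distinct powers of 2 stay distinct in K because the characteristic is
      0.\<close>
    moreover have "(2::'k) ^ k - 2 ^ Suc n \<noteq> 0"
    proof -
      have "(2::nat) ^ k < 2 ^ Suc n" using that by (intro power_strict_increasing) simp_all
      then have "of_nat (2 ^ k) \<noteq> (of_nat (2 ^ Suc n) :: 'k)" by (simp only: of_nat_eq_iff)
      then show ?thesis by simp
    qed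
    ultimately show ?thesis by (rule poly_subspace_cancel[OF V])
  qed
  have "(\<Sum>k\<le>n. v k) + v (Suc n) \<in> V" using Suc.prems(1)[of 1] by simp
  moreover have "(\<Sum>k\<le>n. v k) \<in> V" using low by (intro poly_subspace_sum[OF V]) auto
  ultimately have "(\<Sum>k\<le>n. v k) + v (Suc n) - (\<Sum>k\<le>n. v k) \<in> V"
    by (rule poly_subspaceD(5)[OF V])
  then have "v (Suc n) \<in> V" by simp
  with low Suc.prems(2) show ?case by (cases "k = Suc n") auto
qed

lemma poly_subspace_mem:
  assumes "poly_subspace V" "\<And>a b. (a, b) \<in> Poly_Mapping.keys f \<Longrightarrow> yzmon a b \<in> V"
  shows "f \<in> V"
  by (rule poly_mon_induct[of f "\<lambda>a b. yzmon a b \<in> V"])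
    (use assms in \<open>auto simp: poly_subspaceD[OF assms(1)]\<close>)

lemma poly_subspace_of_nsubspace:
  assumes "nsubspace (G_alg d) N"
  shows "poly_subspace {f. (0, f) \<in> N}"
  unfolding poly_subspace_def mem_Collect_eq
proof (intro conjI ballI allI)
  show "(0, 0) \<in> N" using assms by (simp add: nsubspace_G_iff flip: zero_prod_def)
  fix f assume f: "f \<in> {f. (0, f) \<in> N}"
  show "(0, f + g) \<in> N" if "g \<in> {f. (0, f) \<in> N}" for g
  proof -
    have "(0, f) + (0, g) \<in> N" using assms f that unfolding nsubspace_G_iff by blast
    then show ?thesis by simp
  qed
  show "(0, cst c * f) \<in> N" for c
  proof -
    have "gsmult c (0, f) \<in> N" using assms f unfolding nsubspace_G_iff by blast
    then show ?thesis by (simp add: gsmult_pair)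
  qed
qed

section \<open>Identifying the two sets of variables\<close>

definition merge :: "'k::comm_ring_1 yz_poly \<Rightarrow> 'k yz_poly" where
  "merge = psubst yvar yvar"

text \<open>The identification sends x_i to the nonzero y_i and the polynomial part to degree at
  least 2, so an element of the kernel has no linear part.\<close>

definition merge_kernel :: "nat \<Rightarrow> 'k::comm_ring_1 gelem set" where
  "merge_kernel d = {p \<in> gcarrier d. fst p = 0 \<and> merge (snd p) = 0}"

lemma merge_left_right: "merge (left_poly p) = merge (right_poly p)"
  by (simp add: merge_def left_poly_superset[OF finite_keys subset_refl]
      right_poly_superset[OF finite_keys subset_refl])

lemma merge_psubst:
  assumes "\<And>i. merge (r i) = merge (s i)"
  shows "merge (psubst r s f) = psubst (\<lambda>i. merge (r i)) (\<lambda>i. merge (r i)) (merge f)"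
  using assms by (simp add: merge_def psubst_psubst)

text \<open>Left and right versions of an element agree after the identification, so every
  endomorphism \<open>\<phi>\<close> descends to the substitution y_i ->
  \<open>merge (left_poly (\<phi> (xgen i)))\<close> and maps the kernel into itself.\<close>

lemma T_ideal_merge_kernel: "T_ideal (G_alg d) (merge_kernel d)"
  unfolding T_ideal_def nideal_G_iff nsubspace_G_iff
proof (intro conjI ballI allI impI image_subsetI)
  show "gmult a x \<in> merge_kernel d" "gmult x a \<in> merge_kernel d"
    if ax: "a \<in> gcarrier d" "x \<in> merge_kernel d" for a x
  proof -
    obtain f where "x = (0, f)" "merge f = 0" "x \<in> gcarrier d"
      using ax(2) by (cases x) (auto simp: merge_kernel_def)
    then show "gmult a x \<in> merge_kernel d" "gmult x a \<in> merge_kernel d"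
      using ax gcarrier_gmult[of a d x] gcarrier_gmult[of x d a]
      by (simp_all add: merge_kernel_def merge_def gmult_def)
  qed
  show "\<phi> x \<in> merge_kernel d" if \<phi>: "nendo (G_alg d) \<phi>" and ker: "x \<in> merge_kernel d" for \<phi> x
  proof -
    obtain f where x: "x = (0, f)" "merge f = 0" "x \<in> gcarrier d"
      using ker by (cases x) (auto simp: merge_kernel_def)
    have "\<phi> x = gendo (\<lambda>i. \<phi> (xgen i)) x" by (rule nendo_eq_gendo[OF \<phi> x(3)])
    also have "\<dots> = (0, psubst (\<lambda>i. left_poly (\<phi> (xgen i))) (\<lambda>i. right_poly (\<phi> (xgen i))) f)"
      by (simp add: x gendo_poly)
    finally have eq: "\<phi> x = (0, psubst (\<lambda>i. left_poly (\<phi> (xgen i))) (\<lambda>i. right_poly (\<phi> (xgen i))) f)" .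
    have "\<phi> x \<in> gcarrier d" using \<phi> x(3) unfolding nendo_G_iff by blast
    moreover have "merge (snd (\<phi> x)) = 0"
      by (simp add: eq merge_psubst merge_left_right x(2))
    ultimately show ?thesis by (simp add: merge_kernel_def eq)
  qed
qed (auto simp: merge_kernel_def gcarrier_add gcarrier_gsmult merge_def fst_gsmult snd_gsmult
    intro!: poly_mapping_eqI)

lemma prod_yvar_power:
  "(\<Prod>i\<in>Poly_Mapping.keys a. yvar i ^ Poly_Mapping.lookup a i) = yzmon a 0"
proof (induction "exp_size a" arbitrary: a)
  case 0
  then have "a = 0" by simp
  then show ?case by (simp flip: zero_prod_def)
next
  case (Suc n)
  then obtain i a' where a: "a = delta i + a'" "exp_size a' = n" by (metis exp_size_SucE)
  have "Poly_Mapping.lookup (delta i) i = 1" by (simp add: delta_def)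
  then show ?case using Suc.hyps(1)[of a'] a by (simp add: prod_power_add yzmon_delta_left)
qed

lemma msubst_yvar: "msubst yvar yvar k = yzmon (fst k + snd k) 0"
  by (simp add: msubst_def prod_yvar_power mult_single)

lemma lookup_merge:
  "Poly_Mapping.lookup (merge f) (c, 0)
    = (\<Sum>k\<in>{k \<in> Poly_Mapping.keys f. fst k + snd k = c}. Poly_Mapping.lookup f k)"
proof -
  have "Poly_Mapping.lookup (merge f) (c, 0)
      = (\<Sum>k\<in>Poly_Mapping.keys f. Poly_Mapping.lookup f k when fst k + snd k = c)"
    by (simp add: merge_def psubst_def msubst_yvar lookup_sum mult_single lookup_single)
  also have "\<dots> = (\<Sum>k\<in>{k \<in> Poly_Mapping.keys f. fst k + snd k = c}. Poly_Mapping.lookup f k)"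
    by (simp add: when_def sum.inter_filter)
  finally show ?thesis .
qed

text \<open>Monomials have the same image under \<open>merge\<close> exactly if their contents a + b
  agree. If each monomial of f is replaced by one chosen representative of its content, the
  coefficients belonging to a content add up to a coefficient of \<open>merge f\<close>, hence to 0.
  So f is a combination of differences of monomials of equal content.\<close>

lemma merge_kernel_subset:
  assumes V: "poly_subspace V" and f: "merge f = 0"
    and R: "\<And>a b. (a, b) \<in> Poly_Mapping.keys f \<Longrightarrow> R a b"
    and diff: "\<And>a b a' b'. R a b \<Longrightarrow> R a' b' \<Longrightarrow> a + b = a' + b' \<Longrightarrow> yzmon a b - yzmon a' b' \<in> V"
  shows "f \<in> V"
proof -
  define content :: "yz_monom \<Rightarrow> nat \<Rightarrow>\<^sub>0 nat" where "content k = fst k + snd k" for k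
  define rep where "rep c = (SOME k. R (fst k) (snd k) \<and> content k = c)" for c
  let ?S = "Poly_Mapping.keys f" and ?l = "Poly_Mapping.lookup f"
  let ?m = "\<lambda>k. yzmon (fst k) (snd k)"
  have rep: "R (fst (rep (content k))) (snd (rep (content k)))" "content (rep (content k)) = content k"
    if "k \<in> ?S" for k
  proof -
    have "R (fst k) (snd k) \<and> content k = content k" using R that by (cases k) auto
    then have "R (fst (rep (content k))) (snd (rep (content k))) \<and> content (rep (content k)) = content k"
      unfolding rep_def by (rule someI)
    then show "R (fst (rep (content k))) (snd (rep (content k)))"
      "content (rep (content k)) = content k" by auto
  qed
  have "(\<Sum>k\<in>?S. cst (?l k) * ?m (rep (content k))) =
      (\<Sum>c\<in>content ` ?S. \<Sum>k\<in>{k \<in> ?S. content k = c}. cst (?l k) * ?m (rep (content k)))"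
    by (rule sum.image_gen) simp
  also have "\<dots> = (\<Sum>c\<in>content ` ?S. cst (\<Sum>k\<in>{k \<in> ?S. content k = c}. ?l k) * ?m (rep c))"
  proof (rule sum.cong[OF refl])
    fix c
    have "(\<Sum>k\<in>B. cst (?l k)) = cst (\<Sum>k\<in>B. ?l k)" for B
      by (induction B rule: infinite_finite_induct) (simp_all add: single_add)
    then show "(\<Sum>k\<in>{k \<in> ?S. content k = c}. cst (?l k) * ?m (rep (content k)))
        = cst (\<Sum>k\<in>{k \<in> ?S. content k = c}. ?l k) * ?m (rep c)"
      by (simp flip: sum_distrib_right)
  qed
  also have "\<dots> = 0"
    using lookup_merge[of f] f by (simp add: content_def)
  finally have zero: "(\<Sum>k\<in>?S. cst (?l k) * ?m (rep (content k))) = 0" .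
  have "f = (\<Sum>k\<in>?S. cst (?l k) * ?m k)" by (rule poly_sum_mon) auto
  also have "\<dots> = (\<Sum>k\<in>?S. cst (?l k) * (?m k - ?m (rep (content k))))"
    unfolding right_diff_distrib sum_subtractf zero by simp
  also have "\<dots> \<in> V"
  proof (rule poly_subspace_sum[OF V], rule poly_subspaceD(3)[OF V])
    fix k assume k: "k \<in> ?S"
    have "R (fst k) (snd k)" using R k by (cases k) auto
    moreover have "fst k + snd k = fst (rep (content k)) + snd (rep (content k))"
      using rep(2)[OF k] by (simp add: content_def)
    ultimately show "?m k - ?m (rep (content k)) \<in> V" using rep(1)[OF k] diff by blast
  qed
  finally show ?thesis .
qed

section \<open>Consequences and \<open>GL\<^sub>d\<close>-submodules\<close>

definition poly_part :: "'k gelem set \<Rightarrow> ('k::comm_ring_1) yz_poly set" where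
  "poly_part N = {f. (0, f) \<in> N}"

lemma poly_subspace_poly_part: "nsubspace (G_alg d) N \<Longrightarrow> poly_subspace (poly_part N)"
  unfolding poly_part_def by (rule poly_subspace_of_nsubspace)

lemma T_ideal_subspace: "T_ideal (G_alg d) J \<Longrightarrow> poly_subspace (poly_part J)"
  by (rule poly_subspace_poly_part[of d]) (simp add: T_ideal_def nideal_def)

lemma T_ideal_poly_mult:
  assumes "T_ideal (G_alg d) J" "f \<in> poly_part J" "p \<in> gcarrier d"
  shows "left_poly p * f \<in> poly_part J" "right_poly p * f \<in> poly_part J"
proof -
  have "gmult p (0, f) \<in> J" "gmult (0, f) p \<in> J"
    using assms unfolding T_ideal_def nideal_G_iff poly_part_def by blast+
  then show "left_poly p * f \<in> poly_part J" "right_poly p * f \<in> poly_part J"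
    by (simp_all add: gmult_def poly_part_def mult.commute)
qed

lemma T_ideal_var_mult:
  assumes "T_ideal (G_alg d) J" "f \<in> poly_part J" "i \<in> {1..d}"
  shows "yvar i * f \<in> poly_part J" "zvar i * f \<in> poly_part J"
  using T_ideal_poly_mult[OF assms(1,2) xgen_in_gcarrier[OF assms(3)]] by simp_all

lemma yz_in_gcarrier:
  assumes "i \<in> {1..d}" "j \<in> {1..d}"
  shows "yvar i * zvar j \<in> poly_part (gcarrier d)"
  using gcarrier_gmult[OF assms[THEN xgen_in_gcarrier]] by (simp add: gmult_basis poly_part_def)

lemmas gcarrier_var_mult = T_ideal_var_mult[OF T_ideal_gcarrier]
lemmas gcarrier_poly_subspace = T_ideal_subspace[OF T_ideal_gcarrier]

lemma U_generator_in_gcarrier: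
  assumes "d \<ge> 1"
  shows "gsmult a (0, yvar 1 ^ 2 * zvar 1) + gsmult b (0, yvar 1 * zvar 1 ^ 2) \<in> gcarrier d"
proof -
  have "yvar 1 * (yvar 1 * zvar 1) \<in> poly_part (gcarrier d)"
    "zvar 1 * (yvar 1 * zvar 1) \<in> poly_part (gcarrier d)"
    using assms by (auto intro!: gcarrier_var_mult yz_in_gcarrier)
  then show ?thesis
    by (intro gcarrier_add gcarrier_gsmult)
      (simp_all add: poly_part_def power2_eq_square ac_simps)
qed

lemma T_ideal_U:
  assumes "d \<ge> 1"
  shows "T_ideal (G_alg d) (U_ideal d \<alpha>)"
  unfolding U_ideal_def
  by (rule T_ideal_T_ideal_gen)
    (use T_ideal_gcarrier U_generator_in_gcarrier[OF assms] in \<open>auto simp: G_alg_def\<close>)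

lemma G_quotient_U: "d \<ge> 1 \<Longrightarrow> G_quotient d (U_ideal d \<alpha>)"
  by (rule G_quotient.intro) (rule T_ideal_U)

lemma consequences_memI:
  assumes "d \<ge> 1" "f \<in> gcarrier d" "g \<in> gcomponent d m"
    and "\<And>J. T_ideal (G_alg d) J \<Longrightarrow> U_ideal d \<alpha> \<subseteq> J \<Longrightarrow> f \<in> J \<Longrightarrow> g \<in> J"
  shows "GU_image d \<alpha> g \<in> consequences d \<alpha> f m"
proof -
  have "g \<in> gcarrier d" using assms(3) by (simp add: gcomponent_iff)
  with G_quotient.T_ideal_gen_Q_memI[OF G_quotient_U[OF assms(1)] assms(2) this assms(4)] assms(3)
  show ?thesis by (simp add: consequences_def GU_image_def GU_alg_def GU_component_def)
qed

text \<open>\<open>J\<close> may be any T-ideal above the ideal of the variety that contains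
  \<open>f\<close>; a well-chosen one gives an upper bound for the consequences, with a
  representative that is also homogeneous.\<close>

lemma consequences_memE:
  assumes "X \<in> consequences d \<alpha> f m" "d \<ge> 1"
    and "T_ideal (G_alg d) J" "U_ideal d \<alpha> \<subseteq> J" "f \<in> J"
  obtains g where "g \<in> gcomponent d m" "g \<in> J" "X = GU_image d \<alpha> g"
proof -
  obtain g where g: "g \<in> gcomponent d m" "X = GU_image d \<alpha> g"
    using assms(1) by (auto simp: consequences_def GU_component_def)
  moreover have "g \<in> J"
    by (rule G_quotient.T_ideal_gen_Q_memD[OF G_quotient_U[OF assms(2)] _ assms(3-5)])
      (use assms(1) g(2) in \<open>simp add: consequences_def GU_image_def GU_alg_def\<close>)
  ultimately show thesis using that by blast
qed

lemma GU_image_eq_iff: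
  assumes "d \<ge> 1"
  shows "GU_image d \<alpha> g = GU_image d \<alpha> h \<longleftrightarrow> g - h \<in> U_ideal d \<alpha>"
  unfolding GU_image_def by (rule G_quotient.cs_eq_iff[OF G_quotient_U[OF assms]])

lemma nzero_GU: "d \<ge> 1 \<Longrightarrow> nzero (GU_alg d \<alpha>) = GU_image d \<alpha> 0"
  unfolding GU_image_def GU_alg_def by (rule G_quotient.zero_Q[OF G_quotient_U])

lemma nsubspace_Int: "nsubspace A M \<Longrightarrow> nsubspace A N \<Longrightarrow> nsubspace A (M \<inter> N)"
  unfolding nsubspace_def by blast

lemma GL_action_gcomponent:
  assumes "GL_action d M \<phi>" "p \<in> gcomponent d m"
  shows "\<phi> p \<in> gcomponent d m"
proof (rule nendo_linear_gcomponent[OF _ _ assms(2)])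
  show "nendo (G_alg d) \<phi>" using assms(1) by (simp add: GL_action_def nauto_def)
  show "\<phi> (xgen i) \<in> gcomponent d 1" if "i \<in> {1..d}" for i
  proof -
    have "\<phi> (xgen i) = (\<Sum>r\<in>{1..d}. gsmult (M $$ (r - 1, i - 1)) (xgen r))"
      using assms(1) that unfolding GL_action_def by blast
    then show ?thesis
      by (simp only:) (intro gcomponent_sum gcomponent_gsmult xgen_in_gcomponent)
  qed
qed

lemma GL_submodule_consequences:
  assumes d: "d \<ge> 1" and f: "f \<in> gcarrier d"
  shows "GL_submodule d \<alpha> (consequences d \<alpha> f m)"
proof -
  interpret G_quotient d "U_ideal d \<alpha>" by (rule G_quotient_U[OF d])
  let ?T = "T_ideal_gen (GU_alg d \<alpha>) {GU_image d \<alpha> f}"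
  have T: "T_ideal Q ?T"
    unfolding GU_alg_def GU_image_def
    by (rule T_ideal_T_ideal_gen[OF T_ideal_carrier_Q]) (use f in \<open>auto simp: carrier_Q\<close>)
  have "gcomponent d m \<subseteq> gcarrier d" by (auto simp: gcomponent_iff)
  then have "nsubspace Q (cs ` gcomponent d m)"
    by (intro nsubspace_image) (simp add: nsubspace_G_iff gcomponent_add gcomponent_gsmult)
  with T have sub: "nsubspace (GU_alg d \<alpha>) (consequences d \<alpha> f m)"
    unfolding consequences_def
    by (intro nsubspace_Int)
      (simp_all add: T_ideal_def nideal_def GU_alg_def GU_component_def GU_image_def)
  show ?thesis
    unfolding GL_submodule_def
  proof (intro conjI allI impI ballI sub)
    fix M :: "'a mat" and \<phi> :: "'a gelem \<Rightarrow> 'a gelem" and g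
    assume GL: "M \<in> carrier_mat d d \<and> invertible_mat M \<and> GL_action d M \<phi>"
      and g: "g \<in> gcarrier d" "GU_image d \<alpha> g \<in> consequences d \<alpha> f m"
    have \<phi>: "nendo (G_alg d) \<phi>" using GL by (simp add: GL_action_def nauto_def)
    obtain \<psi> where \<psi>: "nendo Q \<psi>" "\<And>x. x \<in> gcarrier d \<Longrightarrow> \<psi> (cs x) = cs (\<phi> x)"
      using induced_endo[OF \<phi>] by blast
    have "\<psi> ` ?T \<subseteq> ?T" using T \<psi>(1) by (simp add: T_ideal_def)
    moreover have "cs g \<in> ?T" using g(2) by (simp add: consequences_def GU_image_def)
    ultimately have 1: "cs (\<phi> g) \<in> ?T" using \<psi>(2)[OF g(1)] by (metis image_subset_iff)
    \<comment> \<open>The representative \<open>g\<close> need not be homogeneous; since the action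
      respects cosets, it is applied to a homogeneous one instead.\<close>
    obtain h where h: "h \<in> gcomponent d m" "cs g = cs h"
      using g(2) by (auto simp: consequences_def GU_component_def GU_image_def)
    have "h \<in> gcarrier d" using h(1) by (simp add: gcomponent_iff)
    then have "cs (\<phi> g) = cs (\<phi> h)" using \<psi>(2) g(1) h(2) by metis
    moreover have "\<phi> h \<in> gcomponent d m" using GL_action_gcomponent GL h(1) by blast
    ultimately show "GU_image d \<alpha> (\<phi> g) \<in> consequences d \<alpha> f m"
      using 1 by (simp add: consequences_def GU_component_def GU_image_def)
  qed
qed

lemma GL_submodule_gen_minimal:
  "GL_submodule d \<alpha> N \<Longrightarrow> GU_image d \<alpha> ` S \<subseteq> N \<Longrightarrow> GL_submodule_gen d \<alpha> S \<subseteq> N"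
  by (auto simp: GL_submodule_gen_def)

section \<open>Transvections x_i -> x_i + t x_j and the action of GL_d\<close>

definition transv :: "nat \<Rightarrow> nat \<Rightarrow> 'k::comm_ring_1 \<Rightarrow> nat \<Rightarrow> 'k gelem" where
  "transv i j t k = (if k = i then xgen i + gsmult t (xgen j) else xgen k)"

lemma transv_in_gcarrier:
  "i \<in> {1..d} \<Longrightarrow> j \<in> {1..d} \<Longrightarrow> k \<in> {1..d} \<Longrightarrow> transv i j t k \<in> gcarrier d"
  by (auto simp: transv_def intro!: gcarrier_add gcarrier_gsmult xgen_in_gcarrier)

lemma gendo_transv_inverse:
  assumes ij: "i \<in> {1..d}" "j \<in> {1..d}" "i \<noteq> j" and p: "p \<in> gcarrier d"
  shows "gendo (transv i j (- t)) (gendo (transv i j t) p) = p"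
proof -
  have e: "nendo (G_alg d) (gendo (transv i j s))" for s :: 'a
    by (rule nendo_gendo) (rule transv_in_gcarrier[OF ij(1,2)])
  have "(gendo (transv i j (- t)) \<circ> gendo (transv i j t)) p = id p"
  proof (rule nendo_G_eqI[OF _ _ _ p])
    show "nendo (G_alg d) (gendo (transv i j (- t)) \<circ> gendo (transv i j t))"
      using e[of t] e[of "- t"] unfolding nendo_G_iff comp_def
      by (simp add: gendo_add gendo_gsmult gendo_gmult)
    show "nendo (G_alg d) (id :: 'a gelem \<Rightarrow> 'a gelem)" by (simp add: nendo_G_iff)
    show "(gendo (transv i j (- t)) \<circ> gendo (transv i j t)) (xgen k) = id (xgen k)" for k
      using ij(3) by (auto simp: transv_def gendo_add gendo_gsmult add.assoc simp flip: gsmult_add_left)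
  qed
  then show ?thesis by simp
qed

text \<open>Column \<open>i - 1\<close> holds the coordinates of the image x_i + t x_j, so the entry
  t stands in row \<open>j - 1\<close>; the shift by one turns variable indices into matrix
  indices.\<close>

lemma GL_action_transv:
  assumes ij: "i \<in> {1..d}" "j \<in> {1..d}" "i \<noteq> j"
  shows "GL_action d (addrow_mat d t (j - 1) (i - 1)) (gendo (transv i j t))"
  unfolding GL_action_def nauto_def
proof (intro conjI ballI)
  show e: "nendo (G_alg d) (gendo (transv i j t))" for t :: 'a
    by (rule nendo_gendo) (rule transv_in_gcarrier[OF ij(1,2)])
  have sub: "gendo (transv i j t) ` gcarrier d \<subseteq> gcarrier d" for t :: 'a
    using e unfolding nendo_G_iff by blast
  have inv: "gendo (transv i j t) (gendo (transv i j (- t)) p) = p" if "p \<in> gcarrier d" for p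
    using gendo_transv_inverse[OF ij that, of "- t"] by simp
  have "bij_betw (gendo (transv i j t)) (gcarrier d) (gcarrier d)"
    by (rule bij_betw_byWitness[where f' = "gendo (transv i j (- t))", OF _ _ sub sub])
      (intro ballI gendo_transv_inverse[OF ij] inv; assumption)+
  then show "bij_betw (gendo (transv i j t)) (ncarrier (G_alg d)) (ncarrier (G_alg d))"
    by (simp add: G_alg_def)
  fix l assume l: "l \<in> {1..d}"
  have "(\<Sum>r\<in>{1..d}. gsmult (addrow_mat d t (j - 1) (i - 1) $$ (r - 1, l - 1)) (xgen r))
      = (\<Sum>r\<in>{1..d}. (if r = l then xgen r else 0) + (if r = j then if l = i then gsmult t (xgen r) else 0 else 0))"
  proof (rule sum.cong[OF refl])
    fix r assume r: "r \<in> {1..d}"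
    have "j - 1 = r - 1 \<longleftrightarrow> r = j" "i - 1 = l - 1 \<longleftrightarrow> l = i" "r - 1 = l - 1 \<longleftrightarrow> r = l"
      using r l ij by auto
    moreover have "r - 1 < d" "l - 1 < d" using r l by auto
    ultimately show "gsmult (addrow_mat d t (j - 1) (i - 1) $$ (r - 1, l - 1)) (xgen r)
        = (if r = l then xgen r else 0) + (if r = j then if l = i then gsmult t (xgen r) else 0 else 0)"
      using ij(3) by (auto simp del: One_nat_def)
  qed
  also have "\<dots> = transv i j t l"
    using l ij by (simp add: sum.distrib transv_def)
  finally show "gendo (transv i j t) (xgen l)
      = (\<Sum>r\<in>{1..d}. gsmult (addrow_mat d t (j - 1) (i - 1) $$ (r - 1, l - 1)) (xgen r))"
    by simp
qed

lemma invertible_addrow_mat: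
  fixes t :: "'k::comm_ring_1"
  assumes "k < n" "l < n" "k \<noteq> l"
  shows "invertible_mat (addrow_mat n t k l)"
  using addrow_mat_inv[OF assms, of t] addrow_mat_inv[OF assms, of "- t"]
  unfolding invertible_mat_def inverts_mat_def
  by (intro conjI exI[of _ "addrow_mat n (- t) k l"]) simp_all

definition transv_subst :: "nat \<Rightarrow> nat \<Rightarrow> 'k::comm_ring_1 \<Rightarrow> 'k yz_poly \<Rightarrow> 'k yz_poly" where
  "transv_subst i j t = psubst (yvar(i := yvar i + cst t * yvar j)) (zvar(i := zvar i + cst t * zvar j))"

lemma gendo_transv: "gendo (transv i j t) (0, f) = (0, transv_subst i j t f)"
proof -
  have "(\<lambda>k. left_poly (transv i j t k)) = yvar(i := yvar i + cst t * yvar j)"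
    "(\<lambda>k. right_poly (transv i j t k)) = zvar(i := zvar i + cst t * zvar j)"
    by (auto simp: transv_def)
  then show ?thesis by (simp add: gendo_poly transv_subst_def)
qed

text \<open>Pulls a submodule of the factor algebra back to polynomials, so that the later
  computations are made with representatives modulo the ideal of the variety.\<close>

definition GL_preimage :: "nat \<Rightarrow> 'k::field \<times> 'k \<Rightarrow> 'k gelem set set \<Rightarrow> 'k yz_poly set" where
  "GL_preimage d \<alpha> N = {f \<in> poly_part (gcarrier d). GU_image d \<alpha> (0, f) \<in> N}"

lemma GL_preimage_subspace:
  assumes "d \<ge> 1" "GL_submodule d \<alpha> N"
  shows "poly_subspace (GL_preimage d \<alpha> N)"
proof -
  have "nsubspace (G_alg d) {g \<in> gcarrier d. GU_image d \<alpha> g \<in> N}"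
    unfolding GU_image_def
    by (rule G_quotient.nsubspace_preimage[OF G_quotient_U[OF assms(1)]])
      (use assms(2) in \<open>simp add: GL_submodule_def GU_alg_def\<close>)
  from poly_subspace_poly_part[OF this] show ?thesis
    by (simp add: poly_part_def GL_preimage_def)
qed

lemma GL_preimage_U:
  assumes "d \<ge> 1" "GL_submodule d \<alpha> N"
  shows "poly_part (U_ideal d \<alpha>) \<subseteq> GL_preimage d \<alpha> N"
proof
  fix f assume f: "f \<in> poly_part (U_ideal d \<alpha>)"
  have "nzero (GU_alg d \<alpha>) \<in> N" using assms(2) by (simp add: GL_submodule_def nsubspace_def)
  moreover have "GU_image d \<alpha> (0, f) = nzero (GU_alg d \<alpha>)"
    using f by (simp add: nzero_GU[OF assms(1)] GU_image_eq_iff[OF assms(1)] poly_part_def)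
  moreover have "U_ideal d \<alpha> \<subseteq> gcarrier d"
    using T_ideal_U[OF assms(1)] unfolding T_ideal_def nideal_G_iff nsubspace_G_iff by blast
  ultimately show "f \<in> GL_preimage d \<alpha> N"
    using f by (auto simp: GL_preimage_def poly_part_def)
qed

lemma GL_preimage_transv:
  assumes N: "GL_submodule d \<alpha> N" and ij: "i \<in> {1..d}" "j \<in> {1..d}" "i \<noteq> j"
    and f: "f \<in> GL_preimage d \<alpha> N"
  shows "transv_subst i j t f \<in> GL_preimage d \<alpha> N"
proof -
  let ?M = "addrow_mat d t (j - 1) (i - 1)"
  have "?M \<in> carrier_mat d d \<and> invertible_mat ?M \<and> GL_action d ?M (gendo (transv i j t))"
    using ij by (intro conjI invertible_addrow_mat GL_action_transv) auto
  moreover have "(0, f) \<in> gcarrier d" "GU_image d \<alpha> (0, f) \<in> N"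
    using f by (auto simp: GL_preimage_def poly_part_def)
  ultimately have "GU_image d \<alpha> (gendo (transv i j t) (0, f)) \<in> N"
    using N unfolding GL_submodule_def by blast
  moreover have "gendo (transv i j t) (0, f) \<in> gcarrier d"
    by (rule gendo_in_gcarrier[OF transv_in_gcarrier[OF ij(1,2)] \<open>(0, f) \<in> gcarrier d\<close>])
  ultimately show ?thesis by (simp add: gendo_transv GL_preimage_def poly_part_def)
qed

text \<open>For degree 2 in t the values 1 and -1 suffice: half the difference of the two results is
  g, and half their sum, after removing f, is h.\<close>

lemma GL_preimage_transv_coeffs:
  fixes f :: "'k::field_char_0 yz_poly"
  assumes "d \<ge> 1" and N: "GL_submodule d \<alpha> N" and ij: "i \<in> {1..d}" "j \<in> {1..d}" "i \<noteq> j"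
    and f: "f \<in> GL_preimage d \<alpha> N"
    and eq: "\<And>t. transv_subst i j t f = f + cst t * g + cst t * cst t * h"
  shows "g \<in> GL_preimage d \<alpha> N" "h \<in> GL_preimage d \<alpha> N"
proof -
  note V = poly_subspaceD[OF GL_preimage_subspace[OF assms(1) N]]
  note cancel = poly_subspace_cancel_numeral[OF GL_preimage_subspace[OF assms(1) N]]
  have 1: "f + g + h \<in> GL_preimage d \<alpha> N" "f - g + h \<in> GL_preimage d \<alpha> N"
    using GL_preimage_transv[OF N ij f, of 1] GL_preimage_transv[OF N ij f, of "- 1"]
    by (simp_all add: eq single_uminus)
  have "(f + g + h) - (f - g + h) = 2 * g" "(f + g + h) + (f - g + h) - f - f = 2 * h"
    by simp_all
  with 1 f V(2,5) have "2 * g \<in> GL_preimage d \<alpha> N" "2 * h \<in> GL_preimage d \<alpha> N"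
    by metis+
  then show "g \<in> GL_preimage d \<alpha> N" "h \<in> GL_preimage d \<alpha> N" using cancel by blast+
qed

section \<open>Relations in the T-ideal\<close>

lemma exp_size_1E:
  assumes "exp_size a = 1" "Poly_Mapping.keys a \<subseteq> {1..d}"
  obtains i where "a = delta i" "i \<in> {1..d}"
proof -
  obtain i a' where a: "a = delta i + a'" "exp_size a' = 0" using assms(1) exp_size_SucE[of a 0] by auto
  then have "a = delta i" by simp
  then show thesis using that assms(2) by simp
qed

lemma exp_size_2E:
  assumes "exp_size a = 2" "Poly_Mapping.keys a \<subseteq> {1..d}"
  obtains i j where "a = delta i + delta j" "i \<in> {1..d}" "j \<in> {1..d}"
proof -
  obtain i a' where a: "a = delta i + a'" "exp_size a' = 1"
    using assms(1) exp_size_SucE[of a 1] by (metis Suc_1)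
  moreover have "Poly_Mapping.keys a' \<subseteq> {1..d}" "i \<in> {1..d}"
    using assms(2) by (auto simp: a keys_nat_add)
  ultimately show thesis using exp_size_1E[of a' d] that by metis
qed

lemma exp_size_3E:
  assumes "exp_size a = 3" "Poly_Mapping.keys a \<subseteq> {1..d}"
  obtains i j k where "a = delta i + (delta j + delta k)" "i \<in> {1..d}" "j \<in> {1..d}" "k \<in> {1..d}"
proof -
  obtain i a' where a: "a = delta i + a'" "exp_size a' = 2"
    using assms(1) exp_size_SucE[of a 2] by (metis eval_nat_numeral(3))
  moreover have "Poly_Mapping.keys a' \<subseteq> {1..d}" "i \<in> {1..d}"
    using assms(2) by (auto simp: a keys_nat_add)
  ultimately show thesis using exp_size_2E[of a' d] that by metis
qed

lemma degree_3_cases: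
  assumes "good_exp d a b" "exp_size a + exp_size b = 3"
  obtains i j k where "i \<in> {1..d}" "j \<in> {1..d}" "k \<in> {1..d}" "a = delta i + delta j" "b = delta k"
  | i j k where "i \<in> {1..d}" "j \<in> {1..d}" "k \<in> {1..d}" "a = delta i" "b = delta j + delta k"
proof -
  have "exp_size a = 2 \<and> exp_size b = 1 \<or> exp_size a = 1 \<and> exp_size b = 2"
    using assms by (auto simp: good_exp_def)
  then show thesis
    using assms(1) that exp_size_1E exp_size_2E unfolding good_exp_def by metis
qed

lemma degree_4_cases:
  assumes "good_exp d a b" "exp_size a + exp_size b = 4"
  obtains i j k l where "i \<in> {1..d}" "j \<in> {1..d}" "k \<in> {1..d}" "l \<in> {1..d}"
      "a = delta i + (delta j + delta k)" "b = delta l"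
  | i j k l where "i \<in> {1..d}" "j \<in> {1..d}" "k \<in> {1..d}" "l \<in> {1..d}"
      "a = delta i + delta j" "b = delta k + delta l"
  | i j k l where "i \<in> {1..d}" "j \<in> {1..d}" "k \<in> {1..d}" "l \<in> {1..d}"
      "a = delta i" "b = delta j + (delta k + delta l)"
proof -
  have k: "Poly_Mapping.keys a \<subseteq> {1..d}" "Poly_Mapping.keys b \<subseteq> {1..d}"
    using assms(1) by (auto simp: good_exp_def)
  consider "exp_size a = 3" "exp_size b = 1" | "exp_size a = 2" "exp_size b = 2"
    | "exp_size a = 1" "exp_size b = 3"
    using assms by (auto simp: good_exp_def) linarith
  then show thesis
  proof cases
    case 1
    from exp_size_3E[OF 1(1) k(1)] exp_size_1E[OF 1(2) k(2)] that(1) show thesis by metis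
  next
    case 2
    from exp_size_2E[OF 2(1) k(1)] exp_size_2E[OF 2(2) k(2)] that(2) show thesis by metis
  next
    case 3
    from exp_size_1E[OF 3(1) k(1)] exp_size_3E[OF 3(2) k(2)] that(3) show thesis by metis
  qed
qed

lemma poly_subspace_trans:
  assumes "poly_subspace V" "f - g \<in> V" "g - h \<in> V"
  shows "f - h \<in> V"
  using poly_subspaceD(2)[OF assms] by simp

lemma poly_subspace_sym:
  assumes "poly_subspace V" "f - g \<in> V"
  shows "g - f \<in> V"
  using poly_subspaceD(4)[OF assms] by simp

text \<open>Modulo \<open>W\<close> every monomial is congruent to one of the same content with a
  single y. Two such forms of equal content differ at most in which variable is the y, and this is
  what \<open>swap\<close> corrects.\<close>

lemma same_content_cong:
  assumes W: "poly_subspace W"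
    and canon: "\<And>a b. good_exp d a b \<Longrightarrow> exp_size a + exp_size b = m \<Longrightarrow>
      \<exists>i c. good_exp d (delta i) c \<and> delta i + c = a + b \<and> yzmon a b - yzmon (delta i) c \<in> W"
    and swap: "\<And>i j e. i \<in> {1..d} \<Longrightarrow> j \<in> {1..d} \<Longrightarrow> Poly_Mapping.keys e \<subseteq> {1..d} \<Longrightarrow>
      exp_size e + 2 = m \<Longrightarrow> yzmon (delta i) (delta j + e) - yzmon (delta j) (delta i + e) \<in> W"
    and ab: "good_exp d a b \<and> exp_size a + exp_size b = m"
    and ab': "good_exp d a' b' \<and> exp_size a' + exp_size b' = m"
    and eq: "a + b = a' + b'"
  shows "yzmon a b - yzmon a' b' \<in> W"
proof -
  obtain i c where ic: "good_exp d (delta i) c" "delta i + c = a + b" "yzmon a b - yzmon (delta i) c \<in> W"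
    using canon ab by blast
  obtain j c' where jc: "good_exp d (delta j) c'" "delta j + c' = a' + b'"
      "yzmon a' b' - yzmon (delta j) c' \<in> W"
    using canon ab' by blast
  have "yzmon (delta i) c - yzmon (delta j) c' \<in> W"
  proof (cases "i = j")
    case True
    then have "c = c'" using ic(2) jc(2) eq by (metis add_left_cancel)
    then show ?thesis using True poly_subspaceD(1)[OF W] by simp
  next
    case False
    have "delta i + c = delta j + c'" using ic(2) jc(2) eq by simp
    then obtain e where e: "c = delta j + e" "c' = delta i + e" using False by (rule delta_add_eqE)
    have "exp_size (delta i + c) = exp_size a + exp_size b" using ic(2) by simp
    then have "exp_size e + 2 = m" using ab by (simp add: e)
    then show ?thesis
      unfolding e using ic(1) jc(1) by (intro swap) (auto simp: good_exp_def e keys_nat_add)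
  qed
  with ic(3) jc(3) show ?thesis
    using poly_subspace_trans[OF W] poly_subspace_sym[OF W] by blast
qed

lemma gcomponent_poly: "n \<ge> 2 \<Longrightarrow> g \<in> gcomponent d n \<Longrightarrow> fst g = 0"
  by (auto simp: gcomponent_iff)

lemma merge_kernel_component_subset:
  assumes W: "poly_subspace W" and m: "m \<ge> 2"
    and canon: "\<And>a b. good_exp d a b \<Longrightarrow> exp_size a + exp_size b = m \<Longrightarrow>
      \<exists>i c. good_exp d (delta i) c \<and> delta i + c = a + b \<and> yzmon a b - yzmon (delta i) c \<in> W"
    and swap: "\<And>i j e. i \<in> {1..d} \<Longrightarrow> j \<in> {1..d} \<Longrightarrow> Poly_Mapping.keys e \<subseteq> {1..d} \<Longrightarrow>
      exp_size e + 2 = m \<Longrightarrow> yzmon (delta i) (delta j + e) - yzmon (delta j) (delta i + e) \<in> W"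
    and f: "(0, f) \<in> gcomponent d m" "merge f = 0"
  shows "f \<in> W"
proof (rule merge_kernel_subset[OF W f(2), where R = "\<lambda>a b. good_exp d a b \<and> exp_size a + exp_size b = m"])
  show "good_exp d a b \<and> exp_size a + exp_size b = m" if "(a, b) \<in> Poly_Mapping.keys f" for a b
    using f(1) that by (auto simp: gcomponent_iff gcarrier_iff)
qed (rule same_content_cong[OF W canon swap])

text \<open>Full linearization of a x (a - x) by inclusion and exclusion over sums of the pairs (a,
  x), (b, y), (c, z), a pair standing for the left and right version of one element. A squared
  factor gives each mixed term twice, whence the 2.\<close>

lemma cubic_polarization:
  fixes a b c x y z :: "'a::comm_ring_1"
  shows "2 * (a*b*z + a*c*y + b*c*x - (x*y*c + x*z*b + y*z*a)) =
    (a+b+c)*(x+y+z)*((a+b+c)-(x+y+z)) - (a+b)*(x+y)*((a+b)-(x+y)) - (a+c)*(x+z)*((a+c)-(x+z))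
    - (b+c)*(y+z)*((b+c)-(y+z)) + a*x*(a-x) + b*y*(b-y) + c*z*(c-z)"
  by (simp add: algebra_simps power2_eq_square)

text \<open>The same linearization for a x^2, needed for the identity y_1 z_1^2.\<close>

lemma cubic_polarization':
  fixes a b c x y z :: "'a::comm_ring_1"
  shows "2 * (a*y*z + b*x*z + c*x*y) =
    (a+b+c)*(x+y+z)^2 - (a+b)*(x+y)^2 - (a+c)*(x+z)^2 - (b+c)*(y+z)^2 + a*x^2 + b*y^2 + c*z^2"
  by (simp add: algebra_simps power2_eq_square)

lemma T_ideal_psubst:
  assumes J: "T_ideal (G_alg d) J" and f: "f \<in> poly_part J"
    and P: "\<And>i. i \<in> {1..d} \<Longrightarrow> P i \<in> gcarrier d"
  shows "psubst (\<lambda>i. left_poly (P i)) (\<lambda>i. right_poly (P i)) f \<in> poly_part J"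
proof -
  have "gendo P (0, f) \<in> J"
    using J f nendo_gendo[of d P] P unfolding T_ideal_def poly_part_def by blast
  then show ?thesis by (simp add: gendo_poly poly_part_def)
qed

text \<open>\<open>J\<close> is left general: it becomes the ideal of the variety itself for upper
  bounds, and an arbitrary T-ideal containing a given polynomial for lower bounds.\<close>

locale U_relations =
  fixes d :: nat and J :: "'k::field_char_0 gelem set"
  assumes T_ideal_J: "T_ideal (G_alg d) J"
    and cubic_J: "yvar 1 ^ 2 * zvar 1 - yvar 1 * zvar 1 ^ 2 \<in> poly_part J"
begin

abbreviation V :: "'k yz_poly set" where
  "V \<equiv> poly_part J"

lemmas subspace_V = T_ideal_subspace[OF T_ideal_J]
lemmas V_closed = poly_subspaceD[OF subspace_V]
lemmas V_cancel = poly_subspace_cancel_numeral[OF subspace_V]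
lemmas V_var_mult = T_ideal_var_mult[OF T_ideal_J]
lemmas V_trans = poly_subspace_trans[OF subspace_V]
lemmas V_sym = poly_subspace_sym[OF subspace_V]

lemma cubic_V:
  assumes "p \<in> gcarrier d"
  shows "left_poly p * right_poly p * (left_poly p - right_poly p) \<in> V"
  using T_ideal_psubst[OF T_ideal_J cubic_J, of "\<lambda>_. p"] assms
  by (simp add: algebra_simps power2_eq_square)

lemma trilinear_V:
  assumes "p \<in> gcarrier d" "q \<in> gcarrier d" "r \<in> gcarrier d"
  shows "left_poly p * left_poly q * right_poly r + left_poly p * left_poly r * right_poly q
      + left_poly q * left_poly r * right_poly p
      - (right_poly p * right_poly q * left_poly r + right_poly p * right_poly r * left_poly q
      + right_poly q * right_poly r * left_poly p) \<in> V"
proof (rule V_cancel)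
  have "p + q \<in> gcarrier d" "p + r \<in> gcarrier d" "q + r \<in> gcarrier d" "p + q + r \<in> gcarrier d"
    using assms by (simp_all add: gcarrier_add)
  note c = this[THEN cubic_V] assms[THEN cubic_V]
  show "2 * (left_poly p * left_poly q * right_poly r + left_poly p * left_poly r * right_poly q
      + left_poly q * left_poly r * right_poly p
      - (right_poly p * right_poly q * left_poly r + right_poly p * right_poly r * left_poly q
      + right_poly q * right_poly r * left_poly p)) \<in> V"
    unfolding cubic_polarization using c
    by (intro V_closed(2,5)) (simp_all only: left_poly_add right_poly_add)
qed

text \<open>An element without linear part has equal left and right versions; with it as one of the
  three arguments the terms in y_k z_l and y_l z_k cancel.\<close>

lemma square_swap_V:
  assumes "f \<in> poly_part (gcarrier d)" "k \<in> {1..d}" "l \<in> {1..d}"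
  shows "f * (yvar k * yvar l - zvar k * zvar l) \<in> V"
proof -
  have "(0, f) \<in> gcarrier d" using assms(1) by (simp add: poly_part_def)
  from trilinear_V[OF this assms(2,3)[THEN xgen_in_gcarrier]] show ?thesis
    by (simp add: algebra_simps)
qed

text \<open>With two arguments free of linear part, y_k and z_k are left with the coefficients 2 - 1
  and 1 - 2.\<close>

lemma var_swap_V:
  assumes "f \<in> poly_part (gcarrier d)" "g \<in> poly_part (gcarrier d)" "k \<in> {1..d}"
  shows "f * g * (yvar k - zvar k) \<in> V"
proof -
  have "(0, f) \<in> gcarrier d" "(0, g) \<in> gcarrier d" using assms(1,2) by (simp_all add: poly_part_def)
  from trilinear_V[OF this xgen_in_gcarrier[OF assms(3)]] show ?thesis
    by (simp add: algebra_simps)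
qed

lemma good_in_gcarrier: "good_exp d a b \<Longrightarrow> yzmon a b \<in> poly_part (gcarrier d)"
  by (simp add: poly_part_def gcarrier_yzmon)

lemma move_two:
  assumes "good_exp d a b" "k \<in> {1..d}" "l \<in> {1..d}"
  shows "yzmon (delta k + (delta l + a)) b - yzmon a (delta k + (delta l + b)) \<in> V"
  using square_swap_V[OF good_in_gcarrier[OF assms(1)] assms(2,3)]
  by (simp add: yzmon_delta_left yzmon_delta_right right_diff_distrib mult_ac)

text \<open>Sizes at least 2 on both sides let the monomial split into two basis monomials, as
  \<open>var_swap_V\<close> demands; with the moved variable the degree is at least 5.\<close>

lemma move_one:
  assumes "good_exp d a b" "exp_size a \<ge> 2" "exp_size b \<ge> 2" "k \<in> {1..d}"
  shows "yzmon (delta k + a) b - yzmon a (delta k + b) \<in> V"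
proof -
  obtain n m where "exp_size a = Suc (Suc n)" "exp_size b = Suc (Suc m)"
    using assms(2,3) by (metis add_2_eq_Suc le_Suc_ex)
  then obtain i a' j b' where a: "a = delta i + a'" "exp_size a' = Suc n"
      and b: "b = delta j + b'" "exp_size b' = Suc m"
    by (metis exp_size_SucE)
  have "good_exp d (delta i) (delta j)" "good_exp d a' b'"
    using assms(1) a b by (auto simp: good_exp_def keys_nat_add)
  from var_swap_V[OF this[THEN good_in_gcarrier] assms(4)] show ?thesis
    by (simp add: a b yzmon_delta_left yzmon_delta_right yzmon_delta left_diff_distrib right_diff_distrib mult_ac)
qed

text \<open>For a variable k split off \<open>e\<close>, both monomials are congruent to the one
  with y_i y_j y_k on the left. A further z must remain so that y_i times the rest lies in G_d,
  hence size at least 2.\<close>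

lemma swap_V:
  assumes "i \<in> {1..d}" "j \<in> {1..d}" "Poly_Mapping.keys e \<subseteq> {1..d}" "exp_size e \<ge> 2"
  shows "yzmon (delta i) (delta j + e) - yzmon (delta j) (delta i + e) \<in> V"
proof -
  obtain n where "exp_size e = Suc (Suc n)" using assms(4) by (metis add_2_eq_Suc le_Suc_ex)
  then obtain k e' where e: "e = delta k + e'" "exp_size e' = Suc n" by (rule exp_size_SucE)
  have k: "k \<in> {1..d}" and g: "good_exp d (delta i) e'" "good_exp d (delta j) e'"
    using assms e by (auto simp: good_exp_def keys_nat_add)
  have "yzmon (delta j + (delta k + delta i)) e' - yzmon (delta i) (delta j + e) \<in> V"
    using move_two[OF g(1) assms(2) k] by (simp add: e)
  moreover have "yzmon (delta j + (delta k + delta i)) e' - yzmon (delta j) (delta i + e) \<in> V"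
    using move_two[OF g(2) assms(1) k] by (simp add: e ac_simps)
  ultimately show ?thesis using V_trans V_sym by blast
qed

text \<open>Moving variables over in pairs brings an odd y-degree down to 1. An even y-degree needs
  one single move to change the parity, and degree 5 leaves room for it.\<close>

lemma canonical_V:
  assumes "good_exp d a b" "exp_size a + exp_size b \<ge> 5"
  shows "\<exists>i c. good_exp d (delta i) c \<and> delta i + c = a + b \<and> yzmon a b - yzmon (delta i) c \<in> V"
proof -
  have odd: "\<exists>i c. good_exp d (delta i) c \<and> delta i + c = a + b \<and> yzmon a b - yzmon (delta i) c \<in> V"
    if "good_exp d a b" "odd (exp_size a)" for a b
    using that
  proof (induction "exp_size a" arbitrary: a b rule: less_induct)
    case less
    show ?case
    proof (cases "exp_size a = 1")
      case True
      then obtain i where "a = delta i"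
        using less.prems(1) exp_size_1E by (metis good_exp_def)
      then show ?thesis using less.prems V_closed(1) by (intro exI[of _ i] exI[of _ b]) simp
    next
      case False
      moreover obtain r where r: "exp_size a = 2 * r + 1" using less.prems(2) by (rule oddE)
      ultimately have "exp_size a = Suc (Suc (Suc (2 * (r - 1))))" by simp
      then obtain k a1 where a1: "a = delta k + a1" "exp_size a1 = Suc (Suc (2 * (r - 1)))"
        by (rule exp_size_SucE)
      from a1(2) obtain l a2 where a2: "a1 = delta l + a2" "exp_size a2 = Suc (2 * (r - 1))"
        by (rule exp_size_SucE)
      have kl: "k \<in> {1..d}" "l \<in> {1..d}" and g: "good_exp d a2 b"
        and g': "good_exp d a2 (delta k + (delta l + b))"
        using less.prems(1) a1 a2 by (auto simp: good_exp_def keys_nat_add)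
      have "exp_size a2 < exp_size a" "odd (exp_size a2)" using less.prems(2) by (auto simp: a1 a2)
      then obtain i c where ic: "good_exp d (delta i) c" "delta i + c = a2 + (delta k + (delta l + b))"
          "yzmon a2 (delta k + (delta l + b)) - yzmon (delta i) c \<in> V"
        using less.hyps g' by blast
      have "yzmon a b - yzmon a2 (delta k + (delta l + b)) \<in> V"
        using move_two[OF g kl] by (simp add: a1 a2)
      from V_trans[OF this ic(3)] ic(1,2) show ?thesis by (auto simp: a1 a2 ac_simps)
    qed
  qed
  \<comment> \<open>One z is moved to the y side, which makes the y-degree odd; with three z's two
    remain beside the moved one, as \<open>move_one\<close> requires.\<close>
  have even: "\<exists>i c. good_exp d (delta i) c \<and> delta i + c = a + b \<and> yzmon a b - yzmon (delta i) c \<in> V"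
    if ab: "good_exp d a b" "exp_size a \<ge> 2" "exp_size b \<ge> 3" "even (exp_size a)" for a b
  proof -
    obtain n where "exp_size b = 3 + n"
      using ab(3) le_Suc_ex by blast
    then have "exp_size b = Suc (Suc (Suc n))" by simp
    then obtain k b' where b: "b = delta k + b'" "exp_size b' = Suc (Suc n)" by (rule exp_size_SucE)
    have k: "k \<in> {1..d}" and g: "good_exp d a b'" "good_exp d (delta k + a) b'"
      using ab(1) b by (auto simp: good_exp_def keys_nat_add)
    obtain i c where ic: "good_exp d (delta i) c" "delta i + c = (delta k + a) + b'"
        "yzmon (delta k + a) b' - yzmon (delta i) c \<in> V"
      using odd[OF g(2)] ab(4) by auto
    have "yzmon a b - yzmon (delta k + a) b' \<in> V"
      unfolding b(1) by (rule V_sym, rule move_one[OF g(1) ab(2) _ k]) (simp add: b)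
    from V_trans[OF this ic(3)] ic(1,2) show ?thesis by (auto simp: b ac_simps)
  qed
  show ?thesis
  proof (cases "odd (exp_size a)")
    case True
    then show ?thesis using odd assms(1) by blast
  next
    case False
    have a2: "exp_size a \<ge> 2" using assms(1) False by (cases "exp_size a = 1") (auto simp: good_exp_def)
    show ?thesis
    proof (cases "exp_size b \<ge> 3")
      case True
      then show ?thesis using even assms(1) a2 False by blast
    next
      case b: False
      \<comment> \<open>Too few z's for a single move. An even y-degree above 2 is at least 4, so
        two y's can first be moved over while two are kept.\<close>
      then have "exp_size a > 2" using assms(2) by linarith
      then have "exp_size a \<ge> 4" using False by (cases "exp_size a = 3") auto
      then obtain n where "exp_size a = 4 + n" using le_Suc_ex by blast
      then have "exp_size a = Suc (Suc (Suc (Suc n)))" by simp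
      then obtain k a1 where a1: "a = delta k + a1" "exp_size a1 = Suc (Suc (Suc n))" by (rule exp_size_SucE)
      from a1(2) obtain l a2 where a2: "a1 = delta l + a2" "exp_size a2 = Suc (Suc n)" by (rule exp_size_SucE)
      have kl: "k \<in> {1..d}" "l \<in> {1..d}" and g: "good_exp d a2 b"
        and g': "good_exp d a2 (delta k + (delta l + b))"
        using assms(1) a1 a2 by (auto simp: good_exp_def keys_nat_add)
      have "exp_size b \<ge> 1" using assms(1) by (simp add: good_exp_def)
      then obtain i c where ic: "good_exp d (delta i) c" "delta i + c = a2 + (delta k + (delta l + b))"
          "yzmon a2 (delta k + (delta l + b)) - yzmon (delta i) c \<in> V"
        using even[OF g'] False by (auto simp: a1 a2)
      have "yzmon a b - yzmon a2 (delta k + (delta l + b)) \<in> V"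
        using move_two[OF g kl] by (simp add: a1 a2)
      from V_trans[OF this ic(3)] ic(1,2) show ?thesis by (auto simp: a1 a2 ac_simps)
    qed
  qed
qed

lemma merge_kernel_degree_5:
  assumes "m \<ge> 5" "(0, f) \<in> gcomponent d m" "merge f = 0"
  shows "f \<in> V"
proof (rule merge_kernel_component_subset[OF subspace_V _ _ _ assms(2,3)])
  show "\<exists>i c. good_exp d (delta i) c \<and> delta i + c = a + b \<and> yzmon a b - yzmon (delta i) c \<in> V"
    if "good_exp d a b" "exp_size a + exp_size b = m" for a b
    using canonical_V[OF that(1)] that(2) assms(1) by simp
  show "yzmon (delta i) (delta j + e) - yzmon (delta j) (delta i + e) \<in> V"
    if "i \<in> {1..d}" "j \<in> {1..d}" "Poly_Mapping.keys e \<subseteq> {1..d}" "exp_size e + 2 = m" for i j e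
    using swap_V[OF that(1-3)] that(4) assms(1) by simp
qed (use assms(1) in simp)

end

text \<open>The commutator x_i x_j - x_j x_i in G_d, a 2 by 2 minor of the matrix with rows y and z;
  \<open>br 1 2\<close> is w_{(1^2)}^{(0)}.\<close>

definition br :: "nat \<Rightarrow> nat \<Rightarrow> 'k::comm_ring_1 yz_poly" where
  "br i j = yvar i * zvar j - yvar j * zvar i"

section \<open>The kernel of \<open>merge\<close> in degrees 4 and 3\<close>

context U_relations
begin

lemma trilinear_var_V:
  assumes "i \<in> {1..d}" "j \<in> {1..d}" "k \<in> {1..d}"
  shows "yvar i * yvar j * zvar k + yvar i * yvar k * zvar j + yvar j * yvar k * zvar i
    - (zvar i * zvar j * yvar k + zvar i * zvar k * yvar j + zvar j * zvar k * yvar i) \<in> V"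
  using trilinear_V[OF assms[THEN xgen_in_gcarrier]] by simp

lemma cubic_to_linear_V:
  assumes "i \<in> {1..d}" "j \<in> {1..d}" "k \<in> {1..d}" "l \<in> {1..d}"
  shows "yvar i * yvar k * yvar l * zvar j - yvar i * zvar j * zvar k * zvar l \<in> V"
  using square_swap_V[OF yz_in_gcarrier[OF assms(1,2)] assms(3,4)]
  by (simp add: right_diff_distrib mult_ac)

text \<open>Both monomials are congruent to y_i y_j y_k z_l.\<close>

lemma linear_swap_V:
  assumes "i \<in> {1..d}" "j \<in> {1..d}" "k \<in> {1..d}" "l \<in> {1..d}"
  shows "yvar i * zvar j * zvar k * zvar l - yvar j * zvar i * zvar k * zvar l \<in> V"
proof -
  have "(yvar j * yvar i * yvar k * zvar l - yvar j * zvar l * zvar i * zvar k)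
      - (yvar i * yvar j * yvar k * zvar l - yvar i * zvar l * zvar j * zvar k) \<in> V"
    using assms by (intro V_closed(5) cubic_to_linear_V)
  then show ?thesis by (simp add: mult_ac)
qed

text \<open>This is y_m times the polarized cubic: its terms with three y's all become y_m z_i z_j
  z_k by \<open>cubic_to_linear_V\<close>, and its terms with two y's run over the three ways to
  pair m with another index.\<close>

lemma three_pairings_V:
  assumes "i \<in> {1..d}" "j \<in> {1..d}" "k \<in> {1..d}" "m \<in> {1..d}"
  shows "3 * (yvar m * zvar i * zvar j * zvar k)
    - (yvar m * yvar k * zvar i * zvar j + yvar m * yvar j * zvar i * zvar k
      + yvar m * yvar i * zvar j * zvar k) \<in> V"
proof -
  have "yvar m * (yvar i * yvar j * zvar k + yvar i * yvar k * zvar j + yvar j * yvar k * zvar i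
      - (zvar i * zvar j * yvar k + zvar i * zvar k * yvar j + zvar j * zvar k * yvar i))
      - (yvar m * yvar i * yvar j * zvar k - yvar m * zvar k * zvar i * zvar j)
      - (yvar m * yvar i * yvar k * zvar j - yvar m * zvar j * zvar i * zvar k)
      - (yvar m * yvar j * yvar k * zvar i - yvar m * zvar i * zvar j * zvar k) \<in> V"
    using assms by (intro V_closed(5) cubic_to_linear_V V_var_mult trilinear_var_V)
  moreover have "yvar m * (yvar i * yvar j * zvar k + yvar i * yvar k * zvar j + yvar j * yvar k * zvar i
      - (zvar i * zvar j * yvar k + zvar i * zvar k * yvar j + zvar j * zvar k * yvar i))
      - (yvar m * yvar i * yvar j * zvar k - yvar m * zvar k * zvar i * zvar j)
      - (yvar m * yvar i * yvar k * zvar j - yvar m * zvar j * zvar i * zvar k)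
      - (yvar m * yvar j * yvar k * zvar i - yvar m * zvar i * zvar j * zvar k)
      = 3 * (yvar m * zvar i * zvar j * zvar k)
    - (yvar m * yvar k * zvar i * zvar j + yvar m * yvar j * zvar i * zvar k
      + yvar m * yvar i * zvar j * zvar k :: 'k yz_poly)"
    by (simp add: algebra_simps)
  ultimately show ?thesis by (simp only:)
qed

lemma exchange_V:
  assumes "i \<in> {1..d}" "j \<in> {1..d}" "k \<in> {1..d}" "m \<in> {1..d}"
  shows "yvar i * yvar m * zvar j * zvar k - yvar j * yvar k * zvar i * zvar m \<in> V"
proof (rule V_cancel)
  define A where "A m i j k = 3 * (yvar m * zvar i * zvar j * zvar k)
    - (yvar m * yvar k * zvar i * zvar j + yvar m * yvar j * zvar i * zvar k
      + yvar m * yvar i * zvar j * zvar k :: 'k yz_poly)" for m i j k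
  define S where "S i j k l = (yvar i * zvar j * zvar k * zvar l - yvar j * zvar i * zvar k * zvar l :: 'k yz_poly)"
    for i j k l
  have A: "A m i j k \<in> V" if "i \<in> {1..d}" "j \<in> {1..d}" "k \<in> {1..d}" "m \<in> {1..d}" for m i j k
    unfolding A_def by (rule three_pairings_V[OF that])
  have S: "S i j k l \<in> V" if "i \<in> {1..d}" "j \<in> {1..d}" "k \<in> {1..d}" "l \<in> {1..d}" for l i j k
    unfolding S_def by (rule linear_swap_V[OF that])
  \<comment> \<open>Each \<open>A\<close> sums the pairings in which its first index keeps its y.
    With sign + for j, k and - for i, m, the pairings that separate i from m cancel, those with i, m
    on one side and j, k on the other survive twice, and three copies of each \<open>S\<close>
    remove the monomials with one y.\<close>
  have "A j m i k + A k m i j - A m i j k - A i m j k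
      + (S m j i k + S m j i k + S m j i k + (S i k m j + S i k m j + S i k m j)) \<in> V"
    using assms by (intro V_closed(2,5) A S)
  moreover have "A j m i k + A k m i j - A m i j k - A i m j k
      + (S m j i k + S m j i k + S m j i k + (S i k m j + S i k m j + S i k m j))
      = 2 * (yvar i * yvar m * zvar j * zvar k - yvar j * yvar k * zvar i * zvar m)"
    unfolding A_def S_def by (simp add: algebra_simps)
  ultimately show "2 * (yvar i * yvar m * zvar j * zvar k - yvar j * yvar k * zvar i * zvar m) \<in> V"
    by (simp only:)
qed

text \<open>\<open>exchange_V\<close> identifies the four terms of the expanded product in pairs, so
  a product of brackets measures the difference between two pairings, up to the factor 2.\<close>

lemma br_br_V:
  assumes "i \<in> {1..d}" "j \<in> {1..d}" "k \<in> {1..d}" "l \<in> {1..d}"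
  shows "br i l * br j k
    - 2 * (yvar i * yvar j * zvar k * zvar l - yvar i * yvar k * zvar j * zvar l) \<in> V"
proof -
  have "(yvar l * yvar k * zvar i * zvar j - yvar i * yvar j * zvar l * zvar k)
      - (yvar l * yvar j * zvar i * zvar k - yvar i * yvar k * zvar l * zvar j) \<in> V"
    using assms by (intro V_closed(5) exchange_V)
  moreover have "(yvar l * yvar k * zvar i * zvar j - yvar i * yvar j * zvar l * zvar k)
      - (yvar l * yvar j * zvar i * zvar k - yvar i * yvar k * zvar l * zvar j)
      = br i l * br j k
    - 2 * (yvar i * yvar j * zvar k * zvar l - yvar i * yvar k * zvar j * zvar l :: 'k yz_poly)"
    unfolding br_def by (simp add: algebra_simps)
  ultimately show ?thesis by (simp only:)
qed

lemma merge_kernel_degree_4: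
  assumes W: "poly_subspace W" and VW: "V \<subseteq> W"
    and brW: "\<And>i j k l. i \<in> {1..d} \<Longrightarrow> j \<in> {1..d} \<Longrightarrow> k \<in> {1..d} \<Longrightarrow> l \<in> {1..d} \<Longrightarrow> br i j * br k l \<in> W"
    and f: "(0, f) \<in> gcomponent d 4" "merge f = 0"
  shows "f \<in> W"
proof (rule merge_kernel_component_subset[OF W _ _ _ f])
  note W_closed = poly_subspaceD[OF W] and W_cancel = poly_subspace_cancel_numeral[OF W]
  \<comment> \<open>By \<open>br_br_V\<close>, once bracket products lie in \<open>W\<close> it is
    immaterial which variable is paired with y_i.\<close>
  have diff: "yvar i * yvar j * zvar k * zvar l - yvar i * yvar k * zvar j * zvar l \<in> W"
    if "i \<in> {1..d}" "j \<in> {1..d}" "k \<in> {1..d}" "l \<in> {1..d}" for i j k l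
  proof (rule W_cancel)
    have "br i l * br j k - (br i l * br j k
        - 2 * (yvar i * yvar j * zvar k * zvar l - yvar i * yvar k * zvar j * zvar l)) \<in> W"
      by (rule W_closed(5)[OF brW subsetD[OF VW br_br_V]]) (use that in simp_all)
    then show "2 * (yvar i * yvar j * zvar k * zvar l - yvar i * yvar k * zvar j * zvar l) \<in> W" by simp
  qed
  \<comment> \<open>The three pairings in \<open>three_pairings_V\<close> now coincide modulo
    \<open>W\<close>, and 3 can be cancelled.\<close>
  have pair: "yvar i * yvar j * zvar k * zvar l - yvar i * zvar j * zvar k * zvar l \<in> W"
    if "i \<in> {1..d}" "j \<in> {1..d}" "k \<in> {1..d}" "l \<in> {1..d}" for i j k l
  proof (rule W_cancel)
    have "(yvar i * yvar j * zvar k * zvar l - yvar i * yvar k * zvar j * zvar l)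
        + (yvar i * yvar j * zvar l * zvar k - yvar i * yvar l * zvar j * zvar k)
        - (3 * (yvar i * zvar j * zvar k * zvar l)
           - (yvar i * yvar l * zvar j * zvar k + yvar i * yvar k * zvar j * zvar l
              + yvar i * yvar j * zvar k * zvar l)) \<in> W"
      by (rule W_closed(5)[OF W_closed(2)[OF diff diff] subsetD[OF VW three_pairings_V]])
        (use that in simp_all)
    moreover have "(yvar i * yvar j * zvar k * zvar l - yvar i * yvar k * zvar j * zvar l)
        + (yvar i * yvar j * zvar l * zvar k - yvar i * yvar l * zvar j * zvar k)
        - (3 * (yvar i * zvar j * zvar k * zvar l)
           - (yvar i * yvar l * zvar j * zvar k + yvar i * yvar k * zvar j * zvar l
              + yvar i * yvar j * zvar k * zvar l))
        = 3 * (yvar i * yvar j * zvar k * zvar l - yvar i * zvar j * zvar k * zvar l :: 'k yz_poly)"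
      by (simp add: algebra_simps)
    ultimately show "3 * (yvar i * yvar j * zvar k * zvar l - yvar i * zvar j * zvar k * zvar l) \<in> W"
      by (simp only:)
  qed
  show "\<exists>i c. good_exp d (delta i) c \<and> delta i + c = a + b \<and> yzmon a b - yzmon (delta i) c \<in> W"
    if ab: "good_exp d a b" "exp_size a + exp_size b = 4" for a b
    using ab
  proof (cases rule: degree_4_cases)
    case (1 i j k l)
    have "yvar i * yvar j * yvar k * zvar l - yvar i * zvar l * zvar j * zvar k \<in> W"
      using 1 cubic_to_linear_V VW by blast
    then show ?thesis using 1
      by (intro exI[of _ i] exI[of _ "delta j + (delta k + delta l)"])
        (simp add: yzmon_delta_left yzmon_delta_right yzmon_delta good_exp_def keys_nat_add mult_ac add.assoc)
  next
    case (2 i j k l)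
    then show ?thesis using pair[of i j k l]
      by (intro exI[of _ i] exI[of _ "delta j + (delta k + delta l)"])
        (simp add: yzmon_delta_left yzmon_delta_right yzmon_delta good_exp_def keys_nat_add mult_ac add.assoc)
  next
    case (3 i j k l)
    then show ?thesis using ab(1) W_closed(1) by (intro exI[of _ i] exI[of _ b]) simp
  qed
  show "yzmon (delta i) (delta j + e) - yzmon (delta j) (delta i + e) \<in> W"
    if "i \<in> {1..d}" "j \<in> {1..d}" "Poly_Mapping.keys e \<subseteq> {1..d}" "exp_size e + 2 = 4" for i j e
    using swap_V[OF that(1-3)] that(4) VW by auto
qed simp

lemma merge_kernel_degree_3:
  assumes W: "poly_subspace W" and VW: "V \<subseteq> W"
    and yW: "\<And>i j k. i \<in> {1..d} \<Longrightarrow> j \<in> {1..d} \<Longrightarrow> k \<in> {1..d} \<Longrightarrow> yvar k * br i j \<in> W"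
    and zW: "\<And>i j k. i \<in> {1..d} \<Longrightarrow> j \<in> {1..d} \<Longrightarrow> k \<in> {1..d} \<Longrightarrow> zvar k * br i j \<in> W"
    and f: "(0, f) \<in> gcomponent d 3" "merge f = 0"
  shows "f \<in> W"
proof (rule merge_kernel_component_subset[OF W _ _ _ f])
  note W_closed = poly_subspaceD[OF W] and W_cancel = poly_subspace_cancel_numeral[OF W]
  have pair: "yvar i * yvar j * zvar k - yvar i * zvar j * zvar k \<in> W"
    if "i \<in> {1..d}" "j \<in> {1..d}" "k \<in> {1..d}" for i j k
  proof (rule W_cancel)
    \<comment> \<open>The four bracket terms turn the six terms of the trilinear relation into three
      copies each of y_i y_j z_k and y_i z_j z_k.\<close>
    have "yvar i * yvar j * zvar k + yvar i * yvar k * zvar j + yvar j * yvar k * zvar i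
        - (zvar i * zvar j * yvar k + zvar i * zvar k * yvar j + zvar j * zvar k * yvar i)
        + yvar i * br j k + yvar j * br i k - zvar j * br i k - zvar k * br i j \<in> W"
      by (rule W_closed(5)[OF W_closed(5)[OF W_closed(2)[OF W_closed(2)[OF
              subsetD[OF VW trilinear_var_V] yW] yW] zW] zW]) (use that in simp_all)
    moreover have "yvar i * yvar j * zvar k + yvar i * yvar k * zvar j + yvar j * yvar k * zvar i
        - (zvar i * zvar j * yvar k + zvar i * zvar k * yvar j + zvar j * zvar k * yvar i)
        + yvar i * br j k + yvar j * br i k - zvar j * br i k - zvar k * br i j
        = 3 * (yvar i * yvar j * zvar k - yvar i * zvar j * zvar k :: 'k yz_poly)"
      unfolding br_def by (simp add: algebra_simps)
    ultimately show "3 * (yvar i * yvar j * zvar k - yvar i * zvar j * zvar k) \<in> W" by (simp only:)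
  qed
  show "\<exists>i c. good_exp d (delta i) c \<and> delta i + c = a + b \<and> yzmon a b - yzmon (delta i) c \<in> W"
    if ab: "good_exp d a b" "exp_size a + exp_size b = 3" for a b
    using ab
  proof (cases rule: degree_3_cases)
    case (1 i j k)
    then show ?thesis using pair[of i j k]
      by (intro exI[of _ i] exI[of _ "delta j + delta k"])
        (simp add: yzmon_delta_left yzmon_delta_right yzmon_delta good_exp_def keys_nat_add mult_ac add.assoc)
  next
    case (2 i j k)
    then show ?thesis using ab(1) W_closed(1) by (intro exI[of _ i] exI[of _ b]) simp
  qed
  show "yzmon (delta i) (delta j + e) - yzmon (delta j) (delta i + e) \<in> W"
    if ij: "i \<in> {1..d}" "j \<in> {1..d}" and e: "Poly_Mapping.keys e \<subseteq> {1..d}" "exp_size e + 2 = 3" for i j e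
  proof -
    have "exp_size e = 1" using e(2) by simp
    then obtain k where k: "e = delta k" "k \<in> {1..d}" using e(1) by (rule exp_size_1E)
    show ?thesis using zW[OF ij k(2)] k(1)
      by (simp add: yzmon_delta_right yzmon_delta br_def right_diff_distrib mult_ac)
  qed
qed simp

end

section \<open>Submodules generated by brackets\<close>

lemma transv_subst_hom [simp]:
  "transv_subst i j t (f * g) = transv_subst i j t f * transv_subst i j t g"
  "transv_subst i j t (f - g) = transv_subst i j t f - transv_subst i j t g"
  "transv_subst i j t (yvar k) = (if k = i then yvar i + cst t * yvar j else yvar k)"
  "transv_subst i j t (zvar k) = (if k = i then zvar i + cst t * zvar j else zvar k)"
  by (simp_all add: transv_subst_def)

lemma transv_subst_br_left: "i \<noteq> l \<Longrightarrow> transv_subst i k t (br i l) = br i l + cst t * br k l"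
  by (simp add: br_def algebra_simps)

lemma transv_subst_br_right: "i \<noteq> l \<Longrightarrow> transv_subst i k t (br l i) = br l i + cst t * br l k"
  by (simp add: br_def algebra_simps)

lemma br_same [simp]: "br i i = 0"
  by (simp add: br_def)

lemma br_antisym: "br j i = - br i j"
  by (simp add: br_def)

text \<open>Laplace expansion of the 3 by 3 determinant with rows q, y, z, two of which are
  equal.\<close>

lemma br_jacobi:
  assumes "q = yvar \<or> q = zvar"
  shows "q k * br i j + q i * br j k + q j * br k i = 0"
  using assms by (auto simp: br_def algebra_simps)

lemma br_pluecker: "br i j * br k l - br i k * br j l + br i l * br j k = 0"
  by (simp add: br_def algebra_simps)

locale GL_module =
  fixes d :: nat and \<alpha> :: "'k::field_char_0 \<times> 'k" and N :: "'k gelem set set"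
  assumes d2: "d \<ge> 2" and GL: "GL_submodule d \<alpha> N"
begin

abbreviation W :: "'k yz_poly set" where
  "W \<equiv> GL_preimage d \<alpha> N"

lemma d1: "d \<ge> 1"
  using d2 by simp

lemmas subspace_W = GL_preimage_subspace[OF d1 GL]
lemmas W_closed = poly_subspaceD[OF subspace_W]
lemmas W_cancel = poly_subspace_cancel_numeral[OF subspace_W]
lemmas W_transv = GL_preimage_transv_coeffs[OF d1 GL]

lemma var_br_W:
  assumes q: "q = yvar \<or> q = zvar" and base: "q 1 * br 1 2 \<in> W"
    and "i \<in> {1..d}" "j \<in> {1..d}" "k \<in> {1..d}"
  shows "q k * br i j \<in> W"
proof -
  have transv_subst_q: "transv_subst i j t (q k) = (if k = i then q i + cst t * q j else q k)" for i j k t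
    using q by auto
  \<comment> \<open>Coefficients of t and t^2 under x_i -> x_i + t x_k. The case k = j is allowed;
    it gives the exchange of i and j in \<open>swap\<close>, so no permutation matrices are
    needed.\<close>
  have left: "q k * br i j + q i * br k j \<in> W" "q k * br k j \<in> W"
    if "q i * br i j \<in> W" "i \<in> {1..d}" "k \<in> {1..d}" "i \<noteq> j" "k \<noteq> i" for i j k
  proof -
    have "transv_subst i k t (q i * br i j)
        = q i * br i j + cst t * (q k * br i j + q i * br k j) + cst t * cst t * (q k * br k j)" for t
      by (simp add: transv_subst_q transv_subst_br_left[OF that(4)] algebra_simps)
    from W_transv[OF that(2,3) that(5)[symmetric] that(1) this]
    show "q k * br i j + q i * br k j \<in> W" "q k * br k j \<in> W" by blast+
  qed
  have right: "q i * br i k \<in> W"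
    if "q i * br i j \<in> W" "i \<noteq> j" "j \<in> {1..d}" "k \<in> {1..d}" for i j k
  proof (cases "k = j")
    case False
    show ?thesis
      by (rule W_transv(1)[OF that(3,4) False[symmetric] that(1), where h = 0])
        (use that(2) in \<open>simp add: transv_subst_q transv_subst_br_right algebra_simps\<close>)
  qed (use that in simp)
  have swap: "q j * br j i \<in> W"
    if "q i * br i j \<in> W" "i \<noteq> j" "i \<in> {1..d}" "j \<in> {1..d}" for i j
    using W_closed(4)[OF left(1)[OF that(1,3,4,2) that(2)[symmetric]]] by (simp add: br_antisym[of j i])
  have "1 \<in> {1..d}" "2 \<in> {1..d}" "(1::nat) \<noteq> 2" using d2 by auto
  note one_two = this
  have S: "q i * br i j \<in> W" if "i \<in> {1..d}" "j \<in> {1..d}" "i \<noteq> j" for i j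
  proof (cases "j = 1")
    case True
    have "q 1 * br 1 i \<in> W" by (rule right[OF base one_two(3,2) that(1)])
    then show ?thesis using swap[of 1 i] that one_two(1) True by simp
  next
    case False
    have "q 1 * br 1 j \<in> W" by (rule right[OF base one_two(3,2) that(2)])
    then show ?thesis
      using left(2)[of 1 j i] False that one_two(1) by (cases "i = 1") auto
  qed
  consider "i = j" | "k = i" "i \<noteq> j" | "k = j" "i \<noteq> j" | "i \<noteq> j" "k \<noteq> i" "k \<noteq> j" by blast
  then show ?thesis
  proof cases
    case 1
    then show ?thesis using W_closed(1) by simp
  next
    case 2
    then show ?thesis using S assms(3,4) by simp
  next
    case 3
    then have "- (q j * br j i) \<in> W" using S assms(3,4) by (intro W_closed(4)) auto
    then show ?thesis using 3 by (simp add: br_antisym[of j i])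
  next
    case 4
    \<comment> \<open>Two coefficients of t, with the roles of i and j exchanged. Their difference
      contains the wanted element twice, and the Jacobi relation turns the other two terms into a
      third copy.\<close>
    have "(q k * br i j + q i * br k j) - (q k * br j i + q j * br k i) \<in> W"
      by (rule W_closed(5)[OF left(1)[OF S] left(1)[OF S]]) (use 4 assms in auto)
    also have "(q k * br i j + q i * br k j) - (q k * br j i + q j * br k i)
        = 3 * (q k * br i j) - (q k * br i j + q i * br j k + q j * br k i)"
      by (simp add: br_antisym[of k j] br_antisym[of j i] algebra_simps)
    also have "\<dots> = 3 * (q k * br i j)" using br_jacobi[OF q] by simp
    finally show ?thesis by (rule W_cancel)
  qed
qed

lemma br_br_W:
  assumes base: "br 1 2 * br 1 2 \<in> W"
    and "i \<in> {1..d}" "j \<in> {1..d}" "k \<in> {1..d}" "l \<in> {1..d}"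
  shows "br i j * br k l \<in> W"
proof -
  have left: "br i j * br k j \<in> W" "br k j * br k j \<in> W"
    if "br i j * br i j \<in> W" "i \<in> {1..d}" "k \<in> {1..d}" "i \<noteq> j" "k \<noteq> i" for i j k
  proof -
    have eq: "transv_subst i k t (br i j * br i j)
        = br i j * br i j + cst t * (2 * (br i j * br k j)) + cst t * cst t * (br k j * br k j)" for t :: 'k
      by (simp add: transv_subst_br_left[OF that(4)] algebra_simps)
    from W_transv[OF that(2,3) that(5)[symmetric] that(1) eq]
    show "br i j * br k j \<in> W" "br k j * br k j \<in> W" using W_cancel by blast+
  qed
  have "1 \<in> {1..d}" "2 \<in> {1..d}" "(1::nat) \<noteq> 2" using d2 by auto
  note one_two = this
  have sq: "br i j * br i j = br j i * br j i" for i j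
    by (simp add: br_antisym[of i j])
  have one: "br 1 j * br 1 j \<in> W" if "j \<in> {1..d}" for j
  proof (cases "j = 2")
    case False
    then show ?thesis using left(2)[of 2 1 j] base that one_two by (metis sq)
  qed (use base in simp)
  have S: "br i j * br i j \<in> W" if "i \<in> {1..d}" "j \<in> {1..d}" for i j
  proof (cases "i = 1 \<or> j = 1")
    case True
    then show ?thesis using one that sq by metis
  next
    case False
    then show ?thesis using left(2)[OF one[OF that(2)] one_two(1) that(1)] by auto
  qed
  have D: "br i j * br k j \<in> W" if "i \<in> {1..d}" "j \<in> {1..d}" "k \<in> {1..d}" for i j k
  proof -
    consider "i = j" | "k = i" | "i \<noteq> j" "k \<noteq> i" by blast
    then show ?thesis
    proof cases
      case 3
      then show ?thesis using left(1)[OF S] that by blast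
    qed (use S that W_closed(1) in auto)
  qed
  \<comment> \<open>The coefficient of t in \<open>br i j * br k j\<close> under x_j -> x_j + t x_l;
    it breaks up the shared index.\<close>
  have mixed: "br i l * br k j + br i j * br k l \<in> W"
    if "i \<in> {1..d}" "j \<in> {1..d}" "k \<in> {1..d}" "l \<in> {1..d}" "j \<noteq> i" "j \<noteq> k" "j \<noteq> l" for i j k l
    by (rule W_transv(1)[OF that(2,4,7) D[OF that(1-3)], where h = "br i l * br k l"])
      (simp add: transv_subst_br_right[OF that(5)] transv_subst_br_right[OF that(6)] algebra_simps)
  consider "j = l" | "j = k" | "i = k" | "i = l" | "i = j" | "k = l"
    | "j \<noteq> l" "j \<noteq> k" "i \<noteq> k" "i \<noteq> l" "i \<noteq> j" "k \<noteq> l" by blast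
  then show ?thesis
  proof cases
    case 1
    then show ?thesis using D assms by simp
  next
    case 2
    then have "- (br i j * br l j) \<in> W" using D assms by (intro W_closed(4)) auto
    then show ?thesis using 2 by (simp add: br_antisym[of l k])
  next
    case 3
    then have "br j i * br l i \<in> W" using D assms by auto
    then show ?thesis using 3 by (simp add: br_antisym[of j k] br_antisym[of l k])
  next
    case 4
    then have "- (br j i * br k i) \<in> W" using D assms by (intro W_closed(4)) auto
    then show ?thesis using 4 by (simp add: br_antisym[of j l])
  next
    case 5
    then show ?thesis using W_closed(1) by simp
  next
    case 6
    then show ?thesis using W_closed(1) by simp
  next
    case 7
    \<comment> \<open>\<open>mixed\<close> minus its version with k and l exchanged contains the
      wanted product twice; the Pluecker relation evaluates the remaining two terms to a third
      copy.\<close>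
    have "(br i l * br k j + br i j * br k l) - (br i k * br l j + br i j * br l k) \<in> W"
      using assms 7 by (intro W_closed(5) mixed) auto
    also have "(br i l * br k j + br i j * br k l) - (br i k * br l j + br i j * br l k)
        = 3 * (br i j * br k l) - (br i j * br k l - br i k * br j l + br i l * br j k)"
      by (simp add: br_antisym[of l k] br_antisym[of k j] br_antisym[of l j] algebra_simps)
    also have "\<dots> = 3 * (br i j * br k l)" unfolding br_pluecker by simp
    finally show ?thesis by (rule W_cancel)
  qed
qed

end

section \<open>Consequences of \<open>w\<^bsub>(n)\<^esub>\<close>\<close>

lemma cst_power: "cst (t ^ k) = cst t ^ k"
  by (induction k) (simp_all add: cst_mult)

lemma gcomponent_diff: "p \<in> gcomponent d m \<Longrightarrow> q \<in> gcomponent d m \<Longrightarrow> p - q \<in> gcomponent d m"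
  using gcomponent_add[of p d m "gsmult (- 1) q"] gcomponent_gsmult[of q d m "- 1"]
  by (simp add: gsmult_minus_one)

lemma gcomponent_mult_right_power:
  assumes "(0, f) \<in> gcomponent d m" "v \<in> gcomponent d 1"
  shows "(0, f * right_poly v ^ k) \<in> gcomponent d (m + k)"
proof (induction k)
  case (Suc k)
  from gcomponent_gmult[OF this assms(2)] show ?case
    by (simp add: gmult_def mult_ac)
qed (use assms in simp)

context U_relations
begin

lemma yz_power_V:
  assumes "yvar 1 * zvar 1 ^ n \<in> V" "p \<in> gcarrier d"
  shows "left_poly p * right_poly p ^ n \<in> V"
  using T_ideal_psubst[OF T_ideal_J assms(1), of "\<lambda>_. p"] assms(2) by simp

text \<open>Modulo \<open>V\<close> the product y_i z_j is skew in i and j. Hence y_i y_j z_k is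
  symmetric in i, j and skew in j, k, which forces it to vanish once 2 is invertible; the monomials
  with two z's are treated alike.\<close>

lemma all_degree_3:
  assumes base: "yvar 1 * zvar 1 \<in> V" and ab: "good_exp d a b" "exp_size a + exp_size b = 3"
  shows "yzmon a b \<in> V"
proof -
  have sym: "yvar i * zvar j + yvar j * zvar i \<in> V" if ij: "i \<in> {1..d}" "j \<in> {1..d}" for i j
  proof -
    have x: "xgen i \<in> gcarrier d" "xgen j \<in> gcarrier d" "xgen i + xgen j \<in> gcarrier d"
      using ij by (simp_all add: xgen_in_gcarrier gcarrier_add)
    have c: "left_poly p * right_poly p \<in> V" if "p \<in> gcarrier d" for p
      using yz_power_V[of 1 p] base that by simp
    have "(yvar i + yvar j) * (zvar i + zvar j) - yvar i * zvar i - yvar j * zvar j \<in> V"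
      using x[THEN c] by (intro V_closed(5)) simp_all
    then show ?thesis by (simp add: algebra_simps)
  qed
  from ab show ?thesis
  proof (cases rule: degree_3_cases)
    case (1 i j k)
    have "2 * (yvar i * yvar j * zvar k) \<in> V"
    proof -
      have "yvar i * (yvar j * zvar k + yvar k * zvar j) + yvar j * (yvar i * zvar k + yvar k * zvar i)
          - yvar k * (yvar i * zvar j + yvar j * zvar i) \<in> V"
        using 1 by (intro V_closed(2,5) V_var_mult sym)
      then show ?thesis by (simp add: algebra_simps)
    qed
    then show ?thesis using V_cancel 1 by (simp add: yzmon_delta_left yzmon_delta mult_ac)
  next
    case (2 i j k)
    have "2 * (yvar i * zvar j * zvar k) \<in> V"
    proof -
      have "zvar k * (yvar i * zvar j + yvar j * zvar i) + zvar j * (yvar i * zvar k + yvar k * zvar i)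
          - zvar i * (yvar j * zvar k + yvar k * zvar j) \<in> V"
        using 2 by (intro V_closed(2,5) V_var_mult sym)
      then show ?thesis by (simp add: algebra_simps)
    qed
    then show ?thesis using V_cancel 2 by (simp add: yzmon_delta_right yzmon_delta mult_ac)
  qed
qed

text \<open>Times y_m, the polarized identity puts the sum of the three pairings into
  \<open>V\<close>, and \<open>three_pairings_V\<close> then yields the monomials with one y; those
  with three y's are congruent to them.\<close>

lemma all_degree_4:
  assumes base: "yvar 1 * zvar 1 ^ 2 \<in> V" and ab: "good_exp d a b" "exp_size a + exp_size b = 4"
  shows "yzmon a b \<in> V"
proof -
  have tri: "left_poly p * right_poly q * right_poly r + left_poly q * right_poly p * right_poly r
      + left_poly r * right_poly p * right_poly q \<in> V"
    if pqr: "p \<in> gcarrier d" "q \<in> gcarrier d" "r \<in> gcarrier d" for p q r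
  proof (rule V_cancel)
    have "p + q \<in> gcarrier d" "p + r \<in> gcarrier d" "q + r \<in> gcarrier d" "p + q + r \<in> gcarrier d"
      using pqr by (simp_all add: gcarrier_add)
    note c = this[THEN yz_power_V[OF base]] pqr[THEN yz_power_V[OF base]]
    show "2 * (left_poly p * right_poly q * right_poly r + left_poly q * right_poly p * right_poly r
      + left_poly r * right_poly p * right_poly q) \<in> V"
      unfolding cubic_polarization' using c
      by (intro V_closed(2,5)) (simp_all only: left_poly_add right_poly_add)
  qed
  have lin: "yvar m * zvar i * zvar j * zvar k \<in> V" and sum3: "yvar m * yvar k * zvar i * zvar j
      + yvar m * yvar j * zvar i * zvar k + yvar m * yvar i * zvar j * zvar k \<in> V"
    if mijk: "m \<in> {1..d}" "i \<in> {1..d}" "j \<in> {1..d}" "k \<in> {1..d}" for m i j k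
  proof -
    have "yvar m * (yvar i * zvar j * zvar k + yvar j * zvar i * zvar k + yvar k * zvar i * zvar j) \<in> V"
      using V_var_mult(1)[OF tri[OF mijk(2-4)[THEN xgen_in_gcarrier]] mijk(1)] by simp
    then show sum3: "yvar m * yvar k * zvar i * zvar j
        + yvar m * yvar j * zvar i * zvar k + yvar m * yvar i * zvar j * zvar k \<in> V"
      by (simp add: algebra_simps)
    have "3 * (yvar m * zvar i * zvar j * zvar k) \<in> V"
      using V_closed(2)[OF three_pairings_V[OF mijk(2-4,1)] sum3] by simp
    then show "yvar m * zvar i * zvar j * zvar k \<in> V" by (rule V_cancel)
  qed
  from ab show ?thesis
  proof (cases rule: degree_4_cases)
    case (1 i j k l)
    have "yvar i * yvar j * yvar k * zvar l \<in> V"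
      using V_closed(2)[OF cubic_to_linear_V[OF 1(1,4,2,3)] lin[OF 1(1,4,2,3)]] by simp
    then show ?thesis using 1 by (simp add: yzmon_delta_left yzmon_delta mult_ac)
  next
    case (2 i j k l)
    have "(0, yvar i * zvar j) \<in> gcarrier d"
      using yz_in_gcarrier[OF 2(1,2)] by (simp add: poly_part_def)
    \<comment> \<open>Substituting the degree 2 element y_i z_j gives a relation in which the
      pairing of i with j is missing; its difference from \<open>sum3\<close> isolates that
      pairing.\<close>
    from tri[OF this 2(3,4)[THEN xgen_in_gcarrier]]
    have "yvar i * zvar j * zvar k * zvar l + (yvar i * yvar k * zvar j * zvar l + yvar i * yvar l * zvar j * zvar k) \<in> V"
      by (simp add: mult_ac add_ac)
    from V_closed(5)[OF this lin[OF 2(1-4)]]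
    have "yvar i * yvar k * zvar j * zvar l + yvar i * yvar l * zvar j * zvar k \<in> V" by simp
    from V_closed(5)[OF sum3[OF 2(1-4)] this] have "yvar i * yvar j * zvar k * zvar l \<in> V"
      by (simp add: algebra_simps)
    then show ?thesis using 2 by (simp add: yzmon_delta_left yzmon_delta_right yzmon_delta mult_ac)
  next
    case (3 i j k l)
    then show ?thesis using lin[OF 3(1-4)] by (simp add: yzmon_delta_right yzmon_delta mult_ac)
  qed
qed

text \<open>Substitution in y_1 z_1^(n-1) ties the y to the same linear form v as the z's. After
  multiplication by z_w, the kernel of \<open>merge\<close> in degree n + 1, at least 5, permits the
  exchange of z_w with the y-version of v, so the y becomes independent of v.\<close>

lemma linear_times_power_V:
  assumes base: "yvar 1 * zvar 1 ^ (n - 1) \<in> V" and n: "n \<ge> 4"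
    and w: "w \<in> {1..d}" and v: "v \<in> gcomponent d 1"
  shows "yvar w * right_poly v ^ n \<in> V"
proof -
  obtain k where k: "n = Suc (Suc k)" using n le_Suc_ex[of 2 n] by auto
  have vc: "v \<in> gcarrier d" using v by (simp add: gcomponent_iff)
  let ?A = "zvar w * (left_poly v * right_poly v ^ (n - 1))"
  have A: "?A \<in> V" by (rule V_var_mult(2)[OF yz_power_V[OF base vc] w])
  have "(0, left_poly v * right_poly v) \<in> gcomponent d 2"
    using gcomponent_gmult[OF v v] by (simp add: gmult_def numeral_2_eq_2)
  from gcomponent_gmult[OF gcomponent_mult_right_power[OF this v, of k] xgen_in_gcomponent[OF w]]
  have 1: "(0, ?A) \<in> gcomponent d (n + 1)" by (simp add: k gmult_def mult_ac)
  have "(0, yvar w * right_poly v) \<in> gcomponent d 2"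
    using gcomponent_gmult[OF xgen_in_gcomponent[OF w] v] by (simp add: gmult_def numeral_2_eq_2)
  from gcomponent_mult_right_power[OF this v, of "Suc k"]
  have 2: "(0, yvar w * right_poly v ^ n) \<in> gcomponent d (n + 1)" by (simp add: k mult_ac)
  have "yvar w * right_poly v ^ n - ?A \<in> V"
  proof (rule merge_kernel_degree_5)
    show "(0, yvar w * right_poly v ^ n - ?A) \<in> gcomponent d (n + 1)"
      using gcomponent_diff[OF 2 1] by simp
    show "merge (yvar w * right_poly v ^ n - ?A) = 0"
      using merge_left_right[of v] by (simp add: k merge_def)
  qed (use n in simp)
  from V_closed(2)[OF this A] show ?thesis by simp
qed

text \<open>Starting from y_w v^n, replacing v by v + t x_i and taking the coefficient of t releases
  one variable z_i per step until all z's are prescribed.\<close>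

lemma all_degree_ge_5:
  assumes base: "yvar 1 * zvar 1 ^ (n - 1) \<in> V" and n: "n \<ge> 4"
    and ab: "good_exp d a b" "exp_size a + exp_size b = n + 1"
  shows "yzmon a b \<in> V"
proof -
  have polar: "yvar w * yzmon 0 e * right_poly v ^ (n - exp_size e) \<in> V"
    if "w \<in> {1..d}" "v \<in> gcomponent d 1" "Poly_Mapping.keys e \<subseteq> {1..d}" "exp_size e \<le> n" for w v e
    using that
  proof (induction "exp_size e" arbitrary: e v)
    case 0
    then show ?case using linear_times_power_V[OF base n] by (simp flip: zero_prod_def)
  next
    case (Suc r)
    obtain i e' where e: "e = delta i + e'" "exp_size e' = r"
      using Suc.hyps(2)[symmetric] by (rule exp_size_SucE)
    have i: "i \<in> {1..d}" and e': "Poly_Mapping.keys e' \<subseteq> {1..d}"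
      using Suc.prems(3) by (auto simp: e keys_nat_add)
    define m where "m = n - r"
    have m: "m \<ge> 1" "n - exp_size e = m - 1" using Suc.prems(4) by (auto simp: m_def e)
    let ?c = "\<lambda>k. of_nat (m choose k) * (yvar w * yzmon 0 e' * zvar i ^ k * right_poly v ^ (m - k))"
    have "?c 1 \<in> V"
    proof (rule poly_subspace_coefficients[OF subspace_V, where v = ?c and n = m])
      fix t :: 'k
      have "v + gsmult t (xgen i) \<in> gcomponent d 1"
        by (intro gcomponent_add gcomponent_gsmult Suc.prems(2) xgen_in_gcomponent[OF i])
      from Suc.hyps(1)[OF e(2)[symmetric] Suc.prems(1) this e']
      have "yvar w * yzmon 0 e' * (cst t * zvar i + right_poly v) ^ m \<in> V"
        using Suc.prems(4) e by (simp add: m_def add.commute)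
      also have "yvar w * yzmon 0 e' * (cst t * zvar i + right_poly v) ^ m
          = (\<Sum>k\<le>m. cst (t ^ k) * ?c k)"
        unfolding binomial_ring sum_distrib_left
        by (rule sum.cong[OF refl]) (simp add: power_mult_distrib cst_power mult_ac)
      finally show "(\<Sum>k\<le>m. cst (t ^ k) * ?c k) \<in> V" .
    qed (rule m(1))
    \<comment> \<open>The coefficient of t carries the binomial factor m, which is nonzero in
      characteristic 0.\<close>
    then have "cst (of_nat m) * (yvar w * yzmon 0 e' * zvar i * right_poly v ^ (m - 1)) \<in> V" by simp
    then have "yvar w * yzmon 0 e' * zvar i * right_poly v ^ (m - 1) \<in> V"
      by (rule poly_subspace_cancel[OF subspace_V]) (use m(1) in simp)
    then show ?case using m(2) by (simp add: e yzmon_delta_right mult_ac)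
  qed
  obtain i c where ic: "good_exp d (delta i) c" "delta i + c = a + b" "yzmon a b - yzmon (delta i) c \<in> V"
    using canonical_V[OF ab(1)] ab(2) n by auto
  have "exp_size (delta i + c) = n + 1" unfolding ic(2) using ab(2) by simp
  then have c: "exp_size c = n" by simp
  have i: "i \<in> {1..d}" "Poly_Mapping.keys c \<subseteq> {1..d}" using ic(1) by (auto simp: good_exp_def)
  \<comment> \<open>All n powers of the linear form are used up, so v = 0 may be taken: the
    remaining factor is 0^0 = 1.\<close>
  have "yvar i * yzmon 0 c \<in> V" using polar[OF i(1) gcomponent_zero i(2)] c by simp
  then have "yzmon (delta i) c \<in> V" by (simp add: yzmon_delta_left[of i 0 c, simplified])
  from V_closed(2)[OF ic(3) this] show ?thesis by simp
qed

end

text \<open>The condition on \<alpha> makes the defining identity a nonzero multiple of y_1^2 z_1 -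
  y_1 z_1^2.\<close>

lemma U_relations_of_U_ideal:
  fixes \<alpha>1 \<alpha>2 :: "'k::field_char_0"
  assumes "(\<alpha>1, \<alpha>2) \<noteq> (0, 0)" "\<alpha>1 + \<alpha>2 = 0"
    and J: "T_ideal (G_alg d) J" "U_ideal d (\<alpha>1, \<alpha>2) \<subseteq> J"
  shows "U_relations d J"
proof
  have a: "\<alpha>2 = - \<alpha>1" "\<alpha>1 \<noteq> 0" using assms(1,2) by (auto simp: eq_neg_iff_add_eq_0 add.commute)
  have "gsmult \<alpha>1 (0, yvar 1 ^ 2 * zvar 1) + gsmult \<alpha>2 (0, yvar 1 * zvar 1 ^ 2) \<in> J"
    using J(2) T_ideal_gen_superset unfolding U_ideal_def by fastforce
  then have "cst \<alpha>1 * (yvar 1 ^ 2 * zvar 1 - yvar 1 * zvar 1 ^ 2) \<in> poly_part J"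
    by (simp add: poly_part_def gsmult_pair a single_uminus right_diff_distrib)
  then show "yvar 1 ^ 2 * zvar 1 - yvar 1 * zvar 1 ^ 2 \<in> poly_part J"
    using a(2) by (rule poly_subspace_cancel[OF T_ideal_subspace[OF J(1)]])
qed (rule J(1))

section \<open>The four statements, expressed in brackets\<close>

lemma w_two_eq:
  "w_two 1 1 0 = (0, br 1 2)" "w_two 2 1 1 = (0, yvar 1 * br 1 2)"
  "w_two 2 1 0 = (0, zvar 1 * br 1 2)" "w_two 2 2 0 = (0, br 1 2 * br 1 2)"
  by (simp_all add: w_two_def br_def power2_eq_square mult_ac)

lemma merge_mult: "merge (f * g) = merge f * merge g"
  by (simp add: merge_def)

lemma merge_br: "merge (br i j) = 0"
  by (simp add: merge_def br_def mult.commute)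

lemma br_in_gcarrier:
  assumes "i \<in> {1..d}" "j \<in> {1..d}"
  shows "br i j \<in> poly_part (gcarrier d)"
  unfolding br_def using assms by (intro poly_subspaceD(5)[OF gcarrier_poly_subspace] yz_in_gcarrier)

lemma br_in_gcomponent:
  assumes "i \<in> {1..d}" "j \<in> {1..d}"
  shows "(0, br i j) \<in> gcomponent d 2"
  using gcomponent_diff[OF gcomponent_gmult[OF assms[THEN xgen_in_gcomponent]]
      gcomponent_gmult[OF assms(2,1)[THEN xgen_in_gcomponent]]]
  by (simp add: gmult_basis br_def numeral_2_eq_2)

lemma merge_kernelI:
  assumes "(0, f) \<in> gcomponent d m" "merge f = 0"
  shows "(0, f) \<in> merge_kernel d"
  using assms by (simp add: merge_kernel_def gcomponent_iff)

theorem theorem3p9: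
  fixes \<alpha>1 \<alpha>2 :: "'k::field_char_0" and d :: nat
  assumes "d \<ge> 2"
    and "(\<alpha>1, \<alpha>2) \<noteq> (0, 0)"
    and "\<alpha>1 + \<alpha>2 = 0"
  shows
    "(\<forall>n\<ge>1. consequences d (\<alpha>1, \<alpha>2) (w_one n 1) (n + 1) = GU_component d (\<alpha>1, \<alpha>2) (n + 1)) \<and>
     consequences d (\<alpha>1, \<alpha>2) (w_two 1 1 0) 3
       = GL_submodule_gen d (\<alpha>1, \<alpha>2) {w_two 2 1 1, w_two 2 1 0} \<and>
     (\<forall>\<beta>1 \<beta>2. (\<beta>1, \<beta>2) \<noteq> (0, 0) \<longrightarrow>
       consequences d (\<alpha>1, \<alpha>2) (gsmult \<beta>1 (w_two 2 1 1) + gsmult \<beta>2 (w_two 2 1 0)) 4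
         = GL_submodule_gen d (\<alpha>1, \<alpha>2) {w_two 2 2 0}) \<and>
     (\<forall>m>4. consequences d (\<alpha>1, \<alpha>2) (w_two 2 2 0) m = {nzero (GU_alg d (\<alpha>1, \<alpha>2))})"
proof -
  let ?\<alpha> = "(\<alpha>1, \<alpha>2)"
  let ?U = "U_ideal d ?\<alpha>"
  have d1: "d \<ge> 1" using assms(1) by simp
  have idx: "1 \<in> {1..d}" "2 \<in> {1..d}" using assms(1) by auto
  note rel = U_relations_of_U_ideal[OF assms(2,3)]
  interpret U: U_relations d ?U by (rule rel[OF T_ideal_U[OF d1] subset_refl])
  have "\<alpha>2 = - \<alpha>1" using assms(3) by (simp add: eq_neg_iff_add_eq_0 add.commute)
  have U_kernel: "?U \<subseteq> merge_kernel d"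
  proof -
    have gen: "gsmult \<alpha>1 (0, yvar 1 ^ 2 * zvar 1) + gsmult \<alpha>2 (0, yvar 1 * zvar 1 ^ 2) \<in> merge_kernel d"
      using U_generator_in_gcarrier[OF d1, of \<alpha>1 \<alpha>2]
      by (simp add: merge_kernel_def gsmult_pair merge_def power2_eq_square \<open>\<alpha>2 = - \<alpha>1\<close>
          single_uminus)
    show ?thesis unfolding U_ideal_def
      by (rule T_ideal_gen_minimal[OF T_ideal_merge_kernel]) (use gen in simp)
  qed
  \<comment> \<open>The upper bound for (ii) and (iii): the kernel of \<open>merge\<close> is a
    T-ideal above the ideal of the variety, so consequences of its elements have homogeneous
    representatives in it.\<close>
  have kernelE: "\<exists>f. X = GU_image d ?\<alpha> (0, f) \<and> (0, f) \<in> gcomponent d m \<and> merge f = 0"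
    if X: "X \<in> consequences d ?\<alpha> g m" and g: "g \<in> merge_kernel d" for X g m
  proof -
    obtain p where p: "p \<in> gcomponent d m" "p \<in> merge_kernel d" "X = GU_image d ?\<alpha> p"
      by (rule consequences_memE[OF X d1 T_ideal_merge_kernel U_kernel g])
    then show ?thesis by (cases p) (auto simp: merge_kernel_def)
  qed

  have zero_mem: "GU_image d ?\<alpha> 0 \<in> consequences d ?\<alpha> g m" if "g \<in> gcarrier d" for g m
    by (rule consequences_memI[OF d1 that gcomponent_zero])
      (simp add: T_ideal_def nideal_G_iff nsubspace_G_iff)

  have part1: "consequences d ?\<alpha> (w_one n 1) (n + 1) = GU_component d ?\<alpha> (n + 1)" if n: "n \<ge> 1" for n
  proof
    show "consequences d ?\<alpha> (w_one n 1) (n + 1) \<subseteq> GU_component d ?\<alpha> (n + 1)"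
      by (simp add: consequences_def)
    have wc: "(w_one n 1 :: 'k gelem) \<in> gcarrier d"
    proof (cases "n = 1")
      case False
      then obtain k where "n = Suc (Suc k)" using n by (metis One_nat_def Suc_le_D not0_implies_Suc)
      moreover have "(0, yvar 1 * zvar 1 * right_poly (xgen 1 :: 'k gelem) ^ k) \<in> gcomponent d (1 + 1 + k)"
        using gcomponent_gmult[OF idx(1,1)[THEN xgen_in_gcomponent]]
        by (intro gcomponent_mult_right_power xgen_in_gcomponent[OF idx(1)]) (simp add: gmult_basis)
      ultimately show ?thesis by (simp add: w_one_def gcomponent_iff mult_ac)
    qed (use xgen_in_gcarrier[OF idx(1)] in \<open>simp add: w_one_def\<close>)
    show "GU_component d ?\<alpha> (n + 1) \<subseteq> consequences d ?\<alpha> (w_one n 1) (n + 1)"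
      unfolding GU_component_def
    proof (rule image_subsetI, rule consequences_memI[OF d1 wc])
      fix g :: "'k gelem" and J :: "'k gelem set"
      assume g: "g \<in> gcomponent d (n + 1)" and J: "T_ideal (G_alg d) J" "?U \<subseteq> J" "w_one n 1 \<in> J"
      interpret J: U_relations d J by (rule rel[OF J(1,2)])
      have mon: "yzmon a b \<in> poly_part J" if ab: "good_exp d a b" "exp_size a + exp_size b = n + 1" for a b
      proof -
        consider "n = 1" | "n = 2" | "n = 3" | "n \<ge> 4" using n by linarith
        then show ?thesis
        proof cases
          case 1
          \<comment> \<open>The endomorphism sending every generator to x_i carries x_1 to
            x_i.\<close>
          have x: "xgen i \<in> J" if "i \<in> {1..d}" for i
          proof -
            have "nendo (G_alg d) (gendo (\<lambda>_. xgen i :: 'k gelem))"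
              by (rule nendo_gendo) (rule xgen_in_gcarrier[OF that])
            moreover have "xgen 1 \<in> J" using J(3) 1 by (simp add: w_one_def)
            ultimately have "gendo (\<lambda>_. xgen i) (xgen 1) \<in> J"
              using J(1) unfolding T_ideal_def by blast
            then show ?thesis by simp
          qed
          have "exp_size a = 1" "exp_size b = 1" using ab 1 by (auto simp: good_exp_def)
          then obtain i j where ij: "a = delta i" "b = delta j" "i \<in> {1..d}" "j \<in> {1..d}"
            using ab(1) exp_size_1E unfolding good_exp_def by metis
          then have "gmult (xgen i) (xgen j) \<in> J"
            using J(1) x xgen_in_gcarrier unfolding T_ideal_def nideal_G_iff by blast
          then show ?thesis by (simp add: ij yzmon_delta poly_part_def gmult_basis)
        next
          case 2
          then show ?thesis using J(3) J.all_degree_3[OF _ ab(1)] ab(2)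
            by (simp add: w_one_def poly_part_def)
        next
          case 3
          then show ?thesis using J(3) J.all_degree_4[OF _ ab(1)] ab(2)
            by (simp add: w_one_def poly_part_def)
        next
          case 4
          then show ?thesis using J(3) J.all_degree_ge_5[OF _ 4 ab]
            by (simp add: w_one_def poly_part_def)
        qed
      qed
      have "snd g \<in> poly_part J"
      proof (rule poly_subspace_mem[OF J.subspace_V])
        fix a b assume "(a, b) \<in> Poly_Mapping.keys (snd g)"
        then have "good_exp d a b" "exp_size a + exp_size b = n + 1"
          using g unfolding gcomponent_iff gcarrier_iff by blast+
        then show "yzmon a b \<in> poly_part J" by (rule mon)
      qed
      moreover have "fst g = 0" by (rule gcomponent_poly[OF _ g]) (use n in simp)
      ultimately show "g \<in> J" by (cases g) (simp add: poly_part_def)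
    qed
  qed

  have part2: "consequences d ?\<alpha> (w_two 1 1 0) 3 = GL_submodule_gen d ?\<alpha> {w_two 2 1 1, w_two 2 1 0}"
  proof
    have w: "(0, br 1 2 :: 'k yz_poly) \<in> gcarrier d" using br_in_gcarrier[OF idx] by (simp add: poly_part_def)
    have comp: "(0, yvar 1 * br 1 2 :: 'k yz_poly) \<in> gcomponent d 3"
      "(0, zvar 1 * br 1 2 :: 'k yz_poly) \<in> gcomponent d 3"
      using gcomponent_gmult[OF xgen_in_gcomponent[OF idx(1)] br_in_gcomponent[OF idx]]
        gcomponent_gmult[OF br_in_gcomponent[OF idx] xgen_in_gcomponent[OF idx(1)]]
      by (simp_all add: gmult_basis mult.commute numeral_3_eq_3 numeral_2_eq_2)
    show "GL_submodule_gen d ?\<alpha> {w_two 2 1 1, w_two 2 1 0} \<subseteq> consequences d ?\<alpha> (w_two 1 1 0) 3"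
    proof (rule GL_submodule_gen_minimal)
      show "GL_submodule d ?\<alpha> (consequences d ?\<alpha> (w_two 1 1 0) 3)"
        unfolding w_two_eq by (rule GL_submodule_consequences[OF d1 w])
      have "GU_image d ?\<alpha> (0, q * br 1 2) \<in> consequences d ?\<alpha> (0, br 1 2) 3"
        if q: "q = yvar 1 \<or> q = zvar 1" for q
      proof (rule consequences_memI[OF d1 w])
        fix J :: "'k gelem set"
        assume J: "T_ideal (G_alg d) J" "(0, br 1 2) \<in> J"
        then show "(0, q * br 1 2) \<in> J"
          using T_ideal_var_mult[OF J(1) _ idx(1)] q by (auto simp: poly_part_def)
      qed (use comp q in auto)
      then show "GU_image d ?\<alpha> ` {w_two 2 1 1, w_two 2 1 0} \<subseteq> consequences d ?\<alpha> (w_two 1 1 0) 3"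
        unfolding w_two_eq by auto
    qed
    show "consequences d ?\<alpha> (w_two 1 1 0) 3 \<subseteq> GL_submodule_gen d ?\<alpha> {w_two 2 1 1, w_two 2 1 0}"
    proof
      fix X assume "X \<in> consequences d ?\<alpha> (w_two 1 1 0) 3"
      moreover have "(0, br 1 2 :: 'k yz_poly) \<in> merge_kernel d"
        by (rule merge_kernelI[OF br_in_gcomponent[OF idx] merge_br])
      ultimately obtain f where f: "X = GU_image d ?\<alpha> (0, f)" "(0, f) \<in> gcomponent d 3" "merge f = 0"
        using kernelE unfolding w_two_eq by blast
      show "X \<in> GL_submodule_gen d ?\<alpha> {w_two 2 1 1, w_two 2 1 0}"
        unfolding GL_submodule_gen_def f(1)
      proof safe
        fix N assume N: "GL_submodule d ?\<alpha> N" "GU_image d ?\<alpha> ` {w_two 2 1 1, w_two 2 1 0} \<subseteq> N"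
        interpret N: GL_module d ?\<alpha> N by unfold_locales (use assms(1) N(1) in auto)
        have base: "yvar 1 * br 1 2 \<in> N.W" "zvar 1 * br 1 2 \<in> N.W"
          using N(2) comp unfolding w_two_eq
          by (auto simp: GL_preimage_def poly_part_def gcomponent_iff)
        \<comment> \<open>The pullback of \<open>N\<close> contains the ideal of the variety and, by
          \<open>var_br_W\<close>, all y_k[i,j] and z_k[i,j]; in degree 3 these span the kernel of
          \<open>merge\<close>.\<close>
        have "f \<in> N.W"
          by (rule U.merge_kernel_degree_3[OF N.subspace_W GL_preimage_U[OF d1 N(1)] _ _ f(2,3)])
            (use N.var_br_W[of yvar] N.var_br_W[of zvar] base in auto)
        then show "GU_image d ?\<alpha> (0, f) \<in> N" by (simp add: GL_preimage_def)
      qed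
    qed
  qed

  have sq_comp: "(0, br 1 2 * br 1 2 :: 'k yz_poly) \<in> gcomponent d 4"
    using gcomponent_gmult[OF br_in_gcomponent[OF idx] br_in_gcomponent[OF idx]]
    by (simp add: gmult_basis)
  then have sq_carrier: "(0, br 1 2 * br 1 2 :: 'k yz_poly) \<in> gcarrier d" by (simp add: gcomponent_iff)

  have part3: "consequences d ?\<alpha> (gsmult \<beta>1 (w_two 2 1 1) + gsmult \<beta>2 (w_two 2 1 0)) 4
      = GL_submodule_gen d ?\<alpha> {w_two 2 2 0}" if \<beta>: "(\<beta>1, \<beta>2) \<noteq> (0, 0)" for \<beta>1 \<beta>2
  proof -
    define g where "g = (cst \<beta>1 * yvar 1 + cst \<beta>2 * zvar 1) * br 1 2"
    have w: "gsmult \<beta>1 (w_two 2 1 1) + gsmult \<beta>2 (w_two 2 1 0) = (0, g)"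
      unfolding w_two_eq gsmult_pair g_def by (simp add: algebra_simps)
    have g_eq: "g = cst \<beta>1 * (yvar 1 * br 1 2) + cst \<beta>2 * (zvar 1 * br 1 2)"
      by (simp add: g_def algebra_simps)
    have "g \<in> poly_part (gcarrier d)"
      unfolding g_eq
      by (intro poly_subspaceD(2,3)[OF gcarrier_poly_subspace] gcarrier_var_mult br_in_gcarrier idx)
    then have gc: "(0, g) \<in> gcarrier d" by (simp add: poly_part_def)
    have gk: "(0, g) \<in> merge_kernel d"
      using gc by (simp add: merge_kernel_def g_def merge_mult merge_br)
    show ?thesis
      unfolding w
    proof
      show "GL_submodule_gen d ?\<alpha> {w_two 2 2 0} \<subseteq> consequences d ?\<alpha> (0, g) 4"
      proof (rule GL_submodule_gen_minimal)
        show "GL_submodule d ?\<alpha> (consequences d ?\<alpha> (0, g) 4)"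
          by (rule GL_submodule_consequences[OF d1 gc])
        have "GU_image d ?\<alpha> (0, br 1 2 * br 1 2) \<in> consequences d ?\<alpha> (0, g) 4"
        proof (rule consequences_memI[OF d1 gc sq_comp])
          fix J :: "'k gelem set"
          assume J: "T_ideal (G_alg d) J" "?U \<subseteq> J" "(0, g) \<in> J"
          interpret J: U_relations d J by (rule rel[OF J(1,2)])
          have "g \<in> poly_part J" using J(3) by (simp add: poly_part_def)
          note yg = J.V_var_mult(1)[OF this idx(2)] and zg = J.V_var_mult(2)[OF this idx(2)]
          have "br 1 2 * br 1 2 \<in> poly_part J"
          proof (cases "\<beta>1 = 0")
            case True
            then have "\<beta>2 \<noteq> 0" using \<beta> by simp
            \<comment> \<open>Here y_2 g is \<beta>2 times y_2 z_1 [1,2]. Moreover [1,2]^2 + 2 y_2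
              z_1 [1,2] = y_1^2 z_2^2 - y_2^2 z_1^2 lies in the ideal by \<open>exchange_V\<close>,
              so [1,2]^2 is congruent to -2 y_2 z_1 [1,2].\<close>
            have "cst \<beta>2 * (br 1 2 * br 1 2) =
                cst \<beta>2 * (br 1 2 * br 1 2 + 2 * (yvar 2 * zvar 1 * br 1 2)) - (yvar 2 * g + yvar 2 * g)"
              by (simp add: g_def True algebra_simps)
            also have "\<dots> \<in> poly_part J"
            proof (rule J.V_closed(5)[OF J.V_closed(3) J.V_closed(2)[OF yg yg]])
              have "br 1 2 * br 1 2 + 2 * (yvar 2 * zvar 1 * br 1 2)
                  = yvar 1 * yvar 1 * zvar 2 * zvar 2 - yvar 2 * yvar 2 * zvar 1 * (zvar 1 :: 'k yz_poly)"
                by (simp add: br_def algebra_simps)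
              then show "br 1 2 * br 1 2 + 2 * (yvar 2 * zvar 1 * br 1 2) \<in> poly_part J"
                using J.exchange_V[OF idx(1,2,2,1)] by simp
            qed
            finally show ?thesis using \<open>\<beta>2 \<noteq> 0\<close> by (rule poly_subspace_cancel[OF J.subspace_V])
          next
            case False
            \<comment> \<open>Multiplication by z_2 works here: z_2 z_1 [1,2] lies in the ideal by
              \<open>linear_swap_V\<close>, which removes the \<beta>2 term, and 2 z_2 y_1 [1,2] is
              congruent to [1,2]^2 by \<open>exchange_V\<close>.\<close>
            have "cst \<beta>1 * (br 1 2 * br 1 2) =
                cst \<beta>1 * (br 1 2 * br 1 2 - 2 * (zvar 2 * yvar 1 * br 1 2))
                - cst \<beta>2 * (2 * (zvar 2 * zvar 1 * br 1 2)) + (zvar 2 * g + zvar 2 * g)"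
              by (simp add: g_def algebra_simps)
            also have "\<dots> \<in> poly_part J"
            proof (rule J.V_closed(2)[OF J.V_closed(5)[OF J.V_closed(3) J.V_closed(3)] J.V_closed(2)[OF zg zg]])
              have "br 1 2 * br 1 2 - 2 * (zvar 2 * yvar 1 * br 1 2)
                  = yvar 2 * yvar 2 * zvar 1 * zvar 1 - yvar 1 * yvar 1 * zvar 2 * (zvar 2 :: 'k yz_poly)"
                by (simp add: br_def algebra_simps)
              then show "br 1 2 * br 1 2 - 2 * (zvar 2 * yvar 1 * br 1 2) \<in> poly_part J"
                using J.exchange_V[OF idx(2,1,1,2)] by simp
              have "yvar 1 * zvar 2 * zvar 2 * zvar 1 - yvar 2 * zvar 1 * zvar 2 * zvar 1 \<in> poly_part J"
                by (rule J.linear_swap_V[OF idx(1,2,2,1)])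
              moreover have "yvar 1 * zvar 2 * zvar 2 * zvar 1 - yvar 2 * zvar 1 * zvar 2 * zvar 1
                  = zvar 2 * zvar 1 * (br 1 2 :: 'k yz_poly)"
                by (simp add: br_def algebra_simps)
              ultimately have "zvar 2 * zvar 1 * br 1 2 \<in> poly_part J" by (simp only:)
              then show "2 * (zvar 2 * zvar 1 * br 1 2) \<in> poly_part J"
                using J.V_closed(3)[of _ 2] by simp
            qed
            finally show ?thesis using False by (rule poly_subspace_cancel[OF J.subspace_V])
          qed
          then show "(0, br 1 2 * br 1 2) \<in> J" by (simp add: poly_part_def)
        qed
        then show "GU_image d ?\<alpha> ` {w_two 2 2 0} \<subseteq> consequences d ?\<alpha> (0, g) 4"
          unfolding w_two_eq by simp
      qed
      show "consequences d ?\<alpha> (0, g) 4 \<subseteq> GL_submodule_gen d ?\<alpha> {w_two 2 2 0}"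
      proof
        fix X assume "X \<in> consequences d ?\<alpha> (0, g) 4"
        then obtain f where f: "X = GU_image d ?\<alpha> (0, f)" "(0, f) \<in> gcomponent d 4" "merge f = 0"
          using kernelE gk by blast
        show "X \<in> GL_submodule_gen d ?\<alpha> {w_two 2 2 0}"
          unfolding GL_submodule_gen_def f(1)
        proof safe
          fix N assume N: "GL_submodule d ?\<alpha> N" "GU_image d ?\<alpha> ` {w_two 2 2 0} \<subseteq> N"
          interpret N: GL_module d ?\<alpha> N by unfold_locales (use assms(1) N(1) in auto)
          have base: "br 1 2 * br 1 2 \<in> N.W"
            using N(2) sq_carrier unfolding w_two_eq by (simp add: GL_preimage_def poly_part_def)
          have "f \<in> N.W"
            by (rule U.merge_kernel_degree_4[OF N.subspace_W GL_preimage_U[OF d1 N(1)]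
                  N.br_br_W[OF base] f(2,3)])
          then show "GU_image d ?\<alpha> (0, f) \<in> N" by (simp add: GL_preimage_def)
        qed
      qed
    qed
  qed

  have part4: "consequences d ?\<alpha> (w_two 2 2 0) m = {nzero (GU_alg d ?\<alpha>)}" if m: "m > 4" for m
  proof
    show "{nzero (GU_alg d ?\<alpha>)} \<subseteq> consequences d ?\<alpha> (w_two 2 2 0) m"
      using zero_mem[OF sq_carrier] by (simp add: nzero_GU[OF d1] w_two_eq)
    show "consequences d ?\<alpha> (w_two 2 2 0) m \<subseteq> {nzero (GU_alg d ?\<alpha>)}"
    proof
      fix X assume "X \<in> consequences d ?\<alpha> (w_two 2 2 0) m"
      moreover have "(0, br 1 2 * br 1 2 :: 'k yz_poly) \<in> merge_kernel d"
        by (rule merge_kernelI[OF sq_comp]) (simp add: merge_mult merge_br)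
      ultimately obtain f where f: "X = GU_image d ?\<alpha> (0, f)" "(0, f) \<in> gcomponent d m" "merge f = 0"
        using kernelE unfolding w_two_eq by blast
      \<comment> \<open>From degree 5 on the kernel of \<open>merge\<close> lies in the ideal of the
        variety itself, so its elements are zero in the factor algebra.\<close>
      have "f \<in> poly_part ?U" by (rule U.merge_kernel_degree_5[OF _ f(2,3)]) (use m in simp)
      then show "X \<in> {nzero (GU_alg d ?\<alpha>)}"
        by (simp add: f(1) nzero_GU[OF d1] GU_image_eq_iff[OF d1] poly_part_def)
    qed
  qed
  show ?thesis using part1 part2 part3 part4 by blast
qed

end
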